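(* Let $(\mathcal H,U)$ and $(\mathcal K,V)$ be $\mathbb Z_2$-graded Hilbert spaces and let $\mathcal M\subset\mathcal B(\mathcal H)$ and $\mathcal N\subset\mathcal B(\mathcal K)$ be von Neumann algebras such that $U\mathcal MU=\mathcal M$ and $V\mathcal NV=\mathcal N$. Then $$(\mathcal M\,\hat\otimes\,\mathcal N)^{\wr}=\mathcal M^{\wr}\,\hat\otimes\,\mathcal N^{\wr}.$$
   Context: A $\mathbb Z_2$-graded Hilbert space is a pair $(\mathcal H,U)$ with $U$ a self-adjoint unitary on $\mathcal H$. Vectors with $U\xi=\xi$ ($U\xi=-\xi$) are even (odd); operators with $UTU=T$ ($UTU=-T$) are even (odd); homogeneous means even or odd. Every $T\in\mathcal B(\mathcal H)$ is uniquely $T=T_++T_-$ with $T_+$ even and $T_-$ odd. The tensor product $\mathcal H\otimes\mathcal K$ of $(\mathcal H,U)$ and $(\mathcal K,V)$ is graded by $U\otimes V$. The twist automorphism is $\eta_U(T_++T_-)=T_++iUT_-$, and the twisted commutant of $\mathcal M\subset\mathcal B(\mathcal H)$ with $U\mathcal MU=\mathcal M$ is $\mathcal M^{\wr}=\eta_U(\mathcal M')=\eta_U(\mathcal M)'$. On $\mathcal H\otimes\mathcal K$ it is taken with respect to $U\otimes V$. For homogeneous operators $T_1\in\mathcal B(\mathcal H)$, $T_2\in\mathcal B(\mathcal K)$, $T_1\hat\otimes T_2$ is the operator on $\mathcal H\otimes\mathcal K$ with $(T_1\hat\otimes T_2)(\xi_1\otimes\xi_2)=\varepsilon(T_2,\xi_1)\,T_1\xi_1\otimes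 T_2\xi_2$ for homogeneous $\xi_1,\xi_2$, where $\varepsilon(T_2,\xi_1)=-1$ if $T_2$ and $\xi_1$ are both odd and $1$ otherwise; it is extended bilinearly. $\mathcal M\hat\otimes\mathcal N$ is the von Neumann algebra on $\mathcal H\otimes\mathcal K$ generated by the operators $T_1\hat\otimes T_2$, $T_1\in\mathcal M$, $T_2\in\mathcal N$. *)

theory Defs
  imports "HOL-Analysis.Analysis"
begin

section \<open>Complex Hilbert spaces\<close>

class scaleC =
  fixes scaleC :: "complex \<Rightarrow> 'a \<Rightarrow> 'a" (infixr "*\<^sub>C" 75)

text \<open>The inner product is antilinear in the first and linear in the second variable.\<close>

class complex_inner = real_normed_vector + scaleC +
  fixes cinner :: "'a \<Rightarrow> 'a \<Rightarrow> complex"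
  assumes scaleR_scaleC: "r *\<^sub>R x = complex_of_real r *\<^sub>C x"
    and scaleC_add_right: "c *\<^sub>C (x + y) = c *\<^sub>C x + c *\<^sub>C y"
    and scaleC_add_left: "(c + d) *\<^sub>C x = c *\<^sub>C x + d *\<^sub>C x"
    and scaleC_scaleC: "c *\<^sub>C d *\<^sub>C x = (c * d) *\<^sub>C x"
    and cinner_commute: "cinner x y = cnj (cinner y x)"
    and cinner_add_right: "cinner x (y + z) = cinner x y + cinner x z"
    and cinner_scaleC_right: "cinner x (c *\<^sub>C y) = c * cinner x y"
    and cinner_self_nonneg: "0 \<le> Re (cinner x x)"
    and cinner_self_eq_zero_iff: "cinner x x = 0 \<longleftrightarrow> x = 0"
    and norm_eq_sqrt_cinner: "norm x = sqrt (Re (cinner x x))"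

class chilbert_space = complex_inner + complete_space

lemma scaleC_one: "1 *\<^sub>C x = (x :: 'a::complex_inner)"
  using scaleR_scaleC[of 1 x] by simp

global_interpretation complex_vector: vector_space "scaleC :: complex \<Rightarrow> 'a \<Rightarrow> 'a::complex_inner"
  by unfold_locales (simp_all add: scaleC_add_right scaleC_add_left scaleC_scaleC scaleC_one)

abbreviation clinear :: "('a::complex_inner \<Rightarrow> 'b::complex_inner) \<Rightarrow> bool" where
  "clinear \<equiv> Vector_Spaces.linear scaleC scaleC"


section \<open>Bounded operators and von Neumann algebras\<close>

definition bounded_clinear :: "('a::complex_inner \<Rightarrow> 'b::complex_inner) \<Rightarrow> bool" where
  "bounded_clinear T \<longleftrightarrow> clinear T \<and> bounded_linear T"

definition cadjoint :: "('a::chilbert_space \<Rightarrow> 'a) \<Rightarrow> 'a \<Rightarrow> 'a" where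
  "cadjoint T = (THE S. bounded_clinear S \<and> (\<forall>x y. cinner (S x) y = cinner x (T y)))"

definition commutant :: "('a::chilbert_space \<Rightarrow> 'a) set \<Rightarrow> ('a \<Rightarrow> 'a) set" where
  "commutant M = {T. bounded_clinear T \<and> (\<forall>S\<in>M. T \<circ> S = S \<circ> T)}"

definition unital_star_subalgebra :: "('a::chilbert_space \<Rightarrow> 'a) set \<Rightarrow> bool" where
  "unital_star_subalgebra M \<longleftrightarrow>
     M \<subseteq> Collect bounded_clinear \<and> id \<in> M \<and>
     (\<forall>S\<in>M. \<forall>T\<in>M. (\<lambda>x. S x + T x) \<in> M) \<and>
     (\<forall>c. \<forall>T\<in>M. (\<lambda>x. c *\<^sub>C T x) \<in> M) \<and>
     (\<forall>S\<in>M. \<forall>T\<in>M. S \<circ> T \<in> M) \<and>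
     (\<forall>T\<in>M. cadjoint T \<in> M)"

text \<open>The definition of Dixmier and Takesaki: a $*$-algebra of bounded operators that equals
  its double commutant.\<close>

definition von_neumann_algebra :: "('a::chilbert_space \<Rightarrow> 'a) set \<Rightarrow> bool" where
  "von_neumann_algebra M \<longleftrightarrow> unital_star_subalgebra M \<and> commutant (commutant M) = M"

definition vN_generated :: "('a::chilbert_space \<Rightarrow> 'a) set \<Rightarrow> ('a \<Rightarrow> 'a) set" where
  "vN_generated S = \<Inter> {A. von_neumann_algebra A \<and> S \<subseteq> A}"


section \<open>Gradings and the twisted commutant\<close>

definition selfadjoint_unitary :: "('a::chilbert_space \<Rightarrow> 'a) \<Rightarrow> bool" where
  "selfadjoint_unitary U \<longleftrightarrow>
     bounded_clinear U \<and> cadjoint U = U \<and> cadjoint U \<circ> U = id \<and> U \<circ> cadjoint U = id"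

definition even_vec :: "('a::chilbert_space \<Rightarrow> 'a) \<Rightarrow> 'a \<Rightarrow> bool" where
  "even_vec U x \<longleftrightarrow> U x = x"

definition odd_vec :: "('a::chilbert_space \<Rightarrow> 'a) \<Rightarrow> 'a \<Rightarrow> bool" where
  "odd_vec U x \<longleftrightarrow> U x = - x"

definition homogeneous_vec :: "('a::chilbert_space \<Rightarrow> 'a) \<Rightarrow> 'a \<Rightarrow> bool" where
  "homogeneous_vec U x \<longleftrightarrow> even_vec U x \<or> odd_vec U x"

definition even_op :: "('a::chilbert_space \<Rightarrow> 'a) \<Rightarrow> ('a \<Rightarrow> 'a) \<Rightarrow> bool" where
  "even_op U T \<longleftrightarrow> U \<circ> T \<circ> U = T"

definition odd_op :: "('a::chilbert_space \<Rightarrow> 'a) \<Rightarrow> ('a \<Rightarrow> 'a) \<Rightarrow> bool" where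
  "odd_op U T \<longleftrightarrow> U \<circ> T \<circ> U = (\<lambda>x. - T x)"

definition even_part :: "('a::chilbert_space \<Rightarrow> 'a) \<Rightarrow> ('a \<Rightarrow> 'a) \<Rightarrow> 'a \<Rightarrow> 'a" where
  "even_part U T = (\<lambda>x. (1/2) *\<^sub>C (T x + U (T (U x))))"

definition odd_part :: "('a::chilbert_space \<Rightarrow> 'a) \<Rightarrow> ('a \<Rightarrow> 'a) \<Rightarrow> 'a \<Rightarrow> 'a" where
  "odd_part U T = (\<lambda>x. (1/2) *\<^sub>C (T x - U (T (U x))))"

lemma selfadjoint_unitary_involution:
  "selfadjoint_unitary U \<Longrightarrow> U (U x) = x"
  unfolding selfadjoint_unitary_def by (metis comp_apply id_apply)

text \<open>These explicit formulas do give the unique even and odd summands of an operator.\<close>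

lemma even_odd_decomposition:
  assumes U: "selfadjoint_unitary U"
  shows "even_op U (even_part U T)" "odd_op U (odd_part U T)"
    and "T = (\<lambda>x. even_part U T x + odd_part U T x)"
    and "\<lbrakk>even_op U A; odd_op U B; T = (\<lambda>x. A x + B x)\<rbrakk> \<Longrightarrow> A = even_part U T \<and> B = odd_part U T"
proof -
  have lin: "U (x + y) = U x + U y" "U (x - y) = U x - U y" "U (- x) = - U x"
    "U (c *\<^sub>C x) = c *\<^sub>C U x" for x y c
    using U unfolding selfadjoint_unitary_def bounded_clinear_def Vector_Spaces.linear_def
    by (auto simp: module_hom.add module_hom.diff module_hom.neg module_hom.scale)
  have half: "(1/2) *\<^sub>C (x + x) = x" for x :: 'a
  proof -
    have "(1/2) *\<^sub>C (x + x) = (1/2 + 1/2) *\<^sub>C x"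
      unfolding scaleC_add_left scaleC_add_right ..
    then show ?thesis by (simp add: scaleC_one)
  qed
  note inv = selfadjoint_unitary_involution[OF U]
  show "even_op U (even_part U T)"
    unfolding even_op_def even_part_def by (rule ext) (simp add: lin inv add.commute)
  have "U (odd_part U T (U x)) = - odd_part U T x" for x
  proof -
    have "U (odd_part U T (U x)) = (1/2) *\<^sub>C (- (T x - U (T (U x))))"
      unfolding odd_part_def lin inv by simp
    then show ?thesis
      unfolding odd_part_def complex_vector.scale_minus_right .
  qed
  then show "odd_op U (odd_part U T)"
    unfolding odd_op_def by (intro ext) simp
  have "even_part U T x + odd_part U T x = T x" for x
  proof -
    have "even_part U T x + odd_part U T x =
        (1/2) *\<^sub>C ((T x + U (T (U x))) + (T x - U (T (U x))))"
      unfolding even_part_def odd_part_def complex_vector.scale_right_distrib[symmetric] ..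
    also have "(T x + U (T (U x))) + (T x - U (T (U x))) = T x + T x"
      by simp
    finally show ?thesis
      unfolding half .
  qed
  then show "T = (\<lambda>x. even_part U T x + odd_part U T x)"
    by (intro ext) simp
  show "A = even_part U T \<and> B = odd_part U T"
    if "even_op U A" "odd_op U B" "T = (\<lambda>x. A x + B x)"
  proof -
    have AB: "U (A (U x)) = A x" "U (B (U x)) = - B x" for x
      using that(1,2) unfolding even_op_def odd_op_def by (metis comp_apply)+
    have "T x + U (T (U x)) = A x + A x" "T x - U (T (U x)) = B x + B x" for x
      unfolding that(3) lin AB by simp_all
    then show ?thesis
      unfolding even_part_def odd_part_def by (simp only: half)
  qed
qed

definition twist :: "('a::chilbert_space \<Rightarrow> 'a) \<Rightarrow> ('a \<Rightarrow> 'a) \<Rightarrow> 'a \<Rightarrow> 'a" where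
  "twist U T = (\<lambda>x. even_part U T x + \<i> *\<^sub>C U (odd_part U T x))"

definition twisted_commutant ::
    "('a::chilbert_space \<Rightarrow> 'a) \<Rightarrow> ('a \<Rightarrow> 'a) set \<Rightarrow> ('a \<Rightarrow> 'a) set" where
  "twisted_commutant U M = twist U ` commutant M"


section \<open>Tensor products\<close>

text \<open>A Hilbert space tensor product of two spaces consists of a Hilbert space together with a
  bilinear map into it whose values span a dense subspace and satisfy
  $\langle x \otimes y, x' \otimes y' \rangle = \langle x, x' \rangle \langle y, y' \rangle$; in other
  words, the space is the completion of the algebraic tensor product. This fixes it up to a unique
  unitary compatible with the bilinear maps. The map is a parameter of everything below, so
  that no particular model of the tensor product is singled out.\<close>

definition hilbert_tensor ::
    "('h::chilbert_space \<Rightarrow> 'k::chilbert_space \<Rightarrow> 'l::chilbert_space) \<Rightarrow> bool" where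
  "hilbert_tensor tens \<longleftrightarrow>
     (\<forall>y. clinear (\<lambda>x. tens x y)) \<and>
     (\<forall>x. clinear (tens x)) \<and>
     (\<forall>x y x' y'. cinner (tens x y) (tens x' y') = cinner x x' * cinner y y') \<and>
     closure (complex_vector.span {tens x y | x y. True}) = UNIV"

definition tensor_op ::
    "('h::chilbert_space \<Rightarrow> 'k::chilbert_space \<Rightarrow> 'l::chilbert_space) \<Rightarrow>
      ('h \<Rightarrow> 'h) \<Rightarrow> ('k \<Rightarrow> 'k) \<Rightarrow> 'l \<Rightarrow> 'l" where
  "tensor_op tens S T =
     (THE R. bounded_clinear R \<and> (\<forall>x y. R (tens x y) = tens (S x) (T y)))"

definition grading_sign ::
    "('h::chilbert_space \<Rightarrow> 'h) \<Rightarrow> ('k::chilbert_space \<Rightarrow> 'k) \<Rightarrow> ('k \<Rightarrow> 'k) \<Rightarrow> 'h \<Rightarrow> complex" where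
  "grading_sign U V T x = (if odd_op V T \<and> odd_vec U x then -1 else 1)"

text \<open>The defining formula, meant for homogeneous operators. The zero operator and the zero
  vector are both even and odd, but there the sign is irrelevant.\<close>

definition homogeneous_graded_tensor_op ::
    "('h::chilbert_space \<Rightarrow> 'k::chilbert_space \<Rightarrow> 'l::chilbert_space) \<Rightarrow>
      ('h \<Rightarrow> 'h) \<Rightarrow> ('k \<Rightarrow> 'k) \<Rightarrow> ('h \<Rightarrow> 'h) \<Rightarrow> ('k \<Rightarrow> 'k) \<Rightarrow> 'l \<Rightarrow> 'l" where
  "homogeneous_graded_tensor_op tens U V S T =
     (THE R. bounded_clinear R \<and>
        (\<forall>x y. homogeneous_vec U x \<longrightarrow> homogeneous_vec V y \<longrightarrow>
           R (tens x y) = grading_sign U V T x *\<^sub>C tens (S x) (T y)))"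

text \<open>Bilinear extension to arbitrary operators.\<close>

definition graded_tensor_op ::
    "('h::chilbert_space \<Rightarrow> 'k::chilbert_space \<Rightarrow> 'l::chilbert_space) \<Rightarrow>
      ('h \<Rightarrow> 'h) \<Rightarrow> ('k \<Rightarrow> 'k) \<Rightarrow> ('h \<Rightarrow> 'h) \<Rightarrow> ('k \<Rightarrow> 'k) \<Rightarrow> 'l \<Rightarrow> 'l" where
  "graded_tensor_op tens U V S T = (\<lambda>z.
     homogeneous_graded_tensor_op tens U V (even_part U S) (even_part V T) z +
     homogeneous_graded_tensor_op tens U V (even_part U S) (odd_part V T) z +
     homogeneous_graded_tensor_op tens U V (odd_part U S) (even_part V T) z +
     homogeneous_graded_tensor_op tens U V (odd_part U S) (odd_part V T) z)"

definition graded_tensor_algebra ::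
    "('h::chilbert_space \<Rightarrow> 'k::chilbert_space \<Rightarrow> 'l::chilbert_space) \<Rightarrow>
      ('h \<Rightarrow> 'h) \<Rightarrow> ('k \<Rightarrow> 'k) \<Rightarrow> ('h \<Rightarrow> 'h) set \<Rightarrow> ('k \<Rightarrow> 'k) set \<Rightarrow> ('l \<Rightarrow> 'l) set" where
  "graded_tensor_algebra tens U V M N =
     vN_generated {graded_tensor_op tens U V S T | S T. S \<in> M \<and> T \<in> N}"

end

theory Submission
  imports Defs
begin

text \<open>The twist is implemented by a unitary, so the claim is that a generating set of the graded
  tensor product of \<open>M\<close> and \<open>N\<close>, and one built from their commutants, have commuting
  commutants. An operator \<open>C\<close> commuting with the first set is split by the grading \<open>U \<otimes> 1\<close>.
  The even part commutes with the ungraded tensor product of \<open>M \<or> {U}\<close> and \<open>N\<close>, so the ordinary commutation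
  theorem applies; the odd part is reduced to the even one by multiplying with odd elements of the
  commutant of \<open>M\<close>.

  The ordinary commutation theorem is proved with bounded operators only, in the spirit of Rieffel
  and van Daele. For a \<open>*\<close>-algebra \<open>M\<close> and a vector \<open>\<omega>\<close>, the real subspaces \<open>M\<^sub>s\<^sub>a \<omega>\<close> and
  \<open>\<i> (M')\<^sub>s\<^sub>a \<omega>\<close> are real-orthogonal and, after projecting, span a dense subspace of the closure
  of \<open>M \<omega>\<close>. This density passes to tensor products: a vector orthogonal to the products gives
  antilinear maps between the factors whose composition \<open>W\<close> is positive and maps a closed
  real subspace \<open>L\<close> into \<open>\<i> L\<close>; being the square root of \<open>W\<^sup>2\<close>, it also maps \<open>L\<close> into itself, and
  \<open>L \<inter> \<i> L = 0\<close>. Density makes \<open>\<langle>T \<omega>, S \<omega>\<rangle>\<close> real for self-adjoint \<open>T\<close> and \<open>S\<close> in the two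
  commutants and elementary tensors \<open>\<omega>\<close>, and polarization gives \<open>T S = S T\<close>.\<close>

section \<open>Hilbert space geometry\<close>

text \<open>The inclusion of one generating set in the commutant of the other is a sign check.
  Equality needs the commutant of one set to lie in the bicommutant of the other, which is why the
  claim is phrased through two commuting commutants. The twist is an automorphism, so it can be
  undone before any analysis starts. The obstacle on the graded side is that \<open>U\<close> need
  not lie in \<open>M\<close>. An odd \<open>y\<close> contributes only
  \<open>U \<otimes> y\<close>, and \<open>1 \<otimes> y\<close> becomes available only after
  adjoining \<open>U \<otimes> 1\<close>. This enlarges the algebra and shrinks its commutant, so
  the ordinary theorem reaches only those \<open>C\<close> that commute with
  \<open>U \<otimes> 1\<close>. The obstacle on the ungraded side is that \<open>M\<close> is
  arbitrary: a vector that is both cyclic and separating may not exist, and x \<omega> \<mapsto> x*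
  \<omega> may be ill defined or unbounded. The closed real subspace of those v in the closure of M
  \<omega> for which <x \<omega>, v> is real for all self-adjoint x in \<open>M\<close> always
  exists. It takes over the role of that map, and only bounded projections are needed to work with
  it.\<close>

instance chilbert_space \<subseteq> banach ..

section \<open>Sesquilinearity and the Cauchy-Schwarz inequality\<close>

lemma cinner_add_left: "cinner (x + y) z = cinner x z + cinner y (z :: 'a::complex_inner)"
  by (metis cinner_add_right cinner_commute complex_cnj_add)

lemma cinner_scaleC_left: "cinner (c *\<^sub>C x) (y :: 'a::complex_inner) = cnj c * cinner x y"
  by (metis cinner_commute cinner_scaleC_right complex_cnj_mult)

lemma cinner_scaleR_right: "cinner x (r *\<^sub>R (y :: 'a::complex_inner)) = of_real r * cinner x y"
  by (simp add: scaleR_scaleC cinner_scaleC_right)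

lemma cinner_scaleR_left: "cinner (r *\<^sub>R x) (y :: 'a::complex_inner) = of_real r * cinner x y"
  by (simp add: scaleR_scaleC cinner_scaleC_left)

lemma cinner_minus_right: "cinner x (- y :: 'a::complex_inner) = - cinner x y"
  using cinner_scaleR_right[of x "-1" y] by simp

lemma cinner_minus_left: "cinner (- x :: 'a::complex_inner) y = - cinner x y"
  using cinner_scaleR_left[of "-1" x y] by simp

lemma cinner_zero_right: "cinner x (0 :: 'a::complex_inner) = 0"
  using cinner_scaleR_right[of x 0 0] by simp

lemma cinner_zero_left: "cinner (0 :: 'a::complex_inner) y = 0"
  using cinner_scaleR_left[of 0 0 y] by simp

lemma cinner_diff_right: "cinner x (y - z :: 'a::complex_inner) = cinner x y - cinner x z"
  using cinner_add_right[of x y "- z"] by (simp add: cinner_minus_right)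

lemma cinner_diff_left: "cinner (x - y :: 'a::complex_inner) z = cinner x z - cinner y z"
  using cinner_add_left[of x "- y" z] by (simp add: cinner_minus_left)

lemmas cinner_simps = cinner_add_left cinner_add_right cinner_scaleC_left cinner_scaleC_right
  cinner_scaleR_left cinner_scaleR_right cinner_minus_left cinner_minus_right
  cinner_zero_left cinner_zero_right cinner_diff_left cinner_diff_right

lemma cinner_self: "cinner x (x :: 'a::complex_inner) = of_real ((norm x)\<^sup>2)"
proof -
  have "Im (cinner x x) = Im (cnj (cinner x x))" using cinner_commute[of x x] by metis
  then have "Im (cinner x x) = 0" by simp
  moreover have "(norm x)\<^sup>2 = Re (cinner x x)"
    unfolding norm_eq_sqrt_cinner by (rule real_sqrt_pow2) (rule cinner_self_nonneg)
  ultimately show ?thesis by (simp add: complex_eq_iff)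
qed

lemma Re_cinner_commute: "Re (cinner x y) = Re (cinner y (x :: 'a::complex_inner))"
  by (subst cinner_commute) simp

lemma norm_add_squared:
  "(norm (x + y))\<^sup>2 = (norm x)\<^sup>2 + (norm y)\<^sup>2 + 2 * Re (cinner x (y :: 'a::complex_inner))"
proof -
  have "of_real ((norm (x + y))\<^sup>2) = cinner (x + y) (x + y)" by (rule cinner_self[symmetric])
  also have "\<dots> = of_real ((norm x)\<^sup>2) + of_real ((norm y)\<^sup>2) + (cinner x y + cinner y x)"
    unfolding cinner_add_left cinner_add_right cinner_self[of x] cinner_self[of y]
    by (simp only: ac_simps)
  finally have "Re (of_real ((norm (x + y))\<^sup>2)) =
      Re (of_real ((norm x)\<^sup>2) + of_real ((norm y)\<^sup>2) + (cinner x y + cinner y x))"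
    by (rule arg_cong)
  then show ?thesis
    unfolding plus_complex.sel Re_complex_of_real Re_cinner_commute[of y x] by simp
qed

lemma norm_diff_squared:
  "(norm (x - y))\<^sup>2 = (norm x)\<^sup>2 + (norm y)\<^sup>2 - 2 * Re (cinner x (y :: 'a::complex_inner))"
  using norm_add_squared[of x "- y"] by (simp add: cinner_simps)

lemma norm_scaleC: "norm (c *\<^sub>C (x :: 'a::complex_inner)) = cmod c * norm x"
proof -
  have "of_real ((norm (c *\<^sub>C x))\<^sup>2) = c * cnj c * of_real ((norm x)\<^sup>2)"
    unfolding cinner_self[symmetric] by (simp add: cinner_simps)
  then have "(norm (c *\<^sub>C x))\<^sup>2 = (cmod c * norm x)\<^sup>2"
    unfolding complex_mult_cnj cmod_power2[symmetric] power_mult_distrib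
    by (metis of_real_eq_iff of_real_mult)
  then show ?thesis by simp
qed

lemma Re_cinner_bound: "\<bar>Re (cinner x y)\<bar> \<le> norm x * norm (y :: 'a::complex_inner)"
proof -
  have *: "Re (cinner x y) \<le> norm x * norm y" for x y :: 'a
  proof (cases "x = 0 \<or> y = 0")
    case True then show ?thesis by (auto simp: cinner_simps)
  next
    case False
    then have pos: "norm x * norm y > 0" by simp
    have "0 \<le> (norm (norm y *\<^sub>R x - norm x *\<^sub>R y))\<^sup>2" by simp
    also have "\<dots> = 2 * (norm x * norm y) * (norm x * norm y - Re (cinner x y))"
      unfolding norm_diff_squared by (simp add: cinner_simps power2_eq_square algebra_simps)
    finally show ?thesis using pos by (simp add: zero_le_mult_iff)
  qed
  from *[of x y] *[of "- x" y] show ?thesis by (simp add: cinner_simps abs_le_iff)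
qed

lemma cinner_bound: "cmod (cinner x y) \<le> norm x * norm (y :: 'a::complex_inner)"
proof (cases "cinner x y = 0")
  case False
  \<comment> \<open>The phase \<open>c\<close> turns <x, y> into its modulus, which reduces the
    complex bound to the real one.\<close>
  define c where "c = cnj (cinner x y) / of_real (cmod (cinner x y))"
  have c: "cmod c = 1" using False by (simp add: c_def norm_divide)
  have "cinner x (c *\<^sub>C y) = of_real (cmod (cinner x y))"
    using False by (simp add: cinner_simps c_def complex_norm_square[symmetric] power2_eq_square mult.commute)
  then show ?thesis
    using Re_cinner_bound[of x "c *\<^sub>C y"] c by (simp add: norm_scaleC)
qed simp

lemma bounded_bilinear_cinner: "bounded_bilinear (cinner :: 'a::complex_inner \<Rightarrow> _)"
proof
  show "\<exists>K. \<forall>a b. norm (cinner a (b::'a)) \<le> norm a * norm b * K"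
    by (intro exI[of _ 1]) (simp add: cinner_bound)
qed (simp_all add: cinner_simps scaleR_conv_of_real)

interpretation cinner: bounded_bilinear "cinner :: 'a::complex_inner \<Rightarrow> _"
  by (rule bounded_bilinear_cinner)

lemma bounded_bilinear_scaleC: "bounded_bilinear (scaleC :: complex \<Rightarrow> 'a::complex_inner \<Rightarrow> _)"
proof
  show "\<exists>K. \<forall>a b. norm (scaleC a (b::'a)) \<le> norm a * norm b * K"
    by (intro exI[of _ 1]) (simp add: norm_scaleC)
qed (simp_all add: scaleC_add_left scaleC_add_right scaleR_scaleC scaleC_scaleC scaleR_conv_of_real
       mult.commute)

interpretation scaleC: bounded_bilinear "scaleC :: complex \<Rightarrow> 'a::complex_inner \<Rightarrow> _"
  by (rule bounded_bilinear_scaleC)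

lemma cinner_eqI:
  assumes "\<And>z. cinner z x = cinner z (y :: 'a::complex_inner)"
  shows "x = y"
proof -
  have "cinner (x - y) (x - y) = 0" using assms[of "x - y"] by (simp add: cinner_simps)
  then show ?thesis by (simp add: cinner_self_eq_zero_iff)
qed

lemma closure_induct:
  assumes "x \<in> closure S" "closed {x. P x}" "\<And>x. x \<in> S \<Longrightarrow> P x"
  shows "P x"
  using closure_minimal[of S "{x. P x}"] assms by auto

lemma closed_orthogonal: "closed {x. cinner y (x :: 'a::complex_inner) = 0}"
  by (intro closed_Collect_eq continuous_intros cinner.continuous_on)

text \<open>The projection is onto real subspaces because those attached to self-adjoint operators
  are not complex; the complex case follows from it. A minimising sequence is Cauchy by the
  parallelogram law.\<close>

lemma real_projection_exists:
  fixes X :: "'a::chilbert_space set"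
  assumes "closed X" "subspace X"
  shows "\<exists>p\<in>X. \<forall>x\<in>X. Re (cinner x (v - p)) = 0"
proof -
  have ne: "X \<noteq> {}" using assms(2) subspace_0 by auto
  define d where "d = infdist v X"
  have d0: "d \<ge> 0" unfolding d_def by (rule infdist_nonneg)
  have dle: "d \<le> norm (v - x)" if "x \<in> X" for x
    unfolding d_def using infdist_le[OF that, of v] by (simp add: dist_norm)
  have "\<exists>x\<in>X. norm (v - x) < d + 1 / Suc n" for n
  proof -
    have "infdist v X < d + 1 / Suc n" unfolding d_def by simp
    then show ?thesis
      using ne cInf_lessD[of "dist v ` X" "d + 1 / Suc n"] by (auto simp: infdist_def dist_norm)
  qed
  then obtain s where s: "s n \<in> X" "norm (v - s n) < d + 1 / Suc n" for n by metis
  have par: "(norm (s m - s n))\<^sup>2 \<le> 2 * (norm (v - s m))\<^sup>2 + 2 * (norm (v - s n))\<^sup>2 - 4 * d\<^sup>2" for m n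
  proof -
    let ?a = "v - s m" and ?b = "v - s n"
    have "(1/2) *\<^sub>R (s m + s n) \<in> X"
      using s assms(2) by (simp add: subspace_add subspace_scale)
    from dle[OF this] have "2 * d \<le> 2 * norm (v - (1/2) *\<^sub>R (s m + s n))" by simp
    also have "\<dots> = norm (2 *\<^sub>R (v - (1/2) *\<^sub>R (s m + s n)))" by simp
    also have "2 *\<^sub>R (v - (1/2) *\<^sub>R (s m + s n)) = ?a + ?b"
      by (simp add: algebra_simps scaleR_2)
    finally have "(2 * d)\<^sup>2 \<le> (norm (?a + ?b))\<^sup>2" using d0 by (intro power_mono) auto
    moreover have "(norm (s m - s n))\<^sup>2 = (norm (?b - ?a))\<^sup>2" by simp
    ultimately show ?thesis
      unfolding norm_add_squared norm_diff_squared Re_cinner_commute[of ?b] by (simp add: power2_eq_square)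
  qed
  have sq: "(\<lambda>n. (d + 1 / Suc n)\<^sup>2) \<longlonglongrightarrow> d\<^sup>2"
    using LIMSEQ_inverse_real_of_nat_add[of d] by (intro tendsto_intros) (simp add: inverse_eq_divide)
  have "Cauchy s"
  proof (rule metric_CauchyI)
    fix e :: real assume e: "e > 0"
    then have "\<forall>\<^sub>F n in sequentially. (d + 1 / Suc n)\<^sup>2 < d\<^sup>2 + e\<^sup>2 / 4"
      by (intro order_tendstoD(2)[OF sq]) simp
    then obtain N where N: "(d + 1 / Suc n)\<^sup>2 < d\<^sup>2 + e\<^sup>2 / 4" if "n \<ge> N" for n
      by (auto simp: eventually_sequentially)
    have b: "(norm (v - s n))\<^sup>2 < d\<^sup>2 + e\<^sup>2 / 4" if "n \<ge> N" for n
      using power_mono[of "norm (v - s n)" "d + 1 / Suc n" 2] s(2)[of n] N[OF that] by simp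
    have "dist (s m) (s n) < e" if "m \<ge> N" "n \<ge> N" for m n
    proof -
      have "(norm (s m - s n))\<^sup>2 < e\<^sup>2" using par[of m n] b[OF that(1)] b[OF that(2)] by simp
      then show ?thesis using e by (simp add: dist_norm power_less_imp_less_base)
    qed
    then show "\<exists>M. \<forall>m\<ge>M. \<forall>n\<ge>M. dist (s m) (s n) < e" by blast
  qed
  then obtain p where p: "s \<longlonglongrightarrow> p" using Cauchy_convergent convergent_def by blast
  have pX: "p \<in> X" using closed_sequentially[OF assms(1)] s(1) p by blast
  have "norm (v - p) \<le> d"
  proof (rule LIMSEQ_le[of "\<lambda>n. norm (v - s n)" _ "\<lambda>n. d + 1 / Suc n"])
    show "(\<lambda>n. norm (v - s n)) \<longlonglongrightarrow> norm (v - p)" using p by (intro tendsto_intros)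
    show "(\<lambda>n. d + 1 / Suc n) \<longlonglongrightarrow> d"
      using LIMSEQ_inverse_real_of_nat_add[of d] by (simp add: inverse_eq_divide)
    show "\<exists>N. \<forall>n\<ge>N. norm (v - s n) \<le> d + 1 / Suc n" using s(2) less_imp_le by blast
  qed
  have "Re (cinner x (v - p)) = 0" if x: "x \<in> X" for x
  proof (cases "x = 0")
    case False
    let ?r = "Re (cinner (v - p) x)"
    \<comment> \<open>This \<open>t\<close> minimises the norm of v - p - t x.\<close>
    define t where "t = ?r / (norm x)\<^sup>2"
    have "p + t *\<^sub>R x \<in> X" using pX x assms(2) by (simp add: subspace_add subspace_scale)
    from dle[OF this] \<open>norm (v - p) \<le> d\<close> have "norm (v - p) \<le> norm (v - p - t *\<^sub>R x)"
      by (simp add: algebra_simps)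
    then have "(norm (v - p))\<^sup>2 \<le> (norm (v - p - t *\<^sub>R x))\<^sup>2" by (intro power_mono) auto
    also have "\<dots> = (norm (v - p))\<^sup>2 + t\<^sup>2 * (norm x)\<^sup>2 - 2 * t * ?r"
      by (subst norm_diff_squared) (simp add: cinner_simps power_mult_distrib)
    finally have "2 * t * ?r \<le> t\<^sup>2 * (norm x)\<^sup>2" by simp
    also have "\<dots> = t * ?r" using False by (simp add: t_def power2_eq_square)
    finally have "?r\<^sup>2 / (norm x)\<^sup>2 \<le> 0" by (simp add: t_def power2_eq_square)
    then have "?r\<^sup>2 \<le> 0" using False by (simp add: divide_le_0_iff)
    then show ?thesis by (simp add: Re_cinner_commute[of x])
  qed (simp add: cinner_simps)
  with pX show ?thesis by blast
qed

lemma subspace_closure: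
  fixes S :: "'a::real_normed_vector set"
  assumes "subspace S"
  shows "subspace (closure S)"
proof (rule subspaceI)
  show "0 \<in> closure S"
    using subspace_0[OF assms] closure_subset by blast
next
  fix x y assume "x \<in> closure S" "y \<in> closure S"
  then obtain a b where "\<And>n. a n \<in> S" "a \<longlonglongrightarrow> x" "\<And>n. b n \<in> S" "b \<longlonglongrightarrow> y"
    unfolding closure_sequential by blast
  then show "x + y \<in> closure S"
    unfolding closure_sequential
    by (intro exI[of _ "\<lambda>n. a n + b n"]) (auto intro: tendsto_intros subspace_add assms)
next
  fix c x assume "x \<in> closure S"
  then obtain a where "\<And>n. a n \<in> S" "a \<longlonglongrightarrow> x"
    unfolding closure_sequential by blast
  then show "c *\<^sub>R x \<in> closure S"
    unfolding closure_sequential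
    by (intro exI[of _ "\<lambda>n. c *\<^sub>R a n"]) (auto intro: tendsto_intros subspace_scale assms)
qed

lemma csubspace_imp_subspace: "complex_vector.subspace S \<Longrightarrow> subspace S"
  unfolding complex_vector.subspace_def subspace_def by (simp add: scaleR_scaleC)

lemma closure_csubspace:
  fixes S :: "'a::complex_inner set"
  assumes "complex_vector.subspace S"
  shows "complex_vector.subspace (closure S)"
proof -
  note real = subspace_closure[OF csubspace_imp_subspace[OF assms]]
  have "c *\<^sub>C x \<in> closure S" if "x \<in> closure S" for c x
    using that
  proof (rule closure_induct)
    show "closed {x. c *\<^sub>C x \<in> closure S}"
      using closed_vimage[OF closed_closure[of S] scaleC.continuous_on[OF continuous_on_const continuous_on_id]]
      by (simp add: vimage_def)
    show "c *\<^sub>C x \<in> closure S" if "x \<in> S" for x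
      by (rule subsetD[OF closure_subset complex_vector.subspace_scale[OF assms that]])
  qed
  then show ?thesis
    using real unfolding complex_vector.subspace_def subspace_def by blast
qed

lemma projection_exists:
  fixes E :: "'a::chilbert_space set"
  assumes "closed E" "complex_vector.subspace E"
  shows "\<exists>p\<in>E. \<forall>x\<in>E. cinner x (v - p) = 0"
proof -
  obtain p where p: "p \<in> E" "\<And>x. x \<in> E \<Longrightarrow> Re (cinner x (v - p)) = 0"
    using real_projection_exists[OF assms(1) csubspace_imp_subspace[OF assms(2)]] by blast
  have "cinner x (v - p) = 0" if "x \<in> E" for x
  proof -
    \<comment> \<open>Testing against \<i> x as well as x upgrades a vanishing real part to a
      vanishing inner product.\<close>
    have "\<i> *\<^sub>C x \<in> E" using that assms(2) complex_vector.subspace_scale by blast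
    from p(2)[OF this] p(2)[OF that] show ?thesis
      by (simp add: cinner_scaleC_left complex_eq_iff)
  qed
  with p show ?thesis by blast
qed

text \<open>The hypothesis is applied to the residual q = v - p of the projection onto the closure;
  it makes v - p orthogonal to itself.\<close>

lemma closure_bipolar:
  fixes X :: "'a::chilbert_space set"
  assumes "subspace X" "\<And>q. (\<And>x. x \<in> X \<Longrightarrow> Re (cinner x q) = 0) \<Longrightarrow> Re (cinner q v) = 0"
  shows "v \<in> closure X"
proof -
  have "subspace (closure X)" by (rule subspace_closure) fact
  then obtain p where p: "p \<in> closure X" "\<And>x. x \<in> closure X \<Longrightarrow> Re (cinner x (v - p)) = 0"
    using real_projection_exists by blast
  have "Re (cinner (v - p) v) = 0"
    by (rule assms(2)) (use p(2) closure_subset in blast)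
  moreover have "Re (cinner (v - p) p) = 0" using p Re_cinner_commute by metis
  ultimately have "Re (cinner (v - p) (v - p)) = 0"
    by (simp only: cinner_diff_right[of "v - p"] minus_complex.sel)
  then have "v = p" by (simp add: cinner_self)
  with p show ?thesis by simp
qed

section \<open>Bounded operators\<close>

lemma bounded_clinearD:
  assumes "bounded_clinear T"
  shows "T (x + y) = T x + T y" "T (c *\<^sub>C x) = c *\<^sub>C T x" "T (r *\<^sub>R x) = r *\<^sub>R T x"
    "T 0 = 0" "T (- x) = - T x" "T (x - y) = T x - T y"
  using assms unfolding bounded_clinear_def Vector_Spaces.linear_def
  by (auto simp: module_hom.add module_hom.diff module_hom.neg module_hom.scale module_hom.zero
      scaleR_scaleC)

lemma bounded_clinearI:
  assumes "\<And>x y. T (x + y) = T x + T y" "\<And>c x. T (c *\<^sub>C x) = c *\<^sub>C T x"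
    "\<And>x. norm (T x) \<le> norm x * K"
  shows "bounded_clinear T"
proof -
  have "clinear T"
    unfolding Vector_Spaces.linear_iff using assms(1,2)
    by (simp add: complex_vector.vector_space_axioms)
  moreover have "bounded_linear T"
    by (rule bounded_linear_intro[of _ K]) (simp_all add: assms scaleR_scaleC)
  ultimately show ?thesis by (simp add: bounded_clinear_def)
qed

lemma bounded_clinear_bound: "bounded_clinear T \<Longrightarrow> \<exists>K>0. \<forall>x. norm (T x) \<le> norm x * K"
  using bounded_linear.pos_bounded bounded_clinear_def by blast

lemma bounded_clinear_id: "bounded_clinear id" "bounded_clinear (\<lambda>x. x)"
  by (rule bounded_clinearI[of _ 1]; simp)+

lemma bounded_clinear_compose:
  assumes "bounded_clinear S" "bounded_clinear T"
  shows "bounded_clinear (\<lambda>x. S (T x))"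
  using assms bounded_linear_compose[of S T] unfolding bounded_clinear_def
  by (auto simp: Vector_Spaces.linear_iff)

lemma bounded_clinear_comp: "bounded_clinear S \<Longrightarrow> bounded_clinear T \<Longrightarrow> bounded_clinear (S \<circ> T)"
  using bounded_clinear_compose[of S T] by (simp add: comp_def)

lemma bounded_clinear_add:
  assumes "bounded_clinear S" "bounded_clinear T"
  shows "bounded_clinear (\<lambda>x. S x + T x)"
  using assms bounded_linear_add[of S T] unfolding bounded_clinear_def
  by (auto simp: Vector_Spaces.linear_iff scaleC_add_right)

lemma bounded_clinear_scaleC:
  assumes "bounded_clinear T"
  shows "bounded_clinear (\<lambda>x. c *\<^sub>C T x)"
proof -
  obtain K where K: "\<And>x. norm (T x) \<le> norm x * K" using bounded_clinear_bound[OF assms] by blast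
  show ?thesis
  proof (rule bounded_clinearI[of _ "cmod c * K"])
    fix x show "norm (c *\<^sub>C T x) \<le> norm x * (cmod c * K)"
      using mult_left_mono[OF K[of x], of "cmod c"] by (simp add: norm_scaleC algebra_simps)
  qed (simp_all add: bounded_clinearD[OF assms] scaleC_add_right scaleC_scaleC mult.commute)
qed

lemma bounded_clinear_diff:
  assumes "bounded_clinear S" "bounded_clinear T"
  shows "bounded_clinear (\<lambda>x. S x - T x)"
  using bounded_clinear_add[OF assms(1) bounded_clinear_scaleC[OF assms(2), of "-1"]]
  by (simp add: complex_vector.scale_minus_left scaleC_one)

lemma bounded_clinear_zero: "bounded_clinear (\<lambda>x. 0)"
  by (rule bounded_clinearI[of _ 0]) simp_all

lemmas bounded_clinear_intros = bounded_clinear_id bounded_clinear_comp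
  bounded_clinear_add bounded_clinear_diff bounded_clinear_scaleC bounded_clinear_zero

lemma bounded_clinear_continuous_on: "bounded_clinear T \<Longrightarrow> continuous_on S T"
  by (simp add: bounded_clinear_def linear_continuous_on)

section \<open>Riesz representation and adjoints\<close>

lemma riesz:
  fixes f :: "'a::chilbert_space \<Rightarrow> complex"
  assumes add: "\<And>x y. f (x + y) = f x + f y" and scale: "\<And>c x. f (c *\<^sub>C x) = c * f x"
    and bound: "\<And>x. cmod (f x) \<le> norm x * K"
  shows "\<exists>v. \<forall>x. f x = cinner v x"
proof (cases "\<forall>x. f x = 0")
  case True
  then show ?thesis by (intro exI[of _ 0]) (simp add: cinner_simps)
next
  case False
  then obtain u where u: "f u \<noteq> 0" by blast
  interpret f: bounded_linear f
    by (rule bounded_linear_intro[of _ K]) (simp_all add: assms scaleR_scaleC scaleR_conv_of_real)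
  let ?E = "{x. f x = 0}"
  have "closed ?E" by (intro closed_Collect_eq continuous_intros f.continuous_on)
  moreover have "complex_vector.subspace ?E"
    by (auto simp: complex_vector.subspace_def add scale)
  ultimately obtain p where p: "f p = 0" "\<And>x. f x = 0 \<Longrightarrow> cinner x (u - p) = 0"
    using projection_exists[of ?E u] by auto
  define w where "w = u - p"
  have fw: "f w \<noteq> 0" using u p by (simp add: w_def f.diff)
  then have w: "w \<noteq> 0" by auto
  \<comment> \<open>The vector \<open>w\<close> is orthogonal to the kernel of \<open>f\<close>, and
    \<open>c\<close> is chosen so that <c w, w> = f w.\<close>
  define c where "c = cnj (f w) / cinner w w"
  have ww: "cinner w w \<noteq> 0" "cnj (cinner w w) = cinner w w"
    using w cinner_self_eq_zero_iff cinner_commute by (blast, metis)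
  have "f x = cinner (c *\<^sub>C w) x" for x
  proof -
    have "f (x - (f x / f w) *\<^sub>C w) = 0" using fw by (simp add: f.diff scale)
    from p(2)[OF this] have "cinner w (x - (f x / f w) *\<^sub>C w) = 0"
      unfolding w_def using cinner_commute complex_cnj_zero by metis
    then have "cinner w x = (f x / f w) * cinner w w" by (simp add: cinner_simps)
    then show ?thesis using fw ww by (simp add: cinner_simps c_def)
  qed
  then show ?thesis by blast
qed

lemma adjoint_exists:
  fixes T :: "'a::chilbert_space \<Rightarrow> 'b::chilbert_space"
  assumes T: "bounded_clinear T"
  shows "\<exists>S. bounded_clinear S \<and> (\<forall>x y. cinner (S x) y = cinner x (T y))"
proof -
  obtain K where K: "\<And>x. norm (T x) \<le> norm x * K" "K > 0" using bounded_clinear_bound[OF T] by blast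
  have b: "cmod (cinner x (T y)) \<le> norm y * (norm x * K)" for x y
    using cinner_bound[of x "T y"] mult_left_mono[OF K(1)[of y], of "norm x"]
    by (simp add: algebra_simps)
  have "\<exists>v. \<forall>y. cinner x (T y) = cinner v y" for x
    by (rule riesz[OF _ _ b]) (simp_all add: bounded_clinearD[OF T] cinner_simps)
  then obtain S where S: "cinner x (T y) = cinner (S x) y" for x y by metis
  have eq: "a = b" if "\<And>y. cinner a y = cinner b y" for a b :: 'a
    using that cinner_eqI cinner_commute by metis
  have "bounded_clinear S"
  proof (rule bounded_clinearI[of _ K])
    show "S (x + y) = S x + S y" for x y
      by (rule eq) (simp add: cinner_simps S[symmetric])
    show "S (c *\<^sub>C x) = c *\<^sub>C S x" for c x
      by (rule eq) (simp add: cinner_simps S[symmetric])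
    show "norm (S x) \<le> norm x * K" for x
    proof (cases "S x = 0")
      case False
      have "(norm (S x))\<^sup>2 = cmod (cinner x (T (S x)))"
        unfolding S cinner_self by (simp add: norm_power)
      also have "\<dots> \<le> norm (S x) * (norm x * K)" by (rule b)
      finally show ?thesis using False by (simp add: power2_eq_square)
    qed (use less_imp_le[OF K(2)] in simp)
  qed
  with S show ?thesis by metis
qed

lemma cadjoint_props:
  assumes "bounded_clinear T"
  shows "bounded_clinear (cadjoint T) \<and> (\<forall>x y. cinner (cadjoint T x) y = cinner x (T y))"
proof -
  have "S = R" if "\<forall>x y. cinner (S x) y = cinner x (T y)" "\<forall>x y. cinner (R x) y = cinner x (T y)"
    for S R :: "'a \<Rightarrow> 'a"
    by (rule ext, rule cinner_eqI) (metis cinner_commute that)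
  then have "\<exists>!S. bounded_clinear S \<and> (\<forall>x y. cinner (S x) y = cinner x (T y))"
    using adjoint_exists[OF assms] by blast
  from theI'[OF this] show ?thesis unfolding cadjoint_def .
qed

lemma bounded_clinear_cadjoint: "bounded_clinear T \<Longrightarrow> bounded_clinear (cadjoint T)"
  using cadjoint_props by blast

lemma cinner_cadjoint_left: "bounded_clinear T \<Longrightarrow> cinner (cadjoint T x) y = cinner x (T y)"
  using cadjoint_props by blast

lemma cinner_cadjoint_right: "bounded_clinear T \<Longrightarrow> cinner x (cadjoint T y) = cinner (T x) y"
  by (metis cadjoint_props cinner_commute)

lemma cadjoint_eqI:
  assumes "bounded_clinear T" "\<And>x y. cinner (S x) y = cinner x (T y)"
  shows "cadjoint T = S"
  by (rule ext, rule cinner_eqI) (metis assms cinner_commute cinner_cadjoint_left)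

lemma cadjoint_cadjoint: "bounded_clinear T \<Longrightarrow> cadjoint (cadjoint T) = T"
  by (intro cadjoint_eqI bounded_clinear_cadjoint) (simp_all add: cinner_cadjoint_right)

lemma cadjoint_comp:
  "bounded_clinear S \<Longrightarrow> bounded_clinear T \<Longrightarrow> cadjoint (\<lambda>x. S (T x)) = (\<lambda>x. cadjoint T (cadjoint S x))"
  by (rule cadjoint_eqI[OF bounded_clinear_compose]) (simp_all add: cinner_cadjoint_left)

lemma cadjoint_add:
  "bounded_clinear S \<Longrightarrow> bounded_clinear T \<Longrightarrow> cadjoint (\<lambda>x. S x + T x) = (\<lambda>x. cadjoint S x + cadjoint T x)"
  by (intro cadjoint_eqI bounded_clinear_intros) (simp_all add: cinner_cadjoint_left cinner_simps)

lemma cadjoint_diff: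
  "bounded_clinear S \<Longrightarrow> bounded_clinear T \<Longrightarrow> cadjoint (\<lambda>x. S x - T x) = (\<lambda>x. cadjoint S x - cadjoint T x)"
  by (intro cadjoint_eqI bounded_clinear_intros) (simp_all add: cinner_cadjoint_left cinner_simps)

lemma cadjoint_scaleC:
  "bounded_clinear T \<Longrightarrow> cadjoint (\<lambda>x. c *\<^sub>C T x) = (\<lambda>x. cnj c *\<^sub>C cadjoint T x)"
  by (intro cadjoint_eqI bounded_clinear_intros) (simp_all add: cinner_cadjoint_left cinner_simps)

lemma cadjoint_id: "cadjoint id = id" "cadjoint (\<lambda>x. x) = (\<lambda>x. x)"
  by (intro cadjoint_eqI bounded_clinear_intros; simp)+

section \<open>Orthogonal projections as bounded operators\<close>

lemma projection_operator_exists: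
  fixes E :: "'a::chilbert_space set"
  assumes E: "closed E" "complex_vector.subspace E"
  shows "\<exists>P. bounded_clinear P \<and> (\<forall>v. P v \<in> E) \<and> (\<forall>v\<in>E. P v = v) \<and>
    (\<forall>v. \<forall>x\<in>E. cinner x (v - P v) = 0) \<and> (\<forall>v w. cinner (P v) w = cinner v (P w)) \<and>
    (\<forall>v. norm (P v) \<le> norm v)"
proof -
  have "\<exists>p. p \<in> E \<and> (\<forall>x\<in>E. cinner x (v - p) = 0)" for v
    using projection_exists[OF E, of v] by blast
  then obtain P where P': "P v \<in> E \<and> (\<forall>x\<in>E. cinner x (v - P v) = 0)" for v by metis
  have P: "P v \<in> E" "x \<in> E \<Longrightarrow> cinner x (v - P v) = 0" for v x using P'[of v] by simp_all
  have uniq: "P v = p" if "p \<in> E" "\<And>x. x \<in> E \<Longrightarrow> cinner x (v - p) = 0" for v p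
  proof -
    have "P v - p \<in> E" by (intro complex_vector.subspace_diff E(2) P(1) that(1))
    then have "cinner (P v - p) (v - p) = 0" "cinner (P v - p) (v - P v) = 0" by (simp_all add: P that(2))
    then have "cinner (P v - p) (P v - p) = 0" by (simp add: cinner_diff_right)
    then show ?thesis by (simp add: cinner_self_eq_zero_iff)
  qed
  have bound: "norm (P v) \<le> norm v" for v
  proof -
    have "(norm v)\<^sup>2 = (norm (P v))\<^sup>2 + (norm (v - P v))\<^sup>2"
      using norm_add_squared[of "P v" "v - P v"] P(2)[OF P(1), of v v] by simp
    then have "(norm (P v))\<^sup>2 \<le> (norm v)\<^sup>2" by simp
    then show ?thesis by simp
  qed
  have sub: "complex_vector.subspace E" by fact
  have "bounded_clinear P"
  proof (rule bounded_clinearI[of _ 1])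
    show "P (x + y) = P x + P y" for x y
    proof (rule uniq)
      show "cinner z (x + y - (P x + P y)) = 0" if "z \<in> E" for z
        using P(2)[OF that, of x] P(2)[OF that, of y] by (simp add: cinner_simps)
    qed (intro complex_vector.subspace_add sub P(1))
    show "P (c *\<^sub>C x) = c *\<^sub>C P x" for c x
    proof (rule uniq)
      show "cinner z (c *\<^sub>C x - c *\<^sub>C P x) = 0" if "z \<in> E" for z
        using P(2)[OF that, of x] by (simp add: cinner_simps)
    qed (intro complex_vector.subspace_scale sub P(1))
  qed (use bound in simp)
  moreover have "P v = v" if "v \<in> E" for v using uniq[OF that] by (simp add: cinner_simps)
  moreover have "cinner (P v) w = cinner v (P w)" for v w
  proof -
    have "cinner (P v) (w - P w) = 0" "cinner (P w) (v - P v) = 0" by (simp_all add: P)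
    then have "cinner (P v) w = cinner (P v) (P w)" "cinner (P w) v = cinner (P w) (P v)"
      by (simp_all add: cinner_diff_right)
    then show ?thesis by (metis cinner_commute)
  qed
  ultimately show ?thesis using P bound by (intro exI[of _ P] conjI allI ballI) simp_all
qed

definition cproj :: "'a::chilbert_space set \<Rightarrow> 'a \<Rightarrow> 'a" where
  "cproj E = (SOME P. bounded_clinear P \<and> (\<forall>v. P v \<in> E) \<and> (\<forall>v\<in>E. P v = v) \<and>
    (\<forall>v. \<forall>x\<in>E. cinner x (v - P v) = 0) \<and> (\<forall>v w. cinner (P v) w = cinner v (P w)) \<and>
    (\<forall>v. norm (P v) \<le> norm v))"

lemma cproj:
  assumes "closed E" "complex_vector.subspace E"
  shows "bounded_clinear (cproj E)" "cproj E v \<in> E" "v \<in> E \<Longrightarrow> cproj E v = v"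
    "x \<in> E \<Longrightarrow> cinner x (v - cproj E v) = 0" "cinner (cproj E v) w = cinner v (cproj E w)"
    "norm (cproj E v) \<le> norm v"
  using someI_ex[OF projection_operator_exists[OF assms], folded cproj_def] by simp_all

lemma cproj_eq_0:
  assumes E: "closed E" "complex_vector.subspace E" and "\<And>x. x \<in> E \<Longrightarrow> cinner x v = 0"
  shows "cproj E v = 0"
proof -
  have "cinner (cproj E v) (v - cproj E v) = 0" "cinner (cproj E v) v = 0"
    using cproj(4)[OF E cproj(2)[OF E]] assms(3)[OF cproj(2)[OF E]] by blast+
  then show ?thesis by (simp add: cinner_diff_right cinner_self_eq_zero_iff)
qed

text \<open>Invariance of \<open>E\<close> under the adjoint means that \<open>T\<close> preserves
  the orthogonal complement of \<open>E\<close>. Both summands of v = \<open>cproj E v\<close> + (v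
  - \<open>cproj E v\<close>) are therefore respected by \<open>T\<close>.\<close>

lemma cproj_commute:
  assumes E: "closed E" "complex_vector.subspace E" and T: "bounded_clinear T"
    and inv: "\<And>x. x \<in> E \<Longrightarrow> T x \<in> E" "\<And>x. x \<in> E \<Longrightarrow> cadjoint T x \<in> E"
  shows "cproj E (T v) = T (cproj E v)"
proof -
  have "cproj E (T (v - cproj E v)) = 0"
  proof (rule cproj_eq_0[OF E])
    fix x assume "x \<in> E"
    then have "cinner (cadjoint T x) (v - cproj E v) = 0" by (intro cproj(4)[OF E] inv(2))
    then show "cinner x (T (v - cproj E v)) = 0" by (simp add: cinner_cadjoint_left[OF T])
  qed
  moreover have "cproj E (T (cproj E v)) = T (cproj E v)"
    by (intro cproj(3)[OF E] inv(1) cproj(2)[OF E])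
  ultimately show ?thesis
    by (simp add: bounded_clinearD(6)[OF T] bounded_clinearD(6)[OF cproj(1)[OF E]])
qed

section \<open>The direct sum of two Hilbert spaces, in which graphs of operators live\<close>

instantiation prod :: (complex_inner, complex_inner) complex_inner
begin

definition "scaleC c p = (c *\<^sub>C fst p, c *\<^sub>C snd p)" for p :: "'a \<times> 'b"

definition "cinner p q = cinner (fst p) (fst q) + cinner (snd p) (snd q)" for p q :: "'a \<times> 'b"

instance
proof
  fix x y z :: "'a \<times> 'b" and c d :: complex and r :: real
  show "r *\<^sub>R x = complex_of_real r *\<^sub>C x"
    by (simp add: scaleC_prod_def scaleR_prod_def scaleR_scaleC)
  show "c *\<^sub>C (x + y) = c *\<^sub>C x + c *\<^sub>C y" "(c + d) *\<^sub>C x = c *\<^sub>C x + d *\<^sub>C x"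
    "c *\<^sub>C d *\<^sub>C x = (c * d) *\<^sub>C x"
    by (simp_all add: scaleC_prod_def scaleC_add_right scaleC_add_left scaleC_scaleC plus_prod_def)
  show "cinner x y = cnj (cinner y x)"
    unfolding cinner_prod_def
    by (subst cinner_commute, subst (2) cinner_commute) simp
  show "cinner x (y + z) = cinner x y + cinner x z" "cinner x (c *\<^sub>C y) = c * cinner x y"
    by (simp_all add: cinner_prod_def scaleC_prod_def cinner_simps algebra_simps)
  show "0 \<le> Re (cinner x x)"
    by (simp add: cinner_prod_def cinner_self_nonneg)
  have *: "cinner x x = of_real ((norm (fst x))\<^sup>2 + (norm (snd x))\<^sup>2)"
    unfolding cinner_prod_def cinner_self of_real_add ..
  show "norm x = sqrt (Re (cinner x x))"
    unfolding * norm_prod_def by (simp only: Re_complex_of_real)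
  show "cinner x x = 0 \<longleftrightarrow> x = 0"
    unfolding * of_real_eq_0_iff by (simp add: prod_eq_iff sum_power2_eq_zero_iff)
qed

end

instance prod :: (chilbert_space, chilbert_space) chilbert_space ..

lemma norm_fst_le_norm: "norm (fst p) \<le> norm p"
  by (cases p) (simp add: norm_fst_le)

lemma norm_snd_le_norm: "norm (snd p) \<le> norm p"
  by (cases p) (simp add: norm_snd_le)

section \<open>Algebras of operators\<close>

lemma commutantI:
  "bounded_clinear T \<Longrightarrow> (\<And>S x. S \<in> M \<Longrightarrow> T (S x) = S (T x)) \<Longrightarrow> T \<in> commutant M"
  unfolding commutant_def by auto

lemma commutantD: "T \<in> commutant M \<Longrightarrow> S \<in> M \<Longrightarrow> T (S x) = S (T x)"
  unfolding commutant_def by (auto simp: fun_eq_iff)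

lemma commutant_bounded: "T \<in> commutant M \<Longrightarrow> bounded_clinear T"
  unfolding commutant_def by simp

lemma cadjoint_commutant:
  assumes "M \<subseteq> Collect bounded_clinear" "\<And>S. S \<in> M \<Longrightarrow> cadjoint S \<in> M" "T \<in> commutant M"
  shows "cadjoint T \<in> commutant M"
proof (rule commutantI)
  note T = commutant_bounded[OF assms(3)]
  show "bounded_clinear (cadjoint T)" using T by (rule bounded_clinear_cadjoint)
  fix S x assume S: "S \<in> M"
  then have bS: "bounded_clinear S" "bounded_clinear (cadjoint S)" using assms(1,2) by auto
  show "cadjoint T (S x) = S (cadjoint T x)"
  proof (rule cinner_eqI)
    fix z
    have "cinner z (cadjoint T (S x)) = cinner (cadjoint S (T z)) x"
      by (simp add: cinner_cadjoint_right[OF T] cinner_cadjoint_left[OF bS(1)])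
    also have "cadjoint S (T z) = T (cadjoint S z)"
      using commutantD[OF assms(3) assms(2)[OF S]] by simp
    also have "cinner \<dots> x = cinner z (S (cadjoint T x))"
      by (simp add: cinner_cadjoint_right[OF T, symmetric] cinner_cadjoint_left[OF bS(1)])
    finally show "cinner z (cadjoint T (S x)) = cinner z (S (cadjoint T x))" .
  qed
qed

lemma commutant_star_subalgebra:
  assumes "M \<subseteq> Collect bounded_clinear" "\<And>S. S \<in> M \<Longrightarrow> cadjoint S \<in> M"
  shows "unital_star_subalgebra (commutant M)"
  unfolding unital_star_subalgebra_def
proof (intro conjI ballI allI)
  have M: "bounded_clinear S" if "S \<in> M" for S using assms(1) that by auto
  show "commutant M \<subseteq> Collect bounded_clinear" using commutant_bounded by auto
  show "id \<in> commutant M" by (rule commutantI) (simp_all add: bounded_clinear_id)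
  fix S T c assume S: "S \<in> commutant M" and T: "T \<in> commutant M"
  note b = commutant_bounded[OF S] commutant_bounded[OF T]
  show "(\<lambda>x. S x + T x) \<in> commutant M" "(\<lambda>x. c *\<^sub>C T x) \<in> commutant M" "S \<circ> T \<in> commutant M"
    using b by (auto intro!: commutantI bounded_clinear_intros
        simp: commutantD[OF S] commutantD[OF T] bounded_clinearD[OF M])
  show "cadjoint T \<in> commutant M" using assms T by (rule cadjoint_commutant)
qed

lemma commutant_antimono: "A \<subseteq> B \<Longrightarrow> commutant B \<subseteq> commutant A"
  unfolding commutant_def by auto

lemma double_commutant_subset: "M \<subseteq> Collect bounded_clinear \<Longrightarrow> M \<subseteq> commutant (commutant M)"
  unfolding commutant_def by auto

lemma triple_commutant:
  assumes "M \<subseteq> Collect bounded_clinear"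
  shows "commutant (commutant (commutant M)) = commutant M"
proof
  show "commutant (commutant (commutant M)) \<subseteq> commutant M"
    by (rule commutant_antimono) (rule double_commutant_subset[OF assms])
  show "commutant M \<subseteq> commutant (commutant (commutant M))"
    by (rule double_commutant_subset) (auto simp: commutant_def)
qed

lemma unital_star_subalgebraD:
  assumes "unital_star_subalgebra M"
  shows "T \<in> M \<Longrightarrow> bounded_clinear T" "id \<in> M" "(\<lambda>x. x) \<in> M"
    "S \<in> M \<Longrightarrow> T \<in> M \<Longrightarrow> (\<lambda>x. S x + T x) \<in> M"
    "T \<in> M \<Longrightarrow> (\<lambda>x. c *\<^sub>C T x) \<in> M" "S \<in> M \<Longrightarrow> T \<in> M \<Longrightarrow> (\<lambda>x. S (T x)) \<in> M"
    "T \<in> M \<Longrightarrow> cadjoint T \<in> M" "S \<in> M \<Longrightarrow> T \<in> M \<Longrightarrow> (\<lambda>x. S x - T x) \<in> M"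
proof -
  have *: "M \<subseteq> Collect bounded_clinear" "id \<in> M" "\<And>S T. S \<in> M \<Longrightarrow> T \<in> M \<Longrightarrow> (\<lambda>x. S x + T x) \<in> M"
    "\<And>c T. T \<in> M \<Longrightarrow> (\<lambda>x. c *\<^sub>C T x) \<in> M" "\<And>S T. S \<in> M \<Longrightarrow> T \<in> M \<Longrightarrow> S \<circ> T \<in> M"
    "\<And>T. T \<in> M \<Longrightarrow> cadjoint T \<in> M"
    using assms unfolding unital_star_subalgebra_def by auto
  show "T \<in> M \<Longrightarrow> bounded_clinear T" "id \<in> M" "(\<lambda>x. x) \<in> M" "S \<in> M \<Longrightarrow> T \<in> M \<Longrightarrow> (\<lambda>x. S x + T x) \<in> M"
    "T \<in> M \<Longrightarrow> (\<lambda>x. c *\<^sub>C T x) \<in> M" "S \<in> M \<Longrightarrow> T \<in> M \<Longrightarrow> (\<lambda>x. S (T x)) \<in> M" "T \<in> M \<Longrightarrow> cadjoint T \<in> M"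
    using * by (auto simp: comp_def id_def)
  show "S \<in> M \<Longrightarrow> T \<in> M \<Longrightarrow> (\<lambda>x. S x - T x) \<in> M"
    using *(3)[of S "\<lambda>x. (-1) *\<^sub>C T x"] *(4)[of T "-1"]
    by (simp add: complex_vector.scale_minus_left scaleC_one)
qed

lemma selfadjoint_decomposition:
  assumes A: "unital_star_subalgebra A" and T: "T \<in> A"
  obtains H K where "H \<in> A" "cadjoint H = H" "K \<in> A" "cadjoint K = K"
    "\<And>z. T z = (1/2) *\<^sub>C (H z - \<i> *\<^sub>C K z)"
proof -
  note A = unital_star_subalgebraD[OF A]
  let ?a = "cadjoint T"
  have b: "bounded_clinear T" "bounded_clinear ?a" using A(1)[OF T] A(1)[OF A(7)[OF T]] .
  have 1: "cadjoint (\<lambda>v. T v + ?a v) = (\<lambda>v. T v + ?a v)"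
    using b by (simp add: cadjoint_add cadjoint_cadjoint add.commute)
  have "cadjoint (\<lambda>v. \<i> *\<^sub>C (T v - ?a v)) = (\<lambda>v. cnj \<i> *\<^sub>C (?a v - T v))"
    using b by (simp add: cadjoint_scaleC cadjoint_diff bounded_clinear_diff cadjoint_cadjoint)
  also have "\<dots> = (\<lambda>v. \<i> *\<^sub>C (T v - ?a v))"
    by (simp add: complex_vector.scale_right_diff_distrib)
  finally have 2: "cadjoint (\<lambda>v. \<i> *\<^sub>C (T v - ?a v)) = (\<lambda>v. \<i> *\<^sub>C (T v - ?a v))" .
  have "(T v + ?a v) - \<i> *\<^sub>C (\<i> *\<^sub>C (T v - ?a v)) = 2 *\<^sub>C T v" for v
    using scaleC_add_left[of 1 1 "T v"]
    by (simp add: scaleC_scaleC scaleC_one complex_vector.scale_minus_left)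
  then have "T v = (1/2) *\<^sub>C ((T v + ?a v) - \<i> *\<^sub>C (\<i> *\<^sub>C (T v - ?a v)))" for v
    by (simp add: scaleC_scaleC scaleC_one)
  then show thesis
    by (rule that[OF A(4)[OF T A(7)[OF T]] 1 A(5)[OF A(8)[OF T A(7)[OF T]]] 2])
qed

text \<open>The map \<open>f\<close> is the projection onto the cyclic space when \<open>A\<close>
  is a commutant, and multiplication by \<i> when \<open>A\<close> is the algebra itself.\<close>

lemma selfadjoint_orbit_subspace:
  assumes A: "unital_star_subalgebra A" and f: "bounded_clinear f"
  shows "subspace {f (x \<omega>) | x. x \<in> A \<and> cadjoint x = x}" (is "subspace ?X")
proof (rule subspaceI)
  note A = unital_star_subalgebraD[OF A] and f = bounded_clinearD[OF f]
  have "(\<lambda>x. 0) \<in> A" using A(5)[OF A(3), of 0] by simp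
  moreover have "cadjoint (\<lambda>x. 0 :: 'a) = (\<lambda>x. 0)"
    by (rule cadjoint_eqI) (simp_all add: bounded_clinear_zero cinner_simps)
  ultimately show "0 \<in> ?X" using f(4) by force
  show "u + w \<in> ?X" if "u \<in> ?X" "w \<in> ?X" for u w
  proof -
    from that obtain x y where "x \<in> A" "cadjoint x = x" "y \<in> A" "cadjoint y = y"
      "u = f (x \<omega>)" "w = f (y \<omega>)" by blast
    then show ?thesis
      by (intro CollectI exI[of _ "\<lambda>v. x v + y v"]) (simp add: A f cadjoint_add)
  qed
  show "c *\<^sub>R u \<in> ?X" if "u \<in> ?X" for c u
  proof -
    from that obtain x where "x \<in> A" "cadjoint x = x" "u = f (x \<omega>)" by blast
    then show ?thesis
      by (intro CollectI exI[of _ "\<lambda>v. complex_of_real c *\<^sub>C x v"])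
        (simp add: A(1) A(5) f cadjoint_scaleC scaleR_scaleC)
  qed
qed

section \<open>The density theorem\<close>

lemma orbit_csubspace:
  assumes "unital_star_subalgebra M"
  shows "complex_vector.subspace {x \<omega> | x. x \<in> M}"
proof (rule complex_vector.subspaceI)
  note M = unital_star_subalgebraD[OF assms]
  have "(\<lambda>x. x - x) \<in> M" using M(8)[OF M(3) M(3)] .
  then show "0 \<in> {x \<omega> | x. x \<in> M}" by force
  show "u + v \<in> {x \<omega> | x. x \<in> M}" if "u \<in> {x \<omega> | x. x \<in> M}" "v \<in> {x \<omega> | x. x \<in> M}" for u v
    using that by clarsimp (metis M(4))
  show "c *\<^sub>C u \<in> {x \<omega> | x. x \<in> M}" if "u \<in> {x \<omega> | x. x \<in> M}" for c u
    using that by clarsimp (metis M(5))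
qed

text \<open>This is the symmetry of x \<omega> \<mapsto> x \<eta>. For self-adjoint h, reality of <h
  \<omega>, \<eta>> gives <\<omega>, h \<eta>> = <\<eta>, h \<omega>>. Both sides are linear in h,
  so the identity holds on all of \<open>M\<close>, and it is then applied to x* y.\<close>

lemma hermitian_vector_identity:
  fixes M :: "('a::chilbert_space \<Rightarrow> 'a) set"
  assumes "unital_star_subalgebra M"
    and herm: "\<forall>x\<in>M. cadjoint x = x \<longrightarrow> Im (cinner (x \<omega>) \<eta>) = 0"
    and x: "x \<in> M" and y: "y \<in> M"
  shows "cinner (x \<omega>) (y \<eta>) = cinner (x \<eta>) (y \<omega>)"
proof -
  note M = unital_star_subalgebraD[OF assms(1)]
  have sa: "cinner \<omega> (h \<eta>) = cinner \<eta> (h \<omega>)" if h: "h \<in> M" "cadjoint h = h" for h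
  proof -
    have "cinner \<omega> (h \<eta>) = cinner (h \<omega>) \<eta>"
      using cinner_cadjoint_left[OF M(1)[OF h(1)], of \<omega> \<eta>] h(2) by simp
    also have "\<dots> = cnj (cinner (h \<omega>) \<eta>)" using herm h by (simp add: complex_eq_iff)
    finally show ?thesis using cinner_commute[of \<eta> "h \<omega>"] by simp
  qed
  have *: "cinner \<omega> (x \<eta>) = cinner \<eta> (x \<omega>)" if x: "x \<in> M" for x
    by (rule selfadjoint_decomposition[OF assms(1) x]) (simp add: cinner_simps sa)
  have "cinner \<omega> (cadjoint x (y \<eta>)) = cinner \<eta> (cadjoint x (y \<omega>))"
    by (rule *[of "\<lambda>v. cadjoint x (y v)"]) (rule M(6)[OF M(7)[OF x] y])
  then show ?thesis using cinner_cadjoint_right[OF M(1)[OF x]] by simp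
qed

text \<open>The operator \<open>x \<omega> \<mapsto> x \<eta>\<close> is symmetric, but in general unbounded. The projection onto the
  closure of its graph, scaled by a small \<open>s\<close>, has bounded matrix entries in the commutant
  which approximate it.\<close>

lemma graph_projection_estimate:
  fixes M :: "('a::chilbert_space \<Rightarrow> 'a) set"
  assumes "unital_star_subalgebra M"
    and herm: "\<forall>x\<in>M. cadjoint x = x \<longrightarrow> Im (cinner (x \<omega>) \<eta>) = 0"
    and orth: "\<forall>x\<in>commutant M. cadjoint x = x \<longrightarrow> Re (cinner (x \<omega>) \<eta>) = 0"
    and s: "s > 0" and x0: "x0 \<in> M" "norm (\<eta> - x0 \<omega>) \<le> e" "s * norm (x0 \<eta>) \<le> e"
  shows "2 * (norm \<eta>)\<^sup>2 \<le> 5 * e * norm \<eta>"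
proof -
  note M = unital_star_subalgebraD[OF assms(1)]
  note sym = hermitian_vector_identity[OF assms(1) herm]
  define G where "G = closure {(x \<omega>, s *\<^sub>R x \<eta>) | x. x \<in> M}"
  have E: "closed G" by (simp add: G_def)
  have sub: "complex_vector.subspace G"
    unfolding G_def
  proof (intro closure_csubspace complex_vector.subspaceI)
    let ?G = "{(x \<omega>, s *\<^sub>R x \<eta>) | x. x \<in> M}"
    have "(\<lambda>x. x - x) \<in> M" using M(8)[OF M(3) M(3)] .
    then show "0 \<in> ?G" by (force simp: zero_prod_def)
    show "u + v \<in> ?G" if "u \<in> ?G" "v \<in> ?G" for u v
    proof -
      from that obtain a b where "a \<in> M" "b \<in> M" "u = (a \<omega>, s *\<^sub>R a \<eta>)" "v = (b \<omega>, s *\<^sub>R b \<eta>)" by blast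
      then show ?thesis using M(4)[of a b] 
        by (intro CollectI exI[of _ "\<lambda>x. a x + b x"]) (simp add: scaleR_add_right)
    qed
    show "c *\<^sub>C u \<in> ?G" if "u \<in> ?G" for c u
    proof -
      from that obtain a where "a \<in> M" "u = (a \<omega>, s *\<^sub>R a \<eta>)" by blast
      then show ?thesis using M(5)[of a c]
        by (intro CollectI exI[of _ "\<lambda>x. c *\<^sub>C a x"])
          (simp add: scaleC_prod_def scaleR_scaleC scaleC_scaleC mult.commute)
    qed
  qed
  note P = cproj[OF E sub]
  let ?P = "cproj G"
  have inG: "(x \<omega>, s *\<^sub>R x \<eta>) \<in> G" if "x \<in> M" for x
    unfolding G_def using that by (intro subsetD[OF closure_subset]) blast
  \<comment> \<open>\<open>hermitian_vector_identity\<close> survives passage to the closed graph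
    because both sides are continuous in \<open>p\<close>.\<close>
  have c: "cinner (x \<omega>) (snd p) = of_real s * cinner (x \<eta>) (fst p)" if "p \<in> G" "x \<in> M" for p x
    using that(1)[unfolded G_def]
  proof (rule closure_induct)
    show "closed {p. cinner (x \<omega>) (snd p) = of_real s * cinner (x \<eta>) (fst p)}"
      by (intro closed_Collect_eq continuous_intros cinner.continuous_on)
    fix p assume "p \<in> {(x \<omega>, s *\<^sub>R x \<eta>) | x. x \<in> M}"
    then show "cinner (x \<omega>) (snd p) = of_real s * cinner (x \<eta>) (fst p)"
      using sym[OF that(2)] by (auto simp: cinner_simps)
  qed
  define A where "A v = fst (?P (v, 0))" for v
  define B where "B v = snd (?P (v, 0))" for v
  have zz: "(c *\<^sub>C x, 0 :: 'a) = c *\<^sub>C (x, 0)" for x :: 'a and c by (simp add: scaleC_prod_def)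
  have Bb: "bounded_clinear B"
  proof (rule bounded_clinearI[of _ 1])
    show "B (x + y) = B x + B y" for x y
      unfolding B_def using bounded_clinearD(1)[OF P(1), of "(x, 0)" "(y, 0)"] by simp
    show "B (c *\<^sub>C x) = c *\<^sub>C B x" for c x
      unfolding B_def zz bounded_clinearD(2)[OF P(1)] by (simp add: scaleC_prod_def)
    show "norm (B x) \<le> norm x * 1" for x
      unfolding B_def using P(6)[of "(x, 0)"] norm_snd_le_norm[of "?P (x, 0)"] by (simp add: norm_Pair)
  qed
  \<comment> \<open>\<open>M\<close> acts diagonally on the direct sum and leaves \<open>G\<close>
    invariant. The projection commutes with this action, so its corner \<open>B\<close> lies in the
    commutant.\<close>
  have Bc: "B \<in> commutant M"
  proof (rule commutantI[OF Bb])
    fix x v assume x: "x \<in> M"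
    define X where "X x p = (x (fst p), x (snd p))" for x :: "'a \<Rightarrow> 'a" and p
    have Xb: "bounded_clinear (X x)" if x: "x \<in> M" for x
    proof -
      obtain K where K: "\<And>v. norm (x v) \<le> norm v * K" using bounded_clinear_bound[OF M(1)[OF x]] by blast
      show ?thesis
      proof (rule bounded_clinearI[of _ "2 * \<bar>K\<bar>"])
        fix p :: "'a \<times> 'a"
        have "norm (x v) \<le> norm p * \<bar>K\<bar>" if "norm v \<le> norm p" for v
          using K[of v] mult_mono[OF that abs_ge_self[of K]] mult_left_mono[OF abs_ge_self[of K], of "norm v"]
            mult_right_mono[OF that abs_ge_zero[of K]] by (smt (verit) norm_ge_zero)
        from this[OF norm_fst_le_norm] this[OF norm_snd_le_norm]
        show "norm (X x p) \<le> norm p * (2 * \<bar>K\<bar>)"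
          unfolding X_def using norm_Pair_le[of "x (fst p)" "x (snd p)"] by linarith
      qed (simp_all add: X_def scaleC_prod_def bounded_clinearD[OF M(1)[OF x]])
    qed
    have XG: "X x p \<in> G" if "p \<in> G" "x \<in> M" for x p
      using that(1)[unfolded G_def]
    proof (rule closure_induct)
      show "closed {p. X x p \<in> G}"
        using closed_vimage[OF E bounded_clinear_continuous_on[OF Xb[OF that(2)]]] by (simp add: vimage_def)
      fix p assume "p \<in> {(x \<omega>, s *\<^sub>R x \<eta>) | x. x \<in> M}"
      then obtain y where y: "y \<in> M" "p = (y \<omega>, s *\<^sub>R y \<eta>)" by blast
      then show "X x p \<in> G"
        using inG[OF M(6)[OF that(2) y(1)]] bounded_clinearD(3)[OF M(1)[OF that(2)]] by (simp add: X_def)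
    qed
    have adj: "cadjoint (X x) = X (cadjoint x)"
      using M(1)[OF x]
      by (intro cadjoint_eqI Xb x) (simp add: X_def cinner_prod_def cinner_cadjoint_left)
    have "?P (X x (v, 0)) = X x (?P (v, 0))"
      by (rule cproj_commute[OF E sub Xb[OF x]]) (simp_all add: adj XG x M(7))
    then show "B (x v) = x (B v)"
      by (simp add: B_def X_def bounded_clinearD[OF M(1)[OF x]] prod_eq_iff)
  qed
  have "cadjoint B \<in> commutant M"
    by (rule cadjoint_commutant[OF _ M(7) Bc]) (auto intro: M(1))
  then have "(\<lambda>x. B x + cadjoint B x) \<in> commutant M"
    by (intro unital_star_subalgebraD(4)[OF commutant_star_subalgebra] Bc M(7)) (auto intro: M(1))
  moreover have "cadjoint (\<lambda>x. B x + cadjoint B x) = (\<lambda>x. B x + cadjoint B x)"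
    using Bb by (simp add: cadjoint_add bounded_clinear_cadjoint cadjoint_cadjoint add.commute)
  ultimately have "Re (cinner (B \<omega> + cadjoint B \<omega>) \<eta>) = 0" by (rule orth[rule_format])
  moreover have "cinner (cadjoint B \<omega>) \<eta> = of_real s * cinner \<eta> (A \<eta>)"
    using c[OF P(2) M(3), of "(\<eta>, 0)"] by (simp add: cinner_cadjoint_left[OF Bb] B_def A_def)
  moreover define q where "q = snd (?P (0, \<eta>))"
  \<comment> \<open>The pair (\<omega>, s \<eta>) lies in \<open>G\<close> and is fixed by the
    projection, so (\<omega>, 0) is projected to a known vector up to the error
    \<open>q\<close>.\<close>
  have "B \<omega> = s *\<^sub>R (\<eta> - q)"
  proof -
    have "?P (\<omega>, s *\<^sub>R \<eta>) = (\<omega>, s *\<^sub>R \<eta>)" using P(3)[OF inG[OF M(3)]] by simp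
    moreover have "(\<omega>, 0) = (\<omega>, s *\<^sub>R \<eta>) - s *\<^sub>R (0, \<eta>)" by simp
    ultimately show ?thesis
      unfolding B_def q_def by (simp only: bounded_clinearD[OF P(1)]) (simp add: scaleR_diff_right)
  qed
  ultimately have "s * (Re (cinner (\<eta> - q) \<eta>) + Re (cinner \<eta> (A \<eta>))) = 0"
    by (simp add: cinner_add_left cinner_scaleR_left distrib_left)
  then have "Re (cinner (\<eta> - q) \<eta>) + Re (cinner \<eta> (A \<eta>)) = 0" using s by simp
  moreover have "A \<eta> = \<eta> + (A \<eta> - \<eta>)" by simp
  ultimately have key: "2 * (norm \<eta>)\<^sup>2 = Re (cinner q \<eta>) - Re (cinner \<eta> (A \<eta> - \<eta>))"
    by (simp add: cinner_simps cinner_self)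
  \<comment> \<open>By the symmetry \<open>c\<close>, pairing (0, x \<omega>) with an element of
    \<open>G\<close> costs a factor \<open>s\<close>, so nearly vertical vectors have small
    projections.\<close>
  have f: "norm (?P (0, x \<omega>)) \<le> s * norm (x \<eta>)" if "x \<in> M" for x
  proof (cases "?P (0, x \<omega>) = 0")
    case True then show ?thesis using s by simp
  next
    case False
    let ?p = "?P (0, x \<omega>)"
    have "cinner ?p ?p = cinner ?p (0, x \<omega>)"
      using P(4)[OF P(2)[of "(0, x \<omega>)"], of "(0, x \<omega>)"] by (simp add: cinner_diff_right)
    also have "\<dots> = cnj (cinner (x \<omega>) (snd ?p))" 
      by (subst cinner_commute) (simp add: cinner_prod_def cinner_simps)
    finally have "(norm ?p)\<^sup>2 = cmod (cinner (x \<omega>) (snd ?p))"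
      unfolding cinner_self by (metis complex_mod_cnj norm_of_real abs_of_nonneg zero_le_power2)
    also have "\<dots> = s * cmod (cinner (x \<eta>) (fst ?p))"
      unfolding c[OF P(2) that] using s by (simp add: norm_mult)
    also have "\<dots> \<le> s * (norm (x \<eta>) * norm ?p)"
      using s cinner_bound[of "x \<eta>" "fst ?p"] mult_left_mono[OF norm_fst_le_norm[of "?p"] norm_ge_zero[of "x \<eta>"]]
      by (intro mult_left_mono) linarith+
    finally show ?thesis using False by (simp add: power2_eq_square)
  qed
  have q: "norm q \<le> 2 * e"
  proof -
    have "?P (0, \<eta>) = ?P (0, \<eta> - x0 \<omega>) + ?P (0, x0 \<omega>)"
      unfolding bounded_clinearD(1)[OF P(1), symmetric] by simp
    then have "norm (?P (0, \<eta>)) \<le> norm (?P (0, \<eta> - x0 \<omega>)) + norm (?P (0, x0 \<omega>))"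
      by (simp only: norm_triangle_ineq)
    then have "norm (?P (0, \<eta>)) \<le> norm (0 :: 'a, \<eta> - x0 \<omega>) + s * norm (x0 \<eta>)"
      using P(6)[of "(0, \<eta> - x0 \<omega>)"] f[OF x0(1)]
      by linarith
    then show ?thesis
      using x0 norm_snd_le_norm[of "?P (0, \<eta>)"] unfolding q_def norm_Pair by simp
  qed
  have A: "norm (A \<eta> - \<eta>) \<le> 3 * e"
  proof -
    have "?P (x0 \<omega>, s *\<^sub>R x0 \<eta>) = (x0 \<omega>, s *\<^sub>R x0 \<eta>)"
      using P(3)[OF inG[OF x0(1)]] .
    moreover have "(\<eta>, 0) = (\<eta> - x0 \<omega>, 0) + ((x0 \<omega>, s *\<^sub>R x0 \<eta>) - s *\<^sub>R (0, x0 \<eta>))" by simp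
    ultimately have "?P (\<eta>, 0) = ?P (\<eta> - x0 \<omega>, 0) + ((x0 \<omega>, s *\<^sub>R x0 \<eta>) - s *\<^sub>R ?P (0, x0 \<eta>))"
      by (simp only: bounded_clinearD[OF P(1)])
    then have "A \<eta> - \<eta> = fst (?P (\<eta> - x0 \<omega>, 0)) - (\<eta> - x0 \<omega>) - s *\<^sub>R fst (?P (0, x0 \<eta>))"
      by (simp add: A_def)
    then have "norm (A \<eta> - \<eta>) \<le>
        norm (fst (?P (\<eta> - x0 \<omega>, 0)) - (\<eta> - x0 \<omega>)) + norm (s *\<^sub>R fst (?P (0, x0 \<eta>)))"
      by (simp only: norm_triangle_ineq4)
    moreover have "norm (fst (?P (\<eta> - x0 \<omega>, 0))) \<le> e"
      using norm_fst_le_norm[of "?P (\<eta> - x0 \<omega>, 0)"] P(6)[of "(\<eta> - x0 \<omega>, 0)"] x0(2) by (simp add: norm_Pair)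
    moreover have "norm (s *\<^sub>R fst (?P (0, x0 \<eta>))) \<le> e"
    proof -
      have "norm (fst (?P (0, x0 \<eta>))) \<le> norm (x0 \<eta>)"
        using norm_fst_le_norm[of "?P (0, x0 \<eta>)"] P(6)[of "(0, x0 \<eta>)"] by (simp add: norm_Pair)
      from mult_left_mono[OF this less_imp_le[OF s]]
      have "s * norm (fst (?P (0, x0 \<eta>))) \<le> e" using x0(3) by (rule order_trans)
      then show ?thesis using s by simp
    qed
    ultimately show ?thesis
      using x0(2) norm_triangle_ineq4[of "fst (?P (\<eta> - x0 \<omega>, 0))" "\<eta> - x0 \<omega>"] by linarith
  qed
  have "Re (cinner q \<eta>) \<le> 2 * e * norm \<eta>"
    using Re_cinner_bound[of q \<eta>] mult_right_mono[OF q, of "norm \<eta>"] by simp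
  moreover have "- Re (cinner \<eta> (A \<eta> - \<eta>)) \<le> 3 * e * norm \<eta>"
    using Re_cinner_bound[of \<eta> "A \<eta> - \<eta>"] mult_left_mono[OF A, of "norm \<eta>"] by (simp add: mult.commute)
  ultimately show ?thesis using key by linarith
qed

text \<open>The hypotheses say that \<eta> is real-orthogonal to \<i> x \<omega> for self-adjoint x
  in \<open>M\<close> and to x \<omega> for self-adjoint x in the commutant. This is the density
  statement multiplied by \<i>.\<close>

theorem selfadjoint_orbit_density:
  fixes M :: "('a::chilbert_space \<Rightarrow> 'a) set"
  assumes "unital_star_subalgebra M"
    and \<eta>: "\<eta> \<in> closure {x \<omega> | x. x \<in> M}"
    and herm: "\<forall>x\<in>M. cadjoint x = x \<longrightarrow> Im (cinner (x \<omega>) \<eta>) = 0"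
    and orth: "\<forall>x\<in>commutant M. cadjoint x = x \<longrightarrow> Re (cinner (x \<omega>) \<eta>) = 0"
  shows "\<eta> = 0"
proof (rule ccontr)
  assume "\<eta> \<noteq> 0"
  \<comment> \<open>With this \<open>e\<close> the bound 5 e norm \<eta> equals (norm \<eta>)^2,
    which is half of the quantity it bounds.\<close>
  define e where "e = norm \<eta> / 5"
  have e: "e > 0" using \<open>\<eta> \<noteq> 0\<close> by (simp add: e_def)
  obtain x where x: "x \<in> M" "dist (x \<omega>) \<eta> < e"
    using \<eta> e unfolding closure_approachable by blast
  define s where "s = e / (1 + norm (x \<eta>))"
  have "1 + norm (x \<eta>) > 0" by (simp add: add_pos_nonneg)
  then have "s > 0" "s * norm (x \<eta>) \<le> e"
    using e by (simp_all add: s_def field_simps)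
  from graph_projection_estimate[OF assms(1) herm orth this(1) x(1) _ this(2)] x(2)
  have "2 * (norm \<eta>)\<^sup>2 \<le> 5 * e * norm \<eta>" by (simp add: dist_norm norm_minus_commute)
  then have "(norm \<eta>)\<^sup>2 \<le> 0" by (simp add: e_def power2_eq_square)
  then show False using \<open>\<eta> \<noteq> 0\<close> by simp
qed

section \<open>Even powers of a positive operator\<close>

interpretation blinfun_compose: bounded_bilinear blinfun_compose
  by (rule bounded_bilinear_blinfun_compose)

text \<open>A fixed point B satisfies 2 B = A + B^2, that is (1 - B)^2 = 1 - A. So 1 - B is a square
  root of 1 - A, and it is approximated by real polynomials in A.\<close>

fun sqrt_iter :: "('a::real_normed_vector \<Rightarrow>\<^sub>L 'a) \<Rightarrow> nat \<Rightarrow> 'a \<Rightarrow>\<^sub>L 'a" where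
  "sqrt_iter A 0 = 0"
| "sqrt_iter A (Suc n) = (1/2) *\<^sub>R (A + (sqrt_iter A n o\<^sub>L sqrt_iter A n))"

text \<open>The same iteration for the number 1 in place of the operator. It majorises the operator
  iteration and its increments when the norm of A is at most 1.\<close>

fun sqrt_iter_bound :: "nat \<Rightarrow> real" where
  "sqrt_iter_bound 0 = 0"
| "sqrt_iter_bound (Suc n) = (1 + (sqrt_iter_bound n)\<^sup>2) / 2"

lemma sqrt_iter_bound: "0 \<le> sqrt_iter_bound n" "sqrt_iter_bound n \<le> 1"
proof (induction n)
  case (Suc n)
  {
    case 1 show ?case by simp
  next
    case 2 show ?case using Suc power_le_one[of "sqrt_iter_bound n" 2] by simp
  }
qed simp_all

lemma norm_sqrt_iter:
  assumes "norm A \<le> 1"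
  shows "norm (sqrt_iter A n) \<le> sqrt_iter_bound n"
proof (induction n)
  case (Suc n)
  have "norm (sqrt_iter A n o\<^sub>L sqrt_iter A n) \<le> (sqrt_iter_bound n)\<^sup>2"
    using norm_blinfun_compose[of "sqrt_iter A n" "sqrt_iter A n"]
      mult_mono[OF Suc.IH Suc.IH sqrt_iter_bound(1) norm_ge_zero]
    by (simp add: power2_eq_square)
  then have "norm (A + (sqrt_iter A n o\<^sub>L sqrt_iter A n)) \<le> 1 + (sqrt_iter_bound n)\<^sup>2"
    using assms norm_triangle_ineq[of A "sqrt_iter A n o\<^sub>L sqrt_iter A n"] by linarith
  then show ?case by simp
qed simp

lemma sqrt_iter_commute:
  assumes "X o\<^sub>L A = A o\<^sub>L X"
  shows "X o\<^sub>L sqrt_iter A n = sqrt_iter A n o\<^sub>L X"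
proof (induction n)
  case (Suc n)
  then have *: "X (sqrt_iter A n v) = sqrt_iter A n (X v)" for v
    by (metis blinfun_apply_blinfun_compose)
  have "X (A v) = A (X v)" for v using assms by (metis blinfun_apply_blinfun_compose)
  then show ?case
    by (intro blinfun_eqI) (simp add: blinfun.bilinear_simps *)
qed simp

text \<open>Consecutive iterates commute, so the difference of their squares factors as difference
  times sum. The scalar increments satisfy the corresponding recursion with equality.\<close>

lemma sqrt_iter_diff:
  assumes "norm A \<le> 1"
  shows "norm (sqrt_iter A (Suc n) - sqrt_iter A n) \<le> sqrt_iter_bound (Suc n) - sqrt_iter_bound n"
proof (induction n)
  case (Suc n)
  let ?B = "sqrt_iter A" and ?b = sqrt_iter_bound
  have comm: "?B n o\<^sub>L ?B (Suc n) = ?B (Suc n) o\<^sub>L ?B n"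
    by (intro sqrt_iter_commute sqrt_iter_commute[symmetric]) simp
  have "(?B (Suc n) - ?B n) o\<^sub>L (?B (Suc n) + ?B n) = (?B (Suc n) o\<^sub>L ?B (Suc n)) - (?B n o\<^sub>L ?B n)"
    unfolding blinfun_compose.diff_left blinfun_compose.add_right comm by (simp del: sqrt_iter.simps)
  then have "?B (Suc (Suc n)) - ?B (Suc n) = (1/2) *\<^sub>R ((?B (Suc n) - ?B n) o\<^sub>L (?B (Suc n) + ?B n))"
    by (simp only: sqrt_iter.simps(2)[of A "Suc n"] sqrt_iter.simps(2)[of A n]) (simp add: algebra_simps)
  then have "norm (?B (Suc (Suc n)) - ?B (Suc n)) \<le>
      (1/2) * (norm (?B (Suc n) - ?B n) * norm (?B (Suc n) + ?B n))"
    using norm_blinfun_compose[of "?B (Suc n) - ?B n" "?B (Suc n) + ?B n"] by simp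
  also have "\<dots> \<le> (1/2) * ((?b (Suc n) - ?b n) * (?b (Suc n) + ?b n))"
  proof (intro mult_left_mono mult_mono Suc.IH)
    show "norm (?B (Suc n) + ?B n) \<le> ?b (Suc n) + ?b n"
      using norm_triangle_ineq[of "?B (Suc n)" "?B n"] norm_sqrt_iter[OF assms, of n]
        norm_sqrt_iter[OF assms, of "Suc n"] by linarith
    show "0 \<le> ?b (Suc n) - ?b n" using Suc.IH norm_ge_zero order_trans by blast
  qed simp_all
  also have "\<dots> = ?b (Suc (Suc n)) - ?b (Suc n)"
    by (simp add: power2_eq_square field_simps)
  finally show ?case .
qed (use assms in simp)

lemma sqrt_iter_convergent:
  fixes A :: "'a::banach \<Rightarrow>\<^sub>L 'a"
  assumes "norm A \<le> 1"
  shows "convergent (sqrt_iter A)"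
proof -
  let ?b = sqrt_iter_bound and ?B = "sqrt_iter A"
  have step: "norm (?B (Suc n) - ?B n) \<le> ?b (Suc n) - ?b n" for n by (rule sqrt_iter_diff[OF assms])
  have inc: "?b n \<le> ?b (Suc n)" for n using step[of n] norm_ge_zero[of "?B (Suc n) - ?B n"] by linarith
  have "summable (\<lambda>n. ?b (Suc n) - ?b n)"
  proof (rule telescope_summable)
    show "?b \<longlonglongrightarrow> lim ?b"
      using Bseq_monoseq_convergent[of ?b] inc sqrt_iter_bound
      by (intro convergent_LIMSEQ_iff[THEN iffD1] Bseq_monoseq_convergent)
        (auto intro!: BseqI'[of _ 1] simp: monoseq_Suc abs_le_iff intro: order_trans[of _ 0])
  qed
  then have "summable (\<lambda>n. ?B (Suc n) - ?B n)"
    by (rule summable_comparison_test') (rule step)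
  from summable_LIMSEQ[OF this] show ?thesis
    by (auto simp: sum_lessThan_telescope convergent_def simp del: sqrt_iter.simps(2))
qed

text \<open>For z = W y the polynomial t \<mapsto> Re <y + t z, W (y + t z)> is nonnegative and
  vanishes at 0, so its linear coefficient, twice the squared norm of W y, must vanish.\<close>

lemma positive_kernel:
  fixes W :: "'a::chilbert_space \<Rightarrow> 'a"
  assumes "linear W" and sym: "\<And>x y. Re (cinner (W x) y) = Re (cinner x (W y))"
    and pos: "\<And>x. 0 \<le> Re (cinner x (W x))" and "Re (cinner y (W y)) = 0"
  shows "W y = 0"
proof (rule ccontr)
  assume "W y \<noteq> 0"
  interpret linear W by fact
  define z where "z = W y"
  define a where "a = (norm z)\<^sup>2"
  define c where "c = Re (cinner z (W z))"
  have a: "a > 0" using \<open>W y \<noteq> 0\<close> by (simp add: a_def z_def)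
  have zy: "Re (cinner z (W y)) = a" "Re (cinner y (W z)) = a"
    using sym[of y z] by (simp_all add: a_def z_def cinner_self)
  have q: "0 \<le> 2 * t * a + t\<^sup>2 * c" for t
  proof -
    have "0 \<le> Re (cinner (y + t *\<^sub>R z) (W (y + t *\<^sub>R z)))" by (rule pos)
    also have "\<dots> = 2 * t * a + t\<^sup>2 * c"
      by (simp add: add scale cinner_simps zy assms(4) c_def power2_eq_square algebra_simps)
    finally show ?thesis .
  qed
  show False
  proof (cases "c = 0")
    case True then show ?thesis using q[of "-1"] a by simp
  next
    case False
    then have "c > 0" using pos[of z] by (simp add: c_def)
    then have "2 * (- a / c) * a + (- a / c)\<^sup>2 * c = - (a\<^sup>2 / c)"
      by (simp add: power2_eq_square field_simps)
    then show ?thesis using q[of "- a / c"] a \<open>c > 0\<close> by (simp add: divide_le_0_iff)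
  qed
qed

text \<open>The positive root of W^2 is a norm limit of real polynomials in W^2, each of which
  leaves \<open>L\<close> invariant; the root agrees with \<open>W\<close> by positivity. Only real
  inner products and real coefficients may enter, since \<open>L\<close> is a real subspace.\<close>

lemma positive_preserves_of_square_aux:
  fixes W :: "'a::chilbert_space \<Rightarrow>\<^sub>L 'a"
  assumes nW: "norm W \<le> 1"
    and sym: "\<And>x y. Re (cinner (W x) y) = Re (cinner x (W y))"
    and pos: "\<And>x. 0 \<le> Re (cinner x (W x))"
    and L: "closed L" "subspace L" and inv: "\<And>x. x \<in> L \<Longrightarrow> W (W x) \<in> L" and x: "x \<in> L"
  shows "W x \<in> L"
proof -
  \<comment> \<open>With A = 1 - W^2 the fixed point B of the iteration gives (1 - B)^2 =
    W^2.\<close>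
  define A where "A = id_blinfun - (W o\<^sub>L W)"
  have A_app: "A v = v - W (W v)" for v by (simp add: A_def blinfun.bilinear_simps)
  have nW': "norm (W v) \<le> norm v" for v
    using norm_blinfun[of W v] mult_right_mono[OF nW, of "norm v"] by simp
  have nA: "norm A \<le> 1"
  proof (rule norm_blinfun_bound)
    fix v
    have "(norm (A v))\<^sup>2 = (norm v)\<^sup>2 - 2 * (norm (W v))\<^sup>2 + (norm (W (W v)))\<^sup>2"
      unfolding A_app norm_diff_squared sym[of v "W v", symmetric] by (simp add: cinner_self)
    also have "\<dots> \<le> (norm v)\<^sup>2"
      using power_mono[OF nW'[of "W v"] norm_ge_zero, of 2] zero_le_power2[of "norm (W v)"] by linarith
    finally show "norm (A v) \<le> 1 * norm v" by simp
  qed simp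
  define B where "B = lim (sqrt_iter A)"
  have B: "sqrt_iter A \<longlonglongrightarrow> B"
    unfolding B_def using sqrt_iter_convergent[OF nA] convergent_LIMSEQ_iff by blast
  have Bv: "(\<lambda>n. sqrt_iter A n v) \<longlonglongrightarrow> B v" for v
    by (intro tendsto_intros B)
  have "(\<lambda>n. sqrt_iter A (Suc n)) \<longlonglongrightarrow> (1/2) *\<^sub>R (A + (B o\<^sub>L B))"
    by (simp, intro tendsto_intros blinfun_compose.tendsto B)
  then have fix_eq: "B = (1/2) *\<^sub>R (A + (B o\<^sub>L B))"
    using LIMSEQ_unique[OF LIMSEQ_Suc[OF B]] by blast
  have BB: "2 *\<^sub>R B v = A v + B (B v)" for v
    by (subst fix_eq) (simp add: blinfun.bilinear_simps)
  have nB: "norm B \<le> 1"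
  proof (rule Lim_bounded[OF tendsto_norm[OF B]])
    show "\<forall>n\<ge>0. norm (sqrt_iter A n) \<le> 1"
      using norm_sqrt_iter[OF nA] sqrt_iter_bound(2) order_trans by blast
  qed
  have comm: "W (B v) = B (W v)" for v
  proof -
    have "W o\<^sub>L A = A o\<^sub>L W" by (intro blinfun_eqI) (simp add: A_app blinfun.bilinear_simps)
    from sqrt_iter_commute[OF this] have "W (sqrt_iter A n v) = sqrt_iter A n (W v)" for n
      by (metis blinfun_apply_blinfun_compose)
    moreover have "(\<lambda>n. W (sqrt_iter A n v)) \<longlonglongrightarrow> W (B v)"
      by (intro tendsto_intros Bv)
    ultimately show ?thesis using Bv[of "W v"] LIMSEQ_unique by simp
  qed
  have symA: "Re (cinner (A u) v) = Re (cinner u (A v))" for u v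
    by (simp add: A_app cinner_simps sym)
  have symn: "Re (cinner (sqrt_iter A n u) v) = Re (cinner u (sqrt_iter A n v))" for n u v
    by (induction n arbitrary: u v) (simp_all add: cinner_simps blinfun.bilinear_simps symA)
  have symB: "Re (cinner (B u) v) = Re (cinner u (B v))" for u v
  proof (rule LIMSEQ_unique)
    show "(\<lambda>n. Re (cinner (sqrt_iter A n u) v)) \<longlonglongrightarrow> Re (cinner (B u) v)"
      by (intro tendsto_intros cinner.tendsto Bv)
    show "(\<lambda>n. Re (cinner (sqrt_iter A n u) v)) \<longlonglongrightarrow> Re (cinner u (B v))"
      unfolding symn by (intro tendsto_intros cinner.tendsto Bv)
  qed
  have AL: "A v \<in> L" if "v \<in> L" for v
    unfolding A_app using that inv L(2) subspace_diff by blast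
  have nL: "sqrt_iter A n v \<in> L" if "v \<in> L" for n v
    using that
    by (induction n arbitrary: v)
      (simp_all add: blinfun.bilinear_simps subspace_0 subspace_add subspace_scale L AL)
  have BL: "B v \<in> L" if "v \<in> L" for v
    using closed_sequentially[OF L(1) _ Bv] nL[OF that] by blast
  define R where "R v = v - B v" for v
  have R: "linear R"
    unfolding R_def by (intro linearI) (simp_all add: blinfun.bilinear_simps algebra_simps)
  have RR: "R (R v) = W (W v)" for v
  proof -
    have "R (R v) = v - 2 *\<^sub>R B v + B (B v)"
      by (simp add: R_def blinfun.bilinear_simps scaleR_2)
    then show ?thesis unfolding BB A_app by simp
  qed
  have symR: "Re (cinner (R u) v) = Re (cinner u (R v))" for u v
    by (simp add: R_def cinner_simps symB)
  have posR: "0 \<le> Re (cinner v (R v))" for v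
  proof -
    have "Re (cinner v (B v)) \<le> norm v * norm (B v)" using Re_cinner_bound[of v "B v"] by simp
    also have "\<dots> \<le> norm v * norm v"
      using norm_blinfun[of B v] mult_right_mono[OF nB, of "norm v"] by (intro mult_left_mono) auto
    finally show ?thesis by (simp add: R_def cinner_simps cinner_self power2_eq_square)
  qed
  have W: "linear W" by (simp add: blinfun.bounded_linear_right bounded_linear.linear)
  \<comment> \<open>The roots commute and have equal squares, so (W + R) y = W^2 x - R^2 x = 0.
    Positivity then forces W y = R y = 0, and moving W and R across the inner product shows that y
    is orthogonal to itself.\<close>
  define y where "y = W x - R x"
  have "W y + R y = 0"
    unfolding y_def linear_diff[OF R] blinfun.diff_right RR by (simp add: R_def blinfun.bilinear_simps comm)
  then have "Re (cinner y (W y)) + Re (cinner y (R y)) = 0"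
    by (metis cinner_add_right cinner_zero_right plus_complex.sel(1) zero_complex.sel(1))
  then have z: "Re (cinner y (W y)) = 0" "Re (cinner y (R y)) = 0"
    using pos[of y] posR[of y] by linarith+
  have "W y = 0" "R y = 0"
    using positive_kernel[OF W sym pos z(1)] positive_kernel[OF R symR posR z(2)] .
  then have "Re (cinner y y) = 0"
    unfolding y_def[of] by (simp add: cinner_diff_right sym[symmetric] symR[symmetric] cinner_zero_left)
  then have "W x = R x" by (simp add: cinner_self y_def)
  then show ?thesis unfolding R_def using x BL L(2) subspace_diff by metis
qed

lemma positive_preserves_of_square:
  fixes W :: "'a::chilbert_space \<Rightarrow> 'a"
  assumes W: "bounded_linear W"
    and sym: "\<And>x y. Re (cinner (W x) y) = Re (cinner x (W y))"
    and pos: "\<And>x. 0 \<le> Re (cinner x (W x))"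
    and L: "closed L" "subspace L" and inv: "\<And>x. x \<in> L \<Longrightarrow> W (W x) \<in> L" and x: "x \<in> L"
  shows "W x \<in> L"
proof -
  \<comment> \<open>The summand 1 keeps \<open>c\<close> positive even for W = 0.\<close>
  define c where "c = 1 + norm (Blinfun W)"
  have c: "c > 0" unfolding c_def by (simp add: add_pos_nonneg)
  define V where "V = (1 / c) *\<^sub>R Blinfun W"
  have V: "V v = (1 / c) *\<^sub>R W v" for v
    by (simp add: V_def blinfun.bilinear_simps bounded_linear_Blinfun_apply[OF W])
  have "V x \<in> L"
  proof (rule positive_preserves_of_square_aux[OF _ _ _ L _ x])
    show "norm V \<le> 1" using c unfolding V_def by (simp add: c_def divide_le_eq)
    show "Re (cinner (V u) v) = Re (cinner u (V v))" for u v by (simp add: V cinner_simps sym)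
    show "0 \<le> Re (cinner u (V u))" for u using pos[of u] c by (simp add: V cinner_simps)
    show "V (V u) \<in> L" if "u \<in> L" for u
      using inv[OF that] by (simp add: V linear_scale[OF bounded_linear.linear[OF W]] subspace_scale[OF L(2)])
  qed
  from subspace_scale[OF L(2) this, of c] show ?thesis using c by (simp add: V)
qed

section \<open>Tensor products of operators\<close>

text \<open>The densely defined operator is given by its graph. The bound makes the closed graph
  single valued, and completeness makes it everywhere defined.\<close>

lemma bounded_clinear_extension:
  fixes G :: "('a::chilbert_space \<times> 'b::chilbert_space) set"
  assumes G: "complex_vector.subspace G" and bound: "\<And>p. p \<in> G \<Longrightarrow> norm (snd p) \<le> norm (fst p) * K"
    and dense: "closure (fst ` G) = UNIV" and K: "K \<ge> 0"
  shows "\<exists>R. bounded_clinear R \<and> (\<forall>p\<in>G. R (fst p) = snd p)"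
proof -
  define H where "H = closure G"
  have H: "complex_vector.subspace H" unfolding H_def by (rule closure_csubspace[OF G])
  have GH: "p \<in> H" if "p \<in> G" for p unfolding H_def using that closure_subset by blast
  have bH: "norm (snd p) \<le> norm (fst p) * K" if "p \<in> H" for p
    using that[unfolded H_def]
  proof (rule closure_induct)
    show "closed {p :: 'a \<times> 'b. norm (snd p) \<le> norm (fst p) * K}"
      by (intro closed_Collect_le continuous_intros)
  qed (rule bound)
  have ex: "\<exists>w. (z, w) \<in> H" for z
  proof -
    have "z \<in> closure (fst ` G)" using dense by simp
    then obtain s where s: "\<And>n. s n \<in> fst ` G" "s \<longlonglongrightarrow> z"
      unfolding closure_sequential by blast
    then have "\<exists>p. p \<in> G \<and> fst p = s n" for n by (metis imageE)
    then obtain p where p: "p n \<in> G" "fst (p n) = s n" for n by metis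
    have "Cauchy (\<lambda>n. snd (p n))"
    proof (rule metric_CauchyI)
      fix e :: real assume e: "e > 0"
      have "Cauchy s" using s(2) by (rule LIMSEQ_imp_Cauchy)
      then obtain N where N: "dist (s m) (s n) < e / (K + 1)" if "m \<ge> N" "n \<ge> N" for m n
        using e K metric_CauchyD[of s "e / (K + 1)"] by (auto simp: add_nonneg_pos)
      have "dist (snd (p m)) (snd (p n)) < e" if "m \<ge> N" "n \<ge> N" for m n
      proof -
        have "p m - p n \<in> G" using p G complex_vector.subspace_diff by blast
        from bound[OF this] have "dist (snd (p m)) (snd (p n)) \<le> dist (s m) (s n) * K"
          by (simp add: dist_norm p)
        also have "\<dots> \<le> dist (s m) (s n) * (K + 1)" by (intro mult_left_mono) auto
        also have "\<dots> < e" using N[OF that] K by (simp add: pos_less_divide_eq)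
        finally show ?thesis .
      qed
      then show "\<exists>M. \<forall>m\<ge>M. \<forall>n\<ge>M. dist (snd (p m)) (snd (p n)) < e" by blast
    qed
    then obtain w where w: "(\<lambda>n. snd (p n)) \<longlonglongrightarrow> w"
      using Cauchy_convergent convergent_def by blast
    have "(\<lambda>n. (fst (p n), snd (p n))) \<longlonglongrightarrow> (z, w)" using s(2) w
      by (intro tendsto_intros) (simp_all add: p)
    then have "p \<longlonglongrightarrow> (z, w)" by simp
    then have "(z, w) \<in> H" unfolding H_def closure_sequential using p(1) by blast
    then show ?thesis ..
  qed
  have uniq: "w = w'" if "(z, w) \<in> H" "(z, w') \<in> H" for z w w'
    using bH[OF complex_vector.subspace_diff[OF H that]] by simp
  obtain R where R: "(z, R z) \<in> H" for z using ex by metis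
  have "bounded_clinear R"
  proof (rule bounded_clinearI[of _ K])
    show "R (x + y) = R x + R y" for x y
      by (rule uniq[OF R]) (use complex_vector.subspace_add[OF H R[of x] R[of y]] in simp)
    show "R (c *\<^sub>C x) = c *\<^sub>C R x" for c x
      by (rule uniq[OF R]) (use complex_vector.subspace_scale[OF H R[of x], of c] in \<open>simp add: scaleC_prod_def\<close>)
    show "norm (R x) \<le> norm x * K" for x using bH[OF R[of x]] by simp
  qed
  moreover have "R (fst p) = snd p" if "p \<in> G" for p
    using GH[OF that] by (intro uniq[OF R]) simp
  ultimately show ?thesis by blast
qed

text \<open>The ratios of a log-convex sequence increase, so an initial ratio r > k would force
  growth of order r^n, which eventually exceeds C k^n.\<close>

lemma log_convex_bound:
  fixes u :: "nat \<Rightarrow> real"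
  assumes nonneg: "\<And>n. 0 \<le> u n" and convex: "\<And>n. (u (Suc n))\<^sup>2 \<le> u n * u (Suc (Suc n))"
    and bound: "\<And>n. u n \<le> C * k ^ n" and k: "k > 0"
  shows "u 1 \<le> k * u 0"
proof (rule ccontr)
  assume neg: "\<not> ?thesis"
  have u0: "u 0 > 0"
  proof (rule ccontr)
    assume "\<not> u 0 > 0"
    then have "u 0 = 0" using nonneg[of 0] by simp
    then show False using neg convex[of 0] by simp
  qed
  define r where "r = u 1 / u 0"
  have r: "r > k" using neg u0 by (simp add: r_def field_simps)
  have step: "u n > 0 \<and> r * u n \<le> u (Suc n)" for n
  proof (induction n)
    case 0 then show ?case using u0 by (simp add: r_def)
  next
    case (Suc n)
    then have pos: "u (Suc n) > 0" using r k by (meson less_le_trans less_trans mult_pos_pos)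
    have "u n * (r * u (Suc n)) = (r * u n) * u (Suc n)" by simp
    also have "\<dots> \<le> u (Suc n) * u (Suc n)" using Suc pos by (intro mult_right_mono) auto
    also have "\<dots> \<le> u n * u (Suc (Suc n))" using convex[of n] by (simp add: power2_eq_square)
    finally show ?case using Suc pos by simp
  qed
  have low: "u 0 * r ^ n \<le> u n" for n
  proof (induction n)
    case (Suc n)
    have "u 0 * r ^ Suc n = r * (u 0 * r ^ n)" by simp
    also have "\<dots> \<le> r * u n" using Suc r k by (intro mult_left_mono) auto
    also have "\<dots> \<le> u (Suc n)" using step by simp
    finally show ?case .
  qed simp
  have "1 < r / k" using r k by simp
  then obtain n where "C / u 0 < (r / k) ^ n" using real_arch_pow by blast
  then have "C * k ^ n < u 0 * r ^ n"
    using u0 k by (simp add: power_divide field_simps)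
  then show False using low[of n] bound[of n] by simp
qed

section \<open>Elementary tensors, their totality, and amplifications of one operator\<close>

locale hilbert_tensor_product =
  fixes tens :: "'h::chilbert_space \<Rightarrow> 'k::chilbert_space \<Rightarrow> 'l::chilbert_space"
  assumes hilbert_tensor: "hilbert_tensor tens"
begin

lemma cinner_tens: "cinner (tens x y) (tens x' y') = cinner x x' * cinner y y'"
  using hilbert_tensor unfolding hilbert_tensor_def by blast

lemma tens_linear:
  "tens (x + x') y = tens x y + tens x' y" "tens (c *\<^sub>C x) y = c *\<^sub>C tens x y"
  "tens x (y + y') = tens x y + tens x y'" "tens x (c *\<^sub>C y) = c *\<^sub>C tens x y"
  using hilbert_tensor unfolding hilbert_tensor_def Vector_Spaces.linear_iff by blast+

lemma norm_tens: "norm (tens x y) = norm x * norm y"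
proof -
  have "of_real ((norm (tens x y))\<^sup>2) = (of_real ((norm x * norm y)\<^sup>2) :: complex)"
    unfolding cinner_self[symmetric] cinner_tens by (simp add: cinner_self power_mult_distrib)
  then have "(norm (tens x y))\<^sup>2 = (norm x * norm y)\<^sup>2" by (metis of_real_eq_iff)
  then show ?thesis by simp
qed

lemma bounded_clinear_tens: "bounded_clinear (tens x)" "bounded_clinear (\<lambda>x. tens x y)"
  by (rule bounded_clinearI[of _ "norm x"]; simp add: tens_linear norm_tens mult.commute)
     (rule bounded_clinearI[of _ "norm y"]; simp add: tens_linear norm_tens mult.commute)

lemmas tens_simps = tens_linear bounded_clinearD[OF bounded_clinear_tens(1)]
  bounded_clinearD[OF bounded_clinear_tens(2)]

lemma tens_total:
  assumes "closed X" "complex_vector.subspace X" "\<And>x y. tens x y \<in> X"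
  shows "z \<in> X"
proof -
  have "complex_vector.span {tens x y | x y. True} \<subseteq> X"
    using assms by (intro complex_vector.span_minimal) auto
  then have "closure (complex_vector.span {tens x y | x y. True}) \<subseteq> X"
    using assms(1) by (rule closure_minimal)
  then show ?thesis using hilbert_tensor unfolding hilbert_tensor_def by blast
qed

lemma tens_op_eqI:
  fixes R S :: "'l \<Rightarrow> 'm::complex_inner"
  assumes R: "bounded_clinear R" and S: "bounded_clinear S"
    and eq: "\<And>x y. R (tens x y) = S (tens x y)"
  shows "R = S"
proof
  fix z
  have "z \<in> {z. R z = S z}"
  proof (rule tens_total)
    show "closed {z. R z = S z}"
      by (intro closed_Collect_eq bounded_clinear_continuous_on R S)
    show "complex_vector.subspace {z. R z = S z}"
      by (simp add: complex_vector.subspace_def bounded_clinearD[OF R] bounded_clinearD[OF S])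
  qed (simp add: eq)
  then show "R z = S z" by simp
qed

lemma tens_eqI:
  assumes "\<And>x y. cinner (tens x y) u = cinner (tens x y) v"
  shows "u = v"
proof (rule cinner_eqI)
  fix z
  have "z \<in> {z. cinner z u = cinner z v}"
  proof (rule tens_total)
    show "closed {z. cinner z u = cinner z v}"
      by (intro closed_Collect_eq cinner.continuous_on continuous_intros)
    show "complex_vector.subspace {z. cinner z u = cinner z v}"
      by (simp add: complex_vector.subspace_def cinner_simps)
  qed (simp add: assms)
  then show "cinner z u = cinner z v" by simp
qed

text \<open>With \<open>A = S* S\<close> and \<open>a n = \<Sum>\<^sub>i A\<^sup>n x\<^sub>i \<otimes> y\<^sub>i\<close>, the inner products \<open>\<langle>a n, a m\<rangle>\<close> depend only on
  \<open>n + m\<close>, so \<open>norm (a n)\<close> is log-convex; its trivial exponential bound then controls the first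
  step.\<close>

lemma tens_sum_bound:
  assumes S: "bounded_clinear S" and K: "\<And>x. norm (S x) \<le> norm x * K" "K > 0"
  shows "norm (\<Sum>i\<in>I. tens (S (f i)) (g i)) \<le> norm (\<Sum>i\<in>I. tens (f i) (g i)) * K"
proof -
  define A where "A x = cadjoint S (S x)" for x
  have symA: "cinner (A x) y = cinner x (A y)" for x y
    unfolding A_def cinner_cadjoint_left[OF S] cinner_cadjoint_right[OF S] ..
  have adj: "norm (cadjoint S x) \<le> norm x * K" for x
  proof (cases "cadjoint S x = 0")
    case False
    have "(norm (cadjoint S x))\<^sup>2 = Re (cinner x (S (cadjoint S x)))"
      unfolding cinner_cadjoint_left[OF S, symmetric] cinner_self by simp
    also have "\<dots> \<le> norm x * norm (S (cadjoint S x))" using Re_cinner_bound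
      by (rule order_trans[OF abs_ge_self])
    also have "\<dots> \<le> norm x * (norm (cadjoint S x) * K)" by (intro mult_left_mono K) simp
    finally show ?thesis using False by (simp add: power2_eq_square)
  qed (use K(2) in simp)
  have nA: "norm (A x) \<le> norm x * K\<^sup>2" for x
    using adj[of "S x"] mult_right_mono[OF K(1)[of x] less_imp_le[OF K(2)]]
    by (simp add: A_def power2_eq_square)
  have nAn: "norm ((A ^^ n) x) \<le> norm x * (K\<^sup>2) ^ n" for n x
  proof (induction n)
    case (Suc n)
    have "norm ((A ^^ Suc n) x) \<le> norm ((A ^^ n) x) * K\<^sup>2" using nA by simp
    also have "\<dots> \<le> (norm x * (K\<^sup>2) ^ n) * K\<^sup>2" by (intro mult_right_mono Suc.IH) simp
    finally show ?case by (simp add: algebra_simps)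
  qed simp
  define a where "a n = (\<Sum>i\<in>I. tens ((A ^^ n) (f i)) (g i))" for n
  let ?w = "\<Sum>i\<in>I. tens (S (f i)) (g i)"
  have shift: "cinner (a (Suc n)) (a m) = cinner (a n) (a (Suc m))" for n m
    by (simp add: a_def cinner.sum_left cinner.sum_right cinner_tens symA)
  have ww: "cinner ?w ?w = cinner (a 0) (a 1)"
    by (simp add: a_def cinner.sum_left cinner.sum_right cinner_tens A_def
        cinner_cadjoint_right[OF S])
  have conv: "(norm (a (Suc n)))\<^sup>2 \<le> norm (a n) * norm (a (Suc (Suc n)))" for n
  proof -
    have "(norm (a (Suc n)))\<^sup>2 = Re (cinner (a n) (a (Suc (Suc n))))"
      unfolding shift[symmetric] cinner_self by simp
    also have "\<dots> \<le> norm (a n) * norm (a (Suc (Suc n)))"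
      using Re_cinner_bound by (rule order_trans[OF abs_ge_self])
    finally show ?thesis .
  qed
  have "norm (a 1) \<le> K\<^sup>2 * norm (a 0)"
  proof (rule log_convex_bound[of "\<lambda>n. norm (a n)", OF _ conv])
    show "norm (a n) \<le> (\<Sum>i\<in>I. norm (f i) * norm (g i)) * (K\<^sup>2) ^ n" for n
    proof -
      have "norm (a n) \<le> (\<Sum>i\<in>I. norm (tens ((A ^^ n) (f i)) (g i)))" unfolding a_def
        by (rule norm_sum)
      also have "\<dots> \<le> (\<Sum>i\<in>I. (norm (f i) * (K\<^sup>2) ^ n) * norm (g i))"
        unfolding norm_tens by (intro sum_mono mult_right_mono nAn) simp
      also have "\<dots> = (\<Sum>i\<in>I. norm (f i) * norm (g i)) * (K\<^sup>2) ^ n"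
        by (simp add: sum_distrib_right sum_distrib_left algebra_simps)
      finally show ?thesis .
    qed
  qed (use K(2) in simp_all)
  have "(norm ?w)\<^sup>2 = Re (cinner (a 0) (a 1))" unfolding ww[symmetric] cinner_self by simp
  also have "\<dots> \<le> norm (a 0) * norm (a 1)" using Re_cinner_bound by (rule order_trans[OF abs_ge_self])
  also have "\<dots> \<le> norm (a 0) * (K\<^sup>2 * norm (a 0))" by (intro mult_left_mono norm_ge_zero) fact
  also have "\<dots> = (norm (a 0) * K)\<^sup>2" by (simp add: power2_eq_square)
  finally have "norm ?w \<le> norm (a 0) * K"
    using K(2) by (simp add: power2_le_iff_abs_le abs_mult)
  then show ?thesis by (simp add: a_def)
qed

text \<open>\<open>tens_sum_bound\<close> settles two questions at once: the prescription on
  elementary tensors is consistent on their span, and it is bounded there.\<close>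

lemma tensor_left_exists:
  assumes S: "bounded_clinear S"
  shows "\<exists>R. bounded_clinear R \<and> (\<forall>x y. R (tens x y) = tens (S x) y)"
proof -
  obtain K where K: "K > 0" "\<And>x. norm (S x) \<le> norm x * K" using bounded_clinear_bound[OF S] by blast
  define X where "X = {(tens x y, tens (S x) y) | x y. True}"
  let ?G = "complex_vector.span X"
  have "\<exists>R. bounded_clinear R \<and> (\<forall>p\<in>?G. R (fst p) = snd p)"
  proof (rule bounded_clinear_extension)
    show "complex_vector.subspace ?G" by (rule complex_vector.subspace_span)
    show "norm (snd p) \<le> norm (fst p) * K" if "p \<in> ?G" for p
    proof -
      from that obtain t c where t: "finite t" "t \<subseteq> X" "p = (\<Sum>a\<in>t. c a *\<^sub>C a)"
        unfolding complex_vector.span_explicit by blast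
      have "\<forall>a\<in>t. \<exists>x y. a = (tens x y, tens (S x) y)" using t(2) unfolding X_def by blast
      then obtain x y where xy: "\<And>a. a \<in> t \<Longrightarrow> a = (tens (x a) (y a), tens (S (x a)) (y a))" by metis
      \<comment> \<open>The coefficients are absorbed into the first factor, which turns a linear
        combination into a plain sum of elementary tensors.\<close>
      have f: "fst (c a *\<^sub>C a) = tens (c a *\<^sub>C x a) (y a)" "snd (c a *\<^sub>C a) = tens (S (c a *\<^sub>C x a)) (y a)"
        if "a \<in> t" for a
        by (subst xy[OF that], simp add: scaleC_prod_def tens_linear bounded_clinearD[OF S])+
      have "fst p = (\<Sum>a\<in>t. tens (c a *\<^sub>C x a) (y a))" "snd p = (\<Sum>a\<in>t. tens (S (c a *\<^sub>C x a)) (y a))"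
        unfolding t(3) fst_sum snd_sum by (intro sum.cong refl f; assumption)+
      then show ?thesis using tens_sum_bound[OF S K(2,1)] by simp
    qed
    have "complex_vector.span {tens x y | x y. True} \<subseteq> fst ` ?G"
    proof (rule complex_vector.span_minimal)
      show "{tens x y | x y. True} \<subseteq> fst ` ?G"
      proof
        fix z assume "z \<in> {tens x y | x y. True}"
        then obtain x y where "z = tens x y" by blast
        then have "z = fst (tens x y, tens (S x) y)" "(tens x y, tens (S x) y) \<in> X" by (auto simp: X_def)
        then show "z \<in> fst ` ?G" using complex_vector.span_base by blast
      qed
      have G: "complex_vector.subspace ?G" by (rule complex_vector.subspace_span)
      show "complex_vector.subspace (fst ` ?G)"
      proof (rule complex_vector.subspaceI)
        show "0 \<in> fst ` ?G" using complex_vector.subspace_0[OF G] by force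
        show "u + v \<in> fst ` ?G" if "u \<in> fst ` ?G" "v \<in> fst ` ?G" for u v
          using that complex_vector.subspace_add[OF G] by (metis (no_types, lifting) fst_add image_iff)
        show "c *\<^sub>C u \<in> fst ` ?G" if u: "u \<in> fst ` ?G" for c u
        proof -
          from u obtain p where "p \<in> ?G" "u = fst p" by blast
          then have "c *\<^sub>C p \<in> ?G" "c *\<^sub>C u = fst (c *\<^sub>C p)"
            using complex_vector.subspace_scale[OF G] by (auto simp: scaleC_prod_def)
          then show ?thesis by blast
        qed
      qed
    qed
    from closure_mono[OF this] show "closure (fst ` ?G) = UNIV"
      using hilbert_tensor unfolding hilbert_tensor_def by blast
  qed (use K(1) in simp)
  then obtain R where R: "bounded_clinear R" "\<And>p. p \<in> ?G \<Longrightarrow> R (fst p) = snd p" by blast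
  have "R (tens x y) = tens (S x) y" for x y
    using R(2)[OF complex_vector.span_base, of "(tens x y, tens (S x) y)"] by (auto simp: X_def)
  with R(1) show ?thesis by blast
qed

end

lemma hilbert_tensor_swap:
  assumes "hilbert_tensor tens"
  shows "hilbert_tensor (\<lambda>y x. tens x y)"
proof -
  have "{tens x y | y x. True} = {tens x y | x y. True}" by blast
  then show ?thesis
    using assms unfolding hilbert_tensor_def by (simp add: mult.commute)
qed

context hilbert_tensor_product
begin

abbreviation tensor_op_infix :: "('h \<Rightarrow> 'h) \<Rightarrow> ('k \<Rightarrow> 'k) \<Rightarrow> 'l \<Rightarrow> 'l" (infixr "\<otimes>" 75)
  where "S \<otimes> T \<equiv> tensor_op tens S T"

lemma tensor_op:
  assumes S: "bounded_clinear S" and T: "bounded_clinear T"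
  shows "bounded_clinear (S \<otimes> T)" "(S \<otimes> T) (tens x y) = tens (S x) (T y)"
proof -
  interpret swap: hilbert_tensor_product "\<lambda>y x. tens x y"
    by unfold_locales (rule hilbert_tensor_swap[OF hilbert_tensor])
  obtain R where R: "bounded_clinear R" "\<And>x y. R (tens x y) = tens (S x) y"
    using tensor_left_exists[OF S] by blast
  obtain Q where Q: "bounded_clinear Q" "\<And>x y. Q (tens x y) = tens x (T y)"
    using swap.tensor_left_exists[OF T] by blast
  have "\<exists>!R. bounded_clinear R \<and> (\<forall>x y. R (tens x y) = tens (S x) (T y))"
  \<comment> \<open>S \<otimes> T arises as the product of S \<otimes> 1 and 1 \<otimes> T, the
    latter obtained by swapping the factors.\<close>
  proof (rule ex1I[of _ "\<lambda>z. R (Q z)"])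
    show "bounded_clinear (\<lambda>z. R (Q z)) \<and> (\<forall>x y. R (Q (tens x y)) = tens (S x) (T y))"
      using bounded_clinear_compose[OF R(1) Q(1)] R Q by simp
    fix P assume P: "bounded_clinear P \<and> (\<forall>x y. P (tens x y) = tens (S x) (T y))"
    show "P = (\<lambda>z. R (Q z))"
      by (rule tens_op_eqI) (use P bounded_clinear_compose[OF R(1) Q(1)] R Q in simp_all)
  qed
  from theI'[OF this] show "bounded_clinear (S \<otimes> T)" "(S \<otimes> T) (tens x y) = tens (S x) (T y)"
    unfolding tensor_op_def[symmetric] by blast+
qed

lemma tensor_op_eqI:
  "bounded_clinear S \<Longrightarrow> bounded_clinear T \<Longrightarrow> bounded_clinear R \<Longrightarrow>
    (\<And>x y. R (tens x y) = tens (S x) (T y)) \<Longrightarrow> R = S \<otimes> T"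
  by (rule tens_op_eqI) (simp_all add: tensor_op)

lemma tensor_op_comp:
  assumes "bounded_clinear S" "bounded_clinear T" "bounded_clinear S'" "bounded_clinear T'"
  shows "(S \<otimes> T) ((S' \<otimes> T') z) = ((\<lambda>x. S (S' x)) \<otimes> (\<lambda>y. T (T' y))) z"
proof -
  have "(\<lambda>z. (S \<otimes> T) ((S' \<otimes> T') z)) = (\<lambda>x. S (S' x)) \<otimes> (\<lambda>y. T (T' y))"
    by (rule tensor_op_eqI) (simp_all add: bounded_clinear_compose tensor_op assms)
  then show ?thesis by (rule fun_cong)
qed

lemma tensor_op_id: "(id \<otimes> id) = id"
  by (rule tensor_op_eqI[symmetric]) (simp_all add: bounded_clinear_id)

lemma tensor_op_adjoint:
  assumes S: "bounded_clinear S" and T: "bounded_clinear T"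
  shows "cadjoint (S \<otimes> T) = cadjoint S \<otimes> cadjoint T"
proof (rule tensor_op_eqI)
  note ST = tensor_op[OF S T]
  show "cadjoint (S \<otimes> T) (tens x y) = tens (cadjoint S x) (cadjoint T y)" for x y
    by (rule tens_eqI)
      (simp add: cinner_cadjoint_right[OF ST(1)] ST(2) cinner_tens cinner_cadjoint_right[OF S]
        cinner_cadjoint_right[OF T])
qed (simp_all add: assms bounded_clinear_cadjoint tensor_op)

lemma tensor_op_add_left:
  assumes "bounded_clinear S" "bounded_clinear S'" "bounded_clinear T"
  shows "((\<lambda>x. S x + S' x) \<otimes> T) z = (S \<otimes> T) z + (S' \<otimes> T) z"
proof -
  have "(\<lambda>z. (S \<otimes> T) z + (S' \<otimes> T) z) = (\<lambda>x. S x + S' x) \<otimes> T"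
    by (rule tensor_op_eqI) (simp_all add: bounded_clinear_add tensor_op tens_linear assms)
  then show ?thesis by (rule fun_cong[symmetric])
qed

lemma tensor_op_add_right:
  assumes "bounded_clinear S" "bounded_clinear T" "bounded_clinear T'"
  shows "(S \<otimes> (\<lambda>y. T y + T' y)) z = (S \<otimes> T) z + (S \<otimes> T') z"
proof -
  have "(\<lambda>z. (S \<otimes> T) z + (S \<otimes> T') z) = S \<otimes> (\<lambda>y. T y + T' y)"
    by (rule tensor_op_eqI) (simp_all add: bounded_clinear_add tensor_op tens_linear assms)
  then show ?thesis by (rule fun_cong[symmetric])
qed

end

section \<open>Real subspaces of a tensor product\<close>

text \<open>By \<open>adj\<close>, Y is the antilinear adjoint of Z, so <W l, l> is the squared norm
  of Z l and it suffices to get W l = 0. As a product of two antilinear maps, W is complex linear;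
  hence W^2 is minus the square of \<i> W and preserves \<open>L\<close>.\<close>

lemma antilinear_pair_vanishes:
  fixes Z :: "'a::chilbert_space \<Rightarrow> 'b::chilbert_space" and Y :: "'b \<Rightarrow> 'a"
  assumes Z: "\<And>x x'. Z (x + x') = Z x + Z x'" "\<And>c x. Z (c *\<^sub>C x) = cnj c *\<^sub>C Z x"
      "\<And>x. norm (Z x) \<le> norm x * K"
    and Y: "\<And>y y'. Y (y + y') = Y y + Y y'" "\<And>c y. Y (c *\<^sub>C y) = cnj c *\<^sub>C Y y"
      "\<And>y. norm (Y y) \<le> norm y * K"
    and K: "K \<ge> 0"
    and adj: "\<And>x y. cinner (Z x) y = cinner (Y y) x"
    and L: "closed L" "subspace L" "\<And>v. v \<in> L \<Longrightarrow> \<i> *\<^sub>C v \<in> L \<Longrightarrow> v = 0"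
    and YZ: "\<And>l. l \<in> L \<Longrightarrow> \<i> *\<^sub>C Y (Z l) \<in> L" and l: "l \<in> L"
  shows "Z l = 0"
proof -
  define W where "W x = Y (Z x)" for x
  have Wi: "W (\<i> *\<^sub>C x) = \<i> *\<^sub>C W x" for x unfolding W_def Z(2) Y(2) by simp
  have form: "cinner (W x) y = cinner (Z y) (Z x)" "cinner x (W y) = cinner (Z y) (Z x)" for x y
  proof -
    show *: "cinner (W x) y = cinner (Z y) (Z x)" for x y by (simp add: W_def adj)
    show "cinner x (W y) = cinner (Z y) (Z x)"
      using *[of y x] cinner_commute by metis
  qed
  have "W l \<in> L"
  proof (rule positive_preserves_of_square[OF _ _ _ L(1,2) _ l])
    show "bounded_linear W"
    proof (rule bounded_linear_intro[of _ "K * K"])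
      show "norm (W x) \<le> norm x * (K * K)" for x
        using Y(3)[of "Z x"] mult_right_mono[OF Z(3)[of x] K] unfolding W_def by (simp add: algebra_simps)
    qed (simp_all add: W_def Z Y scaleR_scaleC)
    show "Re (cinner (W x) y) = Re (cinner x (W y))" for x y by (simp add: form)
    show "0 \<le> Re (cinner x (W x))" for x by (simp add: form cinner_self)
    show "W (W x) \<in> L" if "x \<in> L" for x
    proof -
      have "\<i> *\<^sub>C W (\<i> *\<^sub>C W x) \<in> L" using YZ[OF YZ[OF that]] by (simp add: W_def)
      then have "- W (W x) \<in> L" by (simp add: Wi scaleC_scaleC complex_vector.scale_minus_left scaleC_one)
      then show ?thesis using subspace_neg[OF L(2)] by fastforce
    qed
  qed
  then have "W l = 0" using YZ[OF l] L(3) by (simp add: W_def)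
  then have "cinner (Z l) (Z l) = 0" by (simp add: form(1)[symmetric] cinner_zero_left)
  then show ?thesis by (simp add: cinner_self_eq_zero_iff)
qed

text \<open>Real-orthogonal complements are taken twice inside \<open>E\<close>. The residual v - p
  of the projection onto \<open>L\<close> stays in \<open>E\<close>, so the hypothesis applies to
  it.\<close>

lemma mem_of_orthogonal_to_complement:
  fixes E L :: "'a::chilbert_space set"
  assumes E: "complex_vector.subspace E" and L: "closed L" "subspace L" "L \<subseteq> E"
    and v: "v \<in> E" "\<And>m. m \<in> E \<Longrightarrow> (\<And>l. l \<in> L \<Longrightarrow> Re (cinner l m) = 0) \<Longrightarrow> Re (cinner m v) = 0"
  shows "v \<in> L"
proof -
  obtain p where p: "p \<in> L" "\<And>l. l \<in> L \<Longrightarrow> Re (cinner l (v - p)) = 0"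
    using real_projection_exists[OF L(1,2)] by blast
  have "v - p \<in> E" using p(1) v(1) L(3) complex_vector.subspace_diff[OF E] by blast
  then have "Re (cinner (v - p) v) = 0" using p(2) v(2) by blast
  moreover have "Re (cinner (v - p) p) = 0" using p(2)[OF p(1)] Re_cinner_commute by metis
  ultimately have "Re (cinner (v - p) (v - p)) = 0"
    by (simp only: cinner_diff_right[of "v - p"] minus_complex.sel)
  then show ?thesis using p(1) by (simp add: cinner_self)
qed

text \<open>Contracting a vector of the tensor product with one factor gives an antilinear operator
  into the other, as in the identification with Hilbert-Schmidt operators.\<close>

lemma (in hilbert_tensor_product) slice_exists:
  "\<exists>Z. (\<forall>x y. cinner (Z x) y = cinner \<zeta> (tens x y)) \<and> (\<forall>x x'. Z (x + x') = Z x + Z x') \<and>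
    (\<forall>c x. Z (c *\<^sub>C x) = cnj c *\<^sub>C Z x) \<and> (\<forall>x. norm (Z x) \<le> norm x * norm \<zeta>)"
proof -
  have "\<exists>v. \<forall>y. cinner \<zeta> (tens x y) = cinner v y" for x
  proof (rule riesz)
    show "cmod (cinner \<zeta> (tens x y)) \<le> norm y * (norm \<zeta> * norm x)" for y
      using cinner_bound[of \<zeta> "tens x y"] by (simp add: norm_tens algebra_simps)
  qed (simp_all add: tens_linear cinner_simps)
  then obtain Z where Z: "cinner \<zeta> (tens x y) = cinner (Z x) y" for x y by metis
  have eq: "a = b" if "\<And>y. cinner a y = cinner b y" for a b :: 'k
    using that cinner_eqI cinner_commute by metis
  show ?thesis
  proof (intro exI[of _ Z] conjI allI)
    show "Z (x + x') = Z x + Z x'" "Z (c *\<^sub>C x) = cnj c *\<^sub>C Z x" for c x x'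
      by (rule eq, simp add: cinner_simps Z[symmetric] tens_linear)+
    show "norm (Z x) \<le> norm x * norm \<zeta>" for x
    proof (cases "Z x = 0")
      case False
      have "(norm (Z x))\<^sup>2 = cmod (cinner \<zeta> (tens x (Z x)))"
        unfolding Z cinner_self by (simp add: norm_power)
      also have "\<dots> \<le> norm \<zeta> * (norm x * norm (Z x))"
        using cinner_bound[of \<zeta> "tens x (Z x)"] by (simp add: norm_tens)
      finally show ?thesis using False by (simp add: power2_eq_square mult.commute)
    qed simp
  qed (simp add: Z)
qed

lemma cproj_fixed:
  fixes E :: "'a::chilbert_space set"
  assumes E: "closed E" "complex_vector.subspace E"
    and "\<And>y. (\<And>x. x \<in> E \<Longrightarrow> cinner x y = 0) \<Longrightarrow> cinner v y = 0"
  shows "v \<in> E"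
proof -
  have "cinner v (v - cproj E v) = 0" using assms(3) cproj(4)[OF E] by blast
  moreover have "cinner (cproj E v) (v - cproj E v) = 0" by (rule cproj(4)[OF E cproj(2)[OF E]])
  ultimately have "cinner (v - cproj E v) (v - cproj E v) = 0"
    by (simp only: cinner_diff_left[of v]) simp
  then show ?thesis using cproj(2)[OF E, of v] by (simp add: cinner_self_eq_zero_iff)
qed

text \<open>This is how density passes to tensor products. With \<open>N1\<close>, \<open>N2\<close>
  the real complements of \<open>L1\<close>, \<open>L2\<close> in \<open>E1\<close>,
  \<open>E2\<close>, the vector \<zeta> lies in E1 \<otimes> E2 and is real-orthogonal to L1
  \<otimes> L2 and to \<i> (N1 \<otimes> N2). The first orthogonality makes both slices map L into
  the opposite N, the second makes \<i> times the slices map N into the opposite L. So \<i> Y Z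
  preserves \<open>L1\<close>, and likewise \<i> Z Y preserves \<open>L2\<close>.\<close>

theorem (in hilbert_tensor_product) real_subspaces_total:
  fixes E1 L1 :: "'h set" and E2 L2 :: "'k set"
  assumes E1: "closed E1" "complex_vector.subspace E1" and E2: "closed E2" "complex_vector.subspace E2"
    and L1: "closed L1" "subspace L1" "L1 \<subseteq> E1" "\<And>v. v \<in> L1 \<Longrightarrow> \<i> *\<^sub>C v \<in> L1 \<Longrightarrow> v = 0"
    and L2: "closed L2" "subspace L2" "L2 \<subseteq> E2" "\<And>v. v \<in> L2 \<Longrightarrow> \<i> *\<^sub>C v \<in> L2 \<Longrightarrow> v = 0"
    and \<zeta>1: "\<And>x y. (\<And>x'. x' \<in> E1 \<Longrightarrow> cinner x' x = 0) \<Longrightarrow> cinner \<zeta> (tens x y) = 0"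
    and \<zeta>2: "\<And>x y. (\<And>y'. y' \<in> E2 \<Longrightarrow> cinner y' y = 0) \<Longrightarrow> cinner \<zeta> (tens x y) = 0"
    and l: "\<And>x y. x \<in> L1 \<Longrightarrow> y \<in> L2 \<Longrightarrow> Re (cinner \<zeta> (tens x y)) = 0"
    and m: "\<And>x y. x \<in> E1 \<Longrightarrow> (\<And>l. l \<in> L1 \<Longrightarrow> Re (cinner l x) = 0) \<Longrightarrow>
      y \<in> E2 \<Longrightarrow> (\<And>l. l \<in> L2 \<Longrightarrow> Re (cinner l y) = 0) \<Longrightarrow> Im (cinner \<zeta> (tens x y)) = 0"
  shows "\<zeta> = 0"
proof -
  interpret swap: hilbert_tensor_product "\<lambda>y x. tens x y"
    by unfold_locales (rule hilbert_tensor_swap[OF hilbert_tensor])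
  define N1 where "N1 = {x \<in> E1. \<forall>l\<in>L1. Re (cinner l x) = 0}"
  define N2 where "N2 = {y \<in> E2. \<forall>l\<in>L2. Re (cinner l y) = 0}"
  obtain Z where Z: "\<And>x y. cinner (Z x) y = cinner \<zeta> (tens x y)" "\<And>x x'. Z (x + x') = Z x + Z x'"
    "\<And>c x. Z (c *\<^sub>C x) = cnj c *\<^sub>C Z x" "\<And>x. norm (Z x) \<le> norm x * norm \<zeta>"
    using slice_exists[of \<zeta>] by blast
  obtain Y where Y: "\<And>x y. cinner (Y y) x = cinner \<zeta> (tens x y)" "\<And>x x'. Y (x + x') = Y x + Y x'"
    "\<And>c x. Y (c *\<^sub>C x) = cnj c *\<^sub>C Y x" "\<And>x. norm (Y x) \<le> norm x * norm \<zeta>"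
    using swap.slice_exists[of \<zeta>] by blast
  have adj: "cinner (Z x) y = cinner (Y y) x" for x y by (simp add: Z(1) Y(1))
  have ZE: "Z x \<in> E2" for x by (rule cproj_fixed[OF E2]) (simp add: Z(1) \<zeta>2)
  have YE: "Y y \<in> E1" for y by (rule cproj_fixed[OF E1]) (simp add: Y(1) \<zeta>1)
  have ZL: "Z x \<in> N2" if "x \<in> L1" for x
    using that l ZE by (auto simp: N2_def Z(1) Re_cinner_commute[of _ "Z x"])
  have YL: "Y y \<in> N1" if "y \<in> L2" for y
    using that l YE by (auto simp: N1_def Y(1) Re_cinner_commute[of _ "Y y"])
  have ZN: "\<i> *\<^sub>C Z x \<in> L2" if "x \<in> N1" for x
  proof (rule mem_of_orthogonal_to_complement[OF E2(2) L2(1-3)])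
    show "\<i> *\<^sub>C Z x \<in> E2" by (rule complex_vector.subspace_scale[OF E2(2) ZE])
    fix y assume "y \<in> E2" "\<And>l. l \<in> L2 \<Longrightarrow> Re (cinner l y) = 0"
    then have "Im (cinner (Z x) y) = 0" using m[of x y] that unfolding Z(1) N1_def by blast
    then show "Re (cinner y (\<i> *\<^sub>C Z x)) = 0"
      by (subst Re_cinner_commute) (simp add: cinner_simps)
  qed
  have YN: "\<i> *\<^sub>C Y y \<in> L1" if "y \<in> N2" for y
  proof (rule mem_of_orthogonal_to_complement[OF E1(2) L1(1-3)])
    show "\<i> *\<^sub>C Y y \<in> E1" by (rule complex_vector.subspace_scale[OF E1(2) YE])
    fix x assume "x \<in> E1" "\<And>l. l \<in> L1 \<Longrightarrow> Re (cinner l x) = 0"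
    then have "Im (cinner (Y y) x) = 0" using m[of x y] that unfolding Y(1) N2_def by blast
    then show "Re (cinner x (\<i> *\<^sub>C Y y)) = 0"
      by (subst Re_cinner_commute) (simp add: cinner_simps)
  qed
  have ZL0: "Z x = 0" if "x \<in> L1" for x
    by (rule antilinear_pair_vanishes[OF Z(2-4) Y(2-4) norm_ge_zero adj L1(1,2,4) YN[OF ZL] that])
  have YL0: "Y y = 0" if "y \<in> L2" for y
    by (rule antilinear_pair_vanishes[OF Y(2-4) Z(2-4) norm_ge_zero adj[symmetric] L2(1,2,4) ZN[OF YL] that])
  \<comment> \<open>\<i> Z x lies in \<open>L2\<close>, where Y already vanishes, and adjointness
    turns this into <Z x, \<i> Z x> = 0.\<close>
  have ZN0: "Z x = 0" if "x \<in> N1" for x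
  proof -
    have "cinner (Z x) (\<i> *\<^sub>C Z x) = 0" by (simp add: adj YL0[OF ZN[OF that]] cinner_zero_left)
    then show ?thesis by (simp add: cinner_simps cinner_self_eq_zero_iff)
  qed
  have ZE0: "Z x = 0" if "x \<in> E1" for x
  proof -
    obtain p where p: "p \<in> L1" "\<And>l. l \<in> L1 \<Longrightarrow> Re (cinner l (x - p)) = 0"
      using real_projection_exists[OF L1(1,2)] by blast
    have "x - p \<in> N1"
      using p that L1(3) complex_vector.subspace_diff[OF E1(2)] by (auto simp: N1_def)
    then show ?thesis using Z(2)[of p "x - p"] ZL0[OF p(1)] ZN0 by simp
  qed
  show ?thesis
  proof (rule tens_eqI)
    fix x y
    have "cinner \<zeta> (tens x y) = cinner \<zeta> (tens (cproj E1 x) y) + cinner \<zeta> (tens (x - cproj E1 x) y)"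
      by (simp add: cinner_simps tens_simps)
    also have "cinner \<zeta> (tens (x - cproj E1 x) y) = 0"
      by (rule \<zeta>1) (rule cproj(4)[OF E1])
    also have "cinner \<zeta> (tens (cproj E1 x) y) = 0"
      unfolding Z(1)[symmetric] by (simp add: ZE0 cproj(2)[OF E1] cinner_zero_left)
    finally have "cinner \<zeta> (tens x y) = 0" by simp
    then show "cinner (tens x y) \<zeta> = cinner (tens x y) 0"
      by (subst cinner_commute) (simp add: cinner_zero_right)
  qed
qed

section \<open>The real subspaces of a cyclic vector\<close>

definition cyclic_space :: "('a::chilbert_space \<Rightarrow> 'a) set \<Rightarrow> 'a \<Rightarrow> 'a set" where
  "cyclic_space M \<omega> = closure {x \<omega> | x. x \<in> M}"

text \<open>Within the cyclic space this is the real-orthogonal complement of the vectors \<i> x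
  \<omega> with x self-adjoint in \<open>M\<close>. It turns out to be the closure of the projected
  vectors x \<omega> with x self-adjoint in the commutant.\<close>

definition hermitian_space :: "('a::chilbert_space \<Rightarrow> 'a) set \<Rightarrow> 'a \<Rightarrow> 'a set" where
  "hermitian_space M \<omega> = {v \<in> cyclic_space M \<omega>. \<forall>x\<in>M. cadjoint x = x \<longrightarrow> Im (cinner (x \<omega>) v) = 0}"

locale cyclic_vector =
  fixes M :: "('a::chilbert_space \<Rightarrow> 'a) set" and \<omega> :: 'a
  assumes star: "unital_star_subalgebra M"
begin

abbreviation "E \<equiv> cyclic_space M \<omega>"
abbreviation "L \<equiv> hermitian_space M \<omega>"

lemmas M = unital_star_subalgebraD[OF star]

lemma E: "closed E" "complex_vector.subspace E"
  unfolding cyclic_space_def using closure_csubspace[OF orbit_csubspace[OF star]] by simp_all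

lemma orbit_in_E: "x \<in> M \<Longrightarrow> x \<omega> \<in> E"
  unfolding cyclic_space_def by (rule subsetD[OF closure_subset]) blast

lemma \<omega>_in_E: "\<omega> \<in> E"
  using orbit_in_E[OF M(3)] .

lemma E_invariant:
  assumes x: "x \<in> M" and "v \<in> E"
  shows "x v \<in> E"
  using assms(2)[unfolded cyclic_space_def]
proof (rule closure_induct)
  show "closed {v. x v \<in> E}"
    using closed_vimage[OF E(1) bounded_clinear_continuous_on[OF M(1)[OF x]]] by (simp add: vimage_def)
  fix v assume "v \<in> {y \<omega> | y. y \<in> M}"
  then obtain y where y: "y \<in> M" "v = y \<omega>" by blast
  show "x v \<in> E" unfolding y(2) by (rule orbit_in_E[OF M(6)[OF x y(1)]])
qed

lemma cproj_commutant: "cproj E \<in> commutant M"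
proof (rule commutantI)
  show "bounded_clinear (cproj E)" by (rule cproj(1)[OF E])
  show "cproj E (x v) = x (cproj E v)" if "x \<in> M" for x v
    by (rule cproj_commute[OF E M(1)[OF that]]) (simp_all add: E_invariant that M(7))
qed

lemma L_closed: "closed L"
proof -
  have "L = E \<inter> (\<Inter>x\<in>{x \<in> M. cadjoint x = x}. {v. Im (cinner (x \<omega>) v) = 0})"
    unfolding hermitian_space_def by auto
  moreover have "closed {v. Im (cinner (x \<omega>) v) = 0}" for x
    by (intro closed_Collect_eq continuous_intros cinner.continuous_on)
  then have "closed (\<Inter>x\<in>{x \<in> M. cadjoint x = x}. {v. Im (cinner (x \<omega>) v) = 0})"
    by (intro closed_INT) blast
  ultimately show ?thesis using closed_Int[OF E(1)] by simp
qed

lemma L_subspace: "subspace L"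
  using csubspace_imp_subspace[OF E(2)] unfolding subspace_def hermitian_space_def
  by (auto simp: cinner_simps)

lemma L_subset: "L \<subseteq> E"
  unfolding hermitian_space_def by auto

text \<open>Both the real and the imaginary part of <x \<omega>, v> vanish for self-adjoint x, so v
  is orthogonal to the cyclic space that contains it.\<close>

lemma L_trivial_intersection:
  assumes "v \<in> L" "\<i> *\<^sub>C v \<in> L"
  shows "v = 0"
proof -
  have sa: "cinner (x \<omega>) v = 0" if "x \<in> M" "cadjoint x = x" for x
    using assms that unfolding hermitian_space_def by (auto simp: cinner_simps complex_eq_iff)
  have orth: "cinner (x \<omega>) v = 0" if x: "x \<in> M" for x
    by (rule selfadjoint_decomposition[OF star x]) (simp add: cinner_simps sa)
  have "cinner v u = 0" if "u \<in> E" for u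
    using that[unfolded cyclic_space_def]
  proof (rule closure_induct)
    show "closed {u. cinner v u = 0}" by (rule closed_orthogonal)
    fix u assume "u \<in> {x \<omega> | x. x \<in> M}"
    then show "cinner v u = 0" by (subst cinner_commute) (auto simp: orth)
  qed
  then have "cinner v v = 0" using assms(1) L_subset by blast
  then show ?thesis by (simp add: cinner_self_eq_zero_iff)
qed

lemma cproj_commutant_in_L:
  assumes x: "x \<in> commutant M" "cadjoint x = x"
  shows "cproj E (x \<omega>) \<in> L"
  unfolding hermitian_space_def
proof (intro CollectI conjI ballI impI)
  show "cproj E (x \<omega>) \<in> E" by (rule cproj(2)[OF E])
  fix y assume y: "y \<in> M" "cadjoint y = y"
  note b = M(1)[OF y(1)] commutant_bounded[OF x(1)]
  have 1: "cinner (y \<omega>) (cproj E (x \<omega>)) = cinner (y \<omega>) (x \<omega>)"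
    unfolding cproj(5)[OF E, symmetric] cproj(3)[OF E orbit_in_E[OF y(1)]] ..
  have "cinner (y \<omega>) (x \<omega>) = cinner \<omega> (x (y \<omega>))"
    using cinner_cadjoint_left[OF b(1), of \<omega> "x \<omega>"] commutantD[OF x(1) y(1)] y(2) by simp
  also have "\<dots> = cinner (x \<omega>) (y \<omega>)"
    using cinner_cadjoint_left[OF b(2), of \<omega> "y \<omega>"] x(2) by simp
  also have "\<dots> = cnj (cinner (y \<omega>) (x \<omega>))" by (rule cinner_commute)
  finally have "Im (cinner (y \<omega>) (x \<omega>)) = Im (cnj (cinner (y \<omega>) (x \<omega>)))"
    by (rule arg_cong)
  then show "Im (cinner (y \<omega>) (cproj E (x \<omega>))) = 0" unfolding 1 by simp
qed

text \<open>This is where the density theorem enters. The residual of v after the real projection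
  stays in \<open>L\<close> and is orthogonal to the self-adjoint orbit of the commutant, so it
  vanishes.\<close>

lemma L_subset_closure:
  "L \<subseteq> closure {cproj E (x \<omega>) | x. x \<in> commutant M \<and> cadjoint x = x}" (is "_ \<subseteq> closure ?X")
proof
  fix v assume v: "v \<in> L"
  have comm: "unital_star_subalgebra (commutant M)"
    by (rule commutant_star_subalgebra[OF _ M(7)]) (auto intro: M(1))
  have "subspace ?X" by (rule selfadjoint_orbit_subspace[OF comm cproj(1)[OF E]])
  then obtain p where p: "p \<in> closure ?X" "\<And>x. x \<in> closure ?X \<Longrightarrow> Re (cinner x (v - p)) = 0"
    using real_projection_exists[OF closed_closure subspace_closure] by blast
  have "closure ?X \<subseteq> L"
    by (rule closure_minimal[OF _ L_closed]) (use cproj_commutant_in_L in blast)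
  then have vp: "v - p \<in> L" using p(1) v L_subspace subspace_diff by blast
  then have vpE: "v - p \<in> E" using L_subset by blast
  have "v - p = 0"
  proof (rule selfadjoint_orbit_density[OF star, of _ \<omega>])
    show "v - p \<in> closure {x \<omega> | x. x \<in> M}" using vpE unfolding cyclic_space_def .
    show "\<forall>x\<in>M. cadjoint x = x \<longrightarrow> Im (cinner (x \<omega>) (v - p)) = 0"
      using vp unfolding hermitian_space_def by blast
    show "\<forall>x\<in>commutant M. cadjoint x = x \<longrightarrow> Re (cinner (x \<omega>) (v - p)) = 0"
    proof (intro ballI impI)
      fix x assume "x \<in> commutant M" "cadjoint x = x"
      then have "cproj E (x \<omega>) \<in> closure ?X"
        by (intro subsetD[OF closure_subset]) blast
      then have "Re (cinner (cproj E (x \<omega>)) (v - p)) = 0" by (rule p(2))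
      then show "Re (cinner (x \<omega>) (v - p)) = 0"
        unfolding cproj(5)[OF E] cproj(3)[OF E vpE] .
    qed
  qed
  then show "v \<in> closure ?X" using p(1) by simp
qed

text \<open>A vector q real-orthogonal to all \<i> x \<omega> with x self-adjoint in
  \<open>M\<close> projects into \<open>L\<close>, hence is orthogonal to m; the bipolar argument
  concludes.\<close>

lemma L_complement_subset_closure:
  assumes m: "m \<in> E" "\<And>l. l \<in> L \<Longrightarrow> Re (cinner l m) = 0"
  shows "m \<in> closure {\<i> *\<^sub>C x \<omega> | x. x \<in> M \<and> cadjoint x = x}" (is "_ \<in> closure ?I")
proof (rule closure_bipolar)
  show "subspace ?I"
    by (rule selfadjoint_orbit_subspace[OF star bounded_clinear_scaleC[OF bounded_clinear_id(2)]])
  fix q assume q: "\<And>x. x \<in> ?I \<Longrightarrow> Re (cinner x q) = 0"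
  let ?q = "cproj E q"
  have "?q \<in> L"
    unfolding hermitian_space_def
  proof (intro CollectI conjI ballI impI)
    show "?q \<in> E" by (rule cproj(2)[OF E])
    fix x assume x: "x \<in> M" "cadjoint x = x"
    have "cinner (x \<omega>) ?q = cinner (x \<omega>) q"
      unfolding cproj(5)[OF E, symmetric] cproj(3)[OF E orbit_in_E[OF x(1)]] ..
    moreover have "Re (cinner (\<i> *\<^sub>C x \<omega>) q) = 0" using q x by blast
    ultimately show "Im (cinner (x \<omega>) ?q) = 0" by (simp add: cinner_simps)
  qed
  from m(2)[OF this] show "Re (cinner q m) = 0"
    unfolding cproj(5)[OF E] cproj(3)[OF E m(1)] .
qed

end

section \<open>The commutation theorem\<close>

lemma selfadjoint_products_real:
  assumes A: "bounded_clinear A" "cadjoint A = A" and B: "bounded_clinear B" "cadjoint B = B"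
    and comm: "A (B \<omega>) = B (A \<omega>)"
  shows "Im (cinner (A \<omega>) (B \<omega>)) = 0"
proof -
  have "cinner (A \<omega>) (B \<omega>) = cinner \<omega> (A (B \<omega>))"
    using cinner_cadjoint_left[OF A(1)] A(2) by metis
  also have "\<dots> = cinner (B \<omega>) (A \<omega>)" unfolding comm using cinner_cadjoint_left[OF B(1)] B(2)
    by metis
  also have "\<dots> = cnj (cinner (A \<omega>) (B \<omega>))" by (rule cinner_commute)
  finally have "Im (cinner (A \<omega>) (B \<omega>)) = Im (cnj (cinner (A \<omega>) (B \<omega>)))"
    by (rule arg_cong)
  then show ?thesis by simp
qed

lemma sesquilinear_polarization:
  fixes B :: "'a::complex_inner \<Rightarrow> 'a \<Rightarrow> complex"
  assumes "\<And>x x' y. B (x + x') y = B x y + B x' y" "\<And>x y y'. B x (y + y') = B x y + B x y'"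
    and "\<And>c x y. B (c *\<^sub>C x) y = cnj c * B x y" "\<And>c x y. B x (c *\<^sub>C y) = c * B x y"
    and diag: "\<And>x. B x x = 0"
  shows "B x y = 0"
proof -
  have "B (x + y) (x + y) = B x y + B y x" by (simp only: assms(1,2)) (simp add: diag)
  then have "B x y + B y x = 0" using diag by simp
  moreover have "\<i> * B x y - \<i> * B y x = 0"
  proof -
    have "B (x + \<i> *\<^sub>C y) (x + \<i> *\<^sub>C y) = \<i> * B x y - \<i> * B y x"
      by (simp only: assms(1-4)) (simp add: diag)
    then show ?thesis using diag by simp
  qed
  then have "B x y = B y x" by simp
  ultimately show ?thesis by simp
qed

lemma commute_of_selfadjoint_commute:
  assumes A: "unital_star_subalgebra A" and B: "unital_star_subalgebra B"
    and sa: "\<And>T S z. T \<in> A \<Longrightarrow> cadjoint T = T \<Longrightarrow> S \<in> B \<Longrightarrow> cadjoint S = S \<Longrightarrow> T (S z) = S (T z)"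
    and T: "T \<in> A" and S: "S \<in> B"
  shows "T (S z) = S (T z)"
proof -
  note bA = unital_star_subalgebraD(1)[OF A] and bB = unital_star_subalgebraD(1)[OF B]
  have half: "T (S z) = S (T z)" if S: "S \<in> B" "cadjoint S = S" for S z
  proof -
    obtain H K where HK: "H \<in> A" "cadjoint H = H" "K \<in> A" "cadjoint K = K"
      and T: "\<And>z. T z = (1/2) *\<^sub>C (H z - \<i> *\<^sub>C K z)"
      by (rule selfadjoint_decomposition[OF A T]) (rule that)
    show ?thesis
      unfolding T bounded_clinearD[OF bB[OF S(1)]] sa[OF HK(1,2) S] sa[OF HK(3,4) S] ..
  qed
  obtain H K where HK: "H \<in> B" "cadjoint H = H" "K \<in> B" "cadjoint K = K"
    and S: "\<And>z. S z = (1/2) *\<^sub>C (H z - \<i> *\<^sub>C K z)"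
    by (rule selfadjoint_decomposition[OF B S]) (rule that)
  show ?thesis
    unfolding S bounded_clinearD[OF bA[OF T]] half[OF HK(1,2)] half[OF HK(3,4)] ..
qed

definition tensor_generators ::
    "('h::chilbert_space \<Rightarrow> 'k::chilbert_space \<Rightarrow> 'l::chilbert_space) \<Rightarrow>
      ('h \<Rightarrow> 'h) set \<Rightarrow> ('k \<Rightarrow> 'k) set \<Rightarrow> ('l \<Rightarrow> 'l) set" where
  "tensor_generators tens M N = {tensor_op tens x id | x. x \<in> M} \<union> {tensor_op tens id y | y. y \<in> N}"

context hilbert_tensor_product
begin

lemma tensor_generators_bounded:
  assumes "M \<subseteq> Collect bounded_clinear" "N \<subseteq> Collect bounded_clinear"
  shows "tensor_generators tens M N \<subseteq> Collect bounded_clinear"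
  unfolding tensor_generators_def
  using assms by (auto intro!: tensor_op bounded_clinear_id)

lemma tensor_generators_adjoint:
  assumes "M \<subseteq> Collect bounded_clinear" "N \<subseteq> Collect bounded_clinear"
    and "\<And>S. S \<in> M \<Longrightarrow> cadjoint S \<in> M" "\<And>S. S \<in> N \<Longrightarrow> cadjoint S \<in> N"
    and "T \<in> tensor_generators tens M N"
  shows "cadjoint T \<in> tensor_generators tens M N"
proof -
  consider x where "x \<in> M" "T = x \<otimes> id" | y where "y \<in> N" "T = id \<otimes> y"
    using assms(5) unfolding tensor_generators_def by blast
  then show ?thesis
  proof cases
    case 1
    then have "cadjoint T = cadjoint x \<otimes> id"
      using assms(1) by (auto simp: tensor_op_adjoint bounded_clinear_id cadjoint_id)
    then show ?thesis unfolding tensor_generators_def using assms(3)[OF 1(1)] by blast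
  next
    case 2
    then have "cadjoint T = id \<otimes> cadjoint y"
      using assms(2) by (auto simp: tensor_op_adjoint bounded_clinear_id cadjoint_id)
    then show ?thesis unfolding tensor_generators_def using assms(4)[OF 2(1)] by blast
  qed
qed

lemma commutant_tensor_generatorsD:
  assumes T: "T \<in> commutant (tensor_generators tens M N)"
    and x: "x \<in> M" "bounded_clinear x" and y: "y \<in> N" "bounded_clinear y"
  shows "T ((x \<otimes> y) z) = (x \<otimes> y) (T z)"
proof -
  have *: "(x \<otimes> id) ((id \<otimes> y) z) = (x \<otimes> y) z" for z
    using tensor_op_comp[OF x(2) bounded_clinear_id(1) bounded_clinear_id(1) y(2)] by simp
  have "x \<otimes> id \<in> tensor_generators tens M N" "id \<otimes> y \<in> tensor_generators tens M N"
    using x(1) y(1) unfolding tensor_generators_def by blast+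
  then show ?thesis
    unfolding *[symmetric] by (simp add: commutantD[OF T])
qed

text \<open>It suffices that \<open>\<langle>T \<omega>, S \<omega>\<rangle>\<close> is real for elementary \<open>\<omega>\<close>. Up to the projection \<open>e\<close> onto
  \<open>E\<^sub>1 \<otimes> E\<^sub>2\<close>, both \<open>T \<omega>\<close> and \<open>S \<omega>\<close> are confined by the real subspace spanned by \<open>L\<^sub>1 \<otimes> L\<^sub>2\<close>:
  the first lies in its closure, and the second has real inner products with it.\<close>

lemma selfadjoint_commutants_real:
  assumes M: "unital_star_subalgebra M" and N: "unital_star_subalgebra N"
    and T: "T \<in> commutant (tensor_generators tens M N)" "cadjoint T = T"
    and S: "S \<in> commutant (tensor_generators tens (commutant M) (commutant N))" "cadjoint S = S"
  shows "Im (cinner (T (tens x y)) (S (tens x y))) = 0"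
proof -
  interpret c1: cyclic_vector M x by unfold_locales (rule M)
  interpret c2: cyclic_vector N y by unfold_locales (rule N)
  note bT = commutant_bounded[OF T(1)] and bS = commutant_bounded[OF S(1)]
  define \<omega> where "\<omega> = tens x y"
  define e where "e = cproj c1.E \<otimes> cproj c2.E"
  note P = cproj(1)[OF c1.E] cproj(1)[OF c2.E]
  have e_tens: "e (tens u v) = tens (cproj c1.E u) (cproj c2.E v)" for u v
    unfolding e_def by (rule tensor_op[OF P])
  have be: "bounded_clinear e" unfolding e_def by (rule tensor_op[OF P])
  have adjP: "cadjoint (cproj c1.E) = cproj c1.E" "cadjoint (cproj c2.E) = cproj c2.E"
    by (rule cadjoint_eqI[OF P(1)], rule cproj[OF c1.E], rule cadjoint_eqI[OF P(2)], rule cproj[OF c2.E])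
  have sae: "cinner (e u) v = cinner u (e v)" for u v
    using cinner_cadjoint_left[OF be, of u v] unfolding e_def tensor_op_adjoint[OF P] adjP .
  have e\<omega>: "e \<omega> = \<omega>"
    unfolding \<omega>_def e_tens by (simp add: cproj(3)[OF c1.E c1.\<omega>_in_E] cproj(3)[OF c2.E c2.\<omega>_in_E])
  \<comment> \<open>The projections lie in the commutants of \<open>M\<close> and \<open>N\<close>,
    with which \<open>S\<close> is compatible. Since \<open>S\<close> commutes with \<open>e\<close>
    and \<omega> is fixed by \<open>e\<close>, replacing T \<omega> by \<tau> = e (T \<omega>) does
    not change its inner product with S \<omega>.\<close>
  have Se: "S (e z) = e (S z)" for z
    unfolding e_def
    by (rule commutant_tensor_generatorsD[OF S(1) c1.cproj_commutant P(1) c2.cproj_commutant P(2)])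
  define \<tau> where "\<tau> = e (T \<omega>)"
  define X where "X = {tens u v | u v. u \<in> c1.L \<and> v \<in> c2.L}"
  define Q where "Q = closure (span X)"
  have Q: "closed Q" "subspace Q" unfolding Q_def by (simp_all add: subspace_closure)
  have XQ: "z \<in> Q" if "z \<in> X" for z
    unfolding Q_def by (rule subsetD[OF closure_subset]) (rule span_base[OF that])
  have Q_induct: "z \<in> R" if "z \<in> Q" "X \<subseteq> R" "closed R" "subspace R" for z R
    using closure_minimal[OF span_minimal[OF that(2,4)] that(3)] that(1) unfolding Q_def by blast
  \<comment> \<open>The aim is \<tau> = p, that is, \<tau> lies in the closed real span of L1
    \<otimes> L2. It follows once the residual \<tau> - p meets the hypotheses of
    \<open>real_subspaces_total\<close>.\<close>
  obtain p where p: "p \<in> Q" "\<And>z. z \<in> Q \<Longrightarrow> Re (cinner z (\<tau> - p)) = 0"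
    using real_projection_exists[OF Q] by blast
  have sa_real: "Im (cinner (tens (a x) (b y)) \<tau>) = 0"
    if a: "a \<in> M" "cadjoint a = a" and b: "b \<in> N" "cadjoint b = b" for a b
  proof -
    note ba = c1.M(1)[OF a(1)] and bb = c2.M(1)[OF b(1)]
    have ab: "(a \<otimes> b) \<omega> = tens (a x) (b y)" unfolding \<omega>_def by (rule tensor_op[OF ba bb])
    have "e (tens (a x) (b y)) = tens (a x) (b y)"
      unfolding e_tens by (simp add: cproj(3)[OF c1.E c1.orbit_in_E[OF a(1)]] cproj(3)[OF c2.E c2.orbit_in_E[OF b(1)]])
    then have "cinner (tens (a x) (b y)) \<tau> = cinner ((a \<otimes> b) \<omega>) (T \<omega>)"
      unfolding \<tau>_def sae[symmetric] ab by simp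
    moreover have "Im \<dots> = 0"
    proof (rule selfadjoint_products_real[OF _ _ bT T(2)])
      show "bounded_clinear (a \<otimes> b)" by (rule tensor_op[OF ba bb])
      show "cadjoint (a \<otimes> b) = a \<otimes> b" using tensor_op_adjoint[OF ba bb] a b by simp
      show "(a \<otimes> b) (T \<omega>) = T ((a \<otimes> b) \<omega>)"
        by (rule commutant_tensor_generatorsD[OF T(1) a(1) ba b(1) bb, symmetric])
    qed
    ultimately show ?thesis by simp
  qed
  have ep: "e p = p"
  proof -
    have "p \<in> {z. e z = z}"
    proof (rule Q_induct[OF p(1)])
      show "X \<subseteq> {z. e z = z}"
        using c1.L_subset c2.L_subset by (auto simp: X_def e_tens cproj(3)[OF c1.E] cproj(3)[OF c2.E] subset_iff)
      show "closed {z. e z = z}"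
        by (intro closed_Collect_eq bounded_clinear_continuous_on be continuous_intros)
      show "subspace {z. e z = z}" by (simp add: subspace_def bounded_clinearD[OF be])
    qed
    then show ?thesis by simp
  qed
  have e\<tau>: "e \<tau> = \<tau>" unfolding \<tau>_def e_def
    by (simp add: tensor_op_comp[OF P P] cproj(3)[OF c1.E cproj(2)[OF c1.E]] cproj(3)[OF c2.E cproj(2)[OF c2.E]])
  \<comment> \<open>The residual is fixed by \<open>e\<close>, so it sees only the components of u
    and v in the cyclic spaces.\<close>
  have vanish: "cinner (\<tau> - p) (tens u v) = 0" if "cproj c1.E u = 0 \<or> cproj c2.E v = 0" for u v
  proof -
    have "cinner (\<tau> - p) (tens u v) = cinner (e (\<tau> - p)) (tens u v)"
      by (simp add: bounded_clinearD[OF be] ep e\<tau>)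
    also have "\<dots> = 0" unfolding sae e_tens using that by (auto simp: tens_simps cinner_simps)
    finally show ?thesis .
  qed
  \<comment> \<open>The real complement of \<open>L\<close> is approximated by vectors \<i> a x, so
    each factor carries an \<i>. Together they give -1, and reality for a x \<otimes> b y is
    enough.\<close>
  have base: "Im (cinner (tens (\<i> *\<^sub>C a x) (\<i> *\<^sub>C b y)) (\<tau> - p)) = 0"
    if a: "a \<in> M" "cadjoint a = a" and b: "b \<in> N" "cadjoint b = b" for a b
  proof -
    have "p \<in> {z. Im (cinner (tens (a x) (b y)) z) = 0}"
    proof (rule Q_induct[OF p(1)])
      show "X \<subseteq> {z. Im (cinner (tens (a x) (b y)) z) = 0}"
        using a b by (auto simp: X_def cinner_tens hermitian_space_def)
      show "closed {z. Im (cinner (tens (a x) (b y)) z) = 0}"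
        by (intro closed_Collect_eq continuous_intros cinner.continuous_on)
      show "subspace {z. Im (cinner (tens (a x) (b y)) z) = 0}"
        by (simp add: subspace_def cinner_simps)
    qed
    then have "Im (cinner (tens (a x) (b y)) (\<tau> - p)) = 0"
      using sa_real[OF a b] by (simp add: cinner_diff_right)
    moreover have "tens (\<i> *\<^sub>C a x) (\<i> *\<^sub>C b y) = - tens (a x) (b y)"
      by (simp add: tens_linear scaleC_scaleC scaleC_one complex_vector.scale_minus_left)
    ultimately show ?thesis by (simp add: cinner_minus_left)
  qed
  have \<tau>p: "\<tau> - p = 0"
  proof (rule real_subspaces_total[OF c1.E c2.E c1.L_closed c1.L_subspace c1.L_subset
        c1.L_trivial_intersection c2.L_closed c2.L_subspace c2.L_subset c2.L_trivial_intersection])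
    fix u v
    show "cinner (\<tau> - p) (tens u v) = 0" if "\<And>x'. x' \<in> c1.E \<Longrightarrow> cinner x' u = 0"
      using vanish cproj_eq_0[OF c1.E that] by blast
    show "cinner (\<tau> - p) (tens u v) = 0" if "\<And>y'. y' \<in> c2.E \<Longrightarrow> cinner y' v = 0"
      using vanish cproj_eq_0[OF c2.E that] by blast
    show "Re (cinner (\<tau> - p) (tens u v)) = 0" if "u \<in> c1.L" "v \<in> c2.L"
    proof -
      have "tens u v \<in> X" using that unfolding X_def by blast
      from p(2)[OF XQ[OF this]] show ?thesis by (subst Re_cinner_commute)
    qed
    show "Im (cinner (\<tau> - p) (tens u v)) = 0"
      if u: "u \<in> c1.E" "\<And>l. l \<in> c1.L \<Longrightarrow> Re (cinner l u) = 0"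
        and v: "v \<in> c2.E" "\<And>l. l \<in> c2.L \<Longrightarrow> Re (cinner l v) = 0"
    proof -
      have cl: "u \<in> closure {\<i> *\<^sub>C a x | a. a \<in> M \<and> cadjoint a = a}"
        "v \<in> closure {\<i> *\<^sub>C b y | b. b \<in> N \<and> cadjoint b = b}"
        using c1.L_complement_subset_closure[of u] c2.L_complement_subset_closure[of v] u v by blast+
      have step: "Im (cinner (tens u (\<i> *\<^sub>C b y)) (\<tau> - p)) = 0" if b: "b \<in> N" "cadjoint b = b" for b
        using cl(1)
      proof (rule closure_induct)
        show "closed {u. Im (cinner (tens u (\<i> *\<^sub>C b y)) (\<tau> - p)) = 0}"
          by (intro closed_Collect_eq continuous_intros cinner.continuous_on
              bounded_clinear_continuous_on bounded_clinear_tens)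
      qed (clarify, rule base, (assumption | rule b)+)
      have "Im (cinner (tens u v) (\<tau> - p)) = 0"
        using cl(2)
      proof (rule closure_induct)
        show "closed {v. Im (cinner (tens u v) (\<tau> - p)) = 0}"
          by (intro closed_Collect_eq continuous_intros cinner.continuous_on
              bounded_clinear_continuous_on bounded_clinear_tens)
      qed (clarify, rule step, assumption+)
      then show ?thesis by (subst cinner_commute) simp
    qed
  qed
  have base': "Im (cinner (tens (cproj c1.E (a x)) (cproj c2.E (b y))) (S \<omega>)) = 0"
    if a: "a \<in> commutant M" "cadjoint a = a" and b: "b \<in> commutant N" "cadjoint b = b" for a b
  proof -
    note ba = commutant_bounded[OF a(1)] and bb = commutant_bounded[OF b(1)]
    have ab: "(a \<otimes> b) \<omega> = tens (a x) (b y)" unfolding \<omega>_def by (rule tensor_op[OF ba bb])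
    have "cinner (tens (cproj c1.E (a x)) (cproj c2.E (b y))) (S \<omega>) = cinner ((a \<otimes> b) \<omega>) (e (S \<omega>))"
      unfolding e_tens[symmetric] sae ab ..
    also have "\<dots> = cinner ((a \<otimes> b) \<omega>) (S \<omega>)" unfolding Se[symmetric] e\<omega> ..
    finally show ?thesis
    proof (rule ssubst)
      show "Im (cinner ((a \<otimes> b) \<omega>) (S \<omega>)) = 0"
      proof (rule selfadjoint_products_real[OF _ _ bS S(2)])
        show "bounded_clinear (a \<otimes> b)" by (rule tensor_op[OF ba bb])
        show "cadjoint (a \<otimes> b) = a \<otimes> b" using tensor_op_adjoint[OF ba bb] a b by simp
        show "(a \<otimes> b) (S \<omega>) = S ((a \<otimes> b) \<omega>)"
          by (rule commutant_tensor_generatorsD[OF S(1) a(1) ba b(1) bb, symmetric])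
      qed
    qed
  qed
  have "p \<in> {z. Im (cinner z (S \<omega>)) = 0}"
  proof (rule Q_induct[OF p(1)])
    show "X \<subseteq> {z. Im (cinner z (S \<omega>)) = 0}"
    proof
      fix z assume "z \<in> X"
      then obtain u v where uv: "u \<in> c1.L" "v \<in> c2.L" "z = tens u v" unfolding X_def by blast
      have step: "Im (cinner (tens u (cproj c2.E (b y))) (S \<omega>)) = 0"
        if b: "b \<in> commutant N" "cadjoint b = b" for b
        using subsetD[OF c1.L_subset_closure uv(1)]
      proof (rule closure_induct)
        show "closed {u. Im (cinner (tens u (cproj c2.E (b y))) (S \<omega>)) = 0}"
          by (intro closed_Collect_eq continuous_intros cinner.continuous_on
              bounded_clinear_continuous_on bounded_clinear_tens)
      qed (clarify, rule base', (assumption | rule b)+)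
      have "Im (cinner (tens u v) (S \<omega>)) = 0"
        using subsetD[OF c2.L_subset_closure uv(2)]
      proof (rule closure_induct)
        show "closed {v. Im (cinner (tens u v) (S \<omega>)) = 0}"
          by (intro closed_Collect_eq continuous_intros cinner.continuous_on
              bounded_clinear_continuous_on bounded_clinear_tens)
      qed (clarify, rule step, assumption+)
      then show "z \<in> {z. Im (cinner z (S \<omega>)) = 0}" using uv(3) by simp
    qed
    show "closed {z. Im (cinner z (S \<omega>)) = 0}"
      by (intro closed_Collect_eq continuous_intros cinner.continuous_on)
    show "subspace {z. Im (cinner z (S \<omega>)) = 0}" by (simp add: subspace_def cinner_simps)
  qed
  then have "Im (cinner \<tau> (S \<omega>)) = 0" using \<tau>p by simp
  moreover have "cinner \<tau> (S \<omega>) = cinner (T \<omega>) (S \<omega>)"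
    unfolding \<tau>_def sae Se[symmetric] e\<omega> ..
  ultimately show ?thesis unfolding \<omega>_def by simp
qed

theorem tensor_commutation:
  assumes M: "unital_star_subalgebra M" and N: "unital_star_subalgebra N"
    and T: "T \<in> commutant (tensor_generators tens M N)"
    and S: "S \<in> commutant (tensor_generators tens (commutant M) (commutant N))"
  shows "T (S z) = S (T z)"
proof -
  have star: "unital_star_subalgebra (commutant (tensor_generators tens A B))"
    if A: "unital_star_subalgebra A" and B: "unital_star_subalgebra B" for A B
  proof -
    note A = unital_star_subalgebraD[OF A] and B = unital_star_subalgebraD[OF B]
    have AB: "A \<subseteq> Collect bounded_clinear" "B \<subseteq> Collect bounded_clinear" using A(1) B(1)
      by blast+
    show ?thesis
      by (rule commutant_star_subalgebra[OF tensor_generators_bounded[OF AB]])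
        (rule tensor_generators_adjoint[OF AB A(7) B(7)])
  qed
  have comm: "unital_star_subalgebra (commutant A)" if A: "unital_star_subalgebra A" for A :: "('m::chilbert_space \<Rightarrow> 'm) set"
    using unital_star_subalgebraD(1)[OF A]
    by (intro commutant_star_subalgebra unital_star_subalgebraD(7)[OF A]) auto
  show ?thesis
  proof (rule commute_of_selfadjoint_commute[OF star[OF M N] star[OF comm[OF M] comm[OF N]] _ T S])
    fix T S z
    assume T: "T \<in> commutant (tensor_generators tens M N)" "cadjoint T = T"
      and S: "S \<in> commutant (tensor_generators tens (commutant M) (commutant N))" "cadjoint S = S"
    note bT = commutant_bounded[OF T(1)] and bS = commutant_bounded[OF S(1)]
    define C where "C z = T (S z) - S (T z)" for z
    have bC: "bounded_clinear C"
      unfolding C_def by (intro bounded_clinear_diff) (rule bounded_clinear_compose bT bS; fact)+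
    note Cs = bounded_clinearD[OF bC] tens_linear cinner_simps
    have diag: "cinner (tens x y) (C (tens x y)) = 0" for x y
    proof -
      let ?w = "tens x y"
      have "cinner ?w (T (S ?w)) = cinner (T ?w) (S ?w)" "cinner ?w (S (T ?w)) = cinner (S ?w) (T ?w)"
        using cinner_cadjoint_left[OF bT] cinner_cadjoint_left[OF bS] T(2) S(2) by metis+
      moreover have "cinner (S ?w) (T ?w) = cnj (cinner (T ?w) (S ?w))" by (rule cinner_commute)
      moreover have "Im (cinner (T ?w) (S ?w)) = 0" by (rule selfadjoint_commutants_real[OF M N T S])
      ultimately show ?thesis by (simp add: C_def cinner_diff_right complex_eq_iff)
    qed
    \<comment> \<open>Only elementary tensors are known to give zero on the diagonal, and they are
      not closed under sums. Polarisation is therefore done in one factor at a time.\<close>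
    have 1: "cinner (tens x y) (C (tens x' y)) = 0" for x x' y
      by (rule sesquilinear_polarization[of "\<lambda>x x'. cinner (tens x y) (C (tens x' y))"])
        (simp_all add: Cs diag)
    have 2: "cinner (tens x y) (C (tens x' y')) = 0" for x x' y y'
      by (rule sesquilinear_polarization[of "\<lambda>y y'. cinner (tens x y) (C (tens x' y'))"])
        (simp_all add: Cs 1)
    have "C = (\<lambda>z. 0)"
    proof (rule tens_op_eqI[OF bC bounded_clinear_zero])
      show "C (tens x y) = 0" for x y by (rule tens_eqI) (simp add: 2 cinner_zero_right)
    qed
    then have "C z = 0" by (rule fun_cong)
    then show "T (S z) = S (T z)" by (simp add: C_def)
  qed
qed

end

section \<open>Gradings and the twist\<close>

lemma half_add: "(1/2) *\<^sub>C (x + x) = (x :: 'a::complex_inner)"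
  by (simp add: scaleC_add_right flip: scaleC_add_left)

locale grading =
  fixes U :: "'a::chilbert_space \<Rightarrow> 'a"
  assumes selfadjoint_unitary: "selfadjoint_unitary U"
begin

lemma bounded: "bounded_clinear U"
  using selfadjoint_unitary unfolding selfadjoint_unitary_def by blast

lemma involution: "U (U x) = x"
  by (rule selfadjoint_unitary_involution[OF selfadjoint_unitary])

lemma adjoint: "cadjoint U = U"
  using selfadjoint_unitary unfolding selfadjoint_unitary_def by blast

lemma symmetric: "cinner (U x) y = cinner x (U y)"
  using cinner_cadjoint_left[OF bounded] adjoint by metis

lemmas lin = bounded_clinearD[OF bounded]

lemma even_op_iff: "even_op U T \<longleftrightarrow> (\<forall>x. U (T x) = T (U x))"
  unfolding even_op_def fun_eq_iff comp_def by (metis involution)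

lemma odd_op_iff: "odd_op U T \<longleftrightarrow> (\<forall>x. U (T x) = - T (U x))"
  unfolding odd_op_def fun_eq_iff comp_def by (metis involution)

lemma even_op_cadjoint:
  assumes T: "bounded_clinear T" "even_op U T"
  shows "even_op U (cadjoint T)"
  unfolding even_op_iff
proof (intro allI cinner_eqI)
  fix x z
  have "cinner z (U (cadjoint T x)) = cinner (T (U z)) x"
    by (simp add: symmetric[symmetric] cinner_cadjoint_right[OF T(1)])
  also have "\<dots> = cinner (U (T z)) x" using T(2) unfolding even_op_iff by simp
  also have "\<dots> = cinner z (cadjoint T (U x))" by (simp add: symmetric cinner_cadjoint_right[OF T(1)])
  finally show "cinner z (U (cadjoint T x)) = cinner z (cadjoint T (U x))" .
qed

lemma odd_op_cadjoint:
  assumes T: "bounded_clinear T" "odd_op U T"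
  shows "odd_op U (cadjoint T)"
  unfolding odd_op_iff
proof (intro allI cinner_eqI)
  fix x z
  have "cinner z (U (cadjoint T x)) = - cinner (- T (U z)) x"
    by (simp add: symmetric[symmetric] cinner_cadjoint_right[OF T(1)] cinner_minus_left)
  also have "\<dots> = - cinner (U (T z)) x" using T(2) unfolding odd_op_iff by simp
  also have "\<dots> = cinner z (- cadjoint T (U x))"
    by (simp add: symmetric cinner_cadjoint_right[OF T(1)] cinner_minus_right)
  finally show "cinner z (U (cadjoint T x)) = cinner z (- cadjoint T (U x))" .
qed

lemma part_bounded:
  assumes "bounded_clinear T"
  shows "bounded_clinear (even_part U T)" "bounded_clinear (odd_part U T)"
  unfolding even_part_def odd_part_def
  by (intro bounded_clinear_scaleC bounded_clinear_add bounded_clinear_diff assms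
      bounded_clinear_compose[OF bounded bounded_clinear_compose[OF assms bounded]])+

lemmas decomposition = even_odd_decomposition[OF selfadjoint_unitary]

lemma parts_of_even:
  assumes "even_op U T"
  shows "even_part U T = T" "odd_part U T = (\<lambda>x. 0)"
proof -
  have "odd_op U (\<lambda>x. 0)" unfolding odd_op_iff by (simp add: lin)
  from decomposition(4)[OF assms this, of T] show "even_part U T = T" "odd_part U T = (\<lambda>x. 0)" by simp_all
qed

lemma parts_of_odd:
  assumes "odd_op U T"
  shows "even_part U T = (\<lambda>x. 0)" "odd_part U T = T"
proof -
  have "even_op U (\<lambda>x. 0)" unfolding even_op_iff by (simp add: lin)
  from decomposition(4)[OF this assms, of T] show "even_part U T = (\<lambda>x. 0)" "odd_part U T = T" by simp_all
qed

lemma twist_even: "even_op U T \<Longrightarrow> twist U T = T"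
  unfolding twist_def by (simp add: parts_of_even lin)

lemma twist_odd: "odd_op U T \<Longrightarrow> twist U T = (\<lambda>x. \<i> *\<^sub>C U (T x))"
  unfolding twist_def by (simp add: parts_of_odd)

lemma even_op_id: "even_op U id"
  unfolding even_op_iff by simp

lemma odd_op_twist: "odd_op U T \<Longrightarrow> odd_op U (\<lambda>x. \<i> *\<^sub>C U (T x))"
  unfolding odd_op_iff by (simp add: lin)

text \<open>Up to normalisation, \<open>1 + \<i> U\<close> is the unitary implementing the twist.\<close>

definition "fwd x = x + \<i> *\<^sub>C U x"
definition "bwd x = x - \<i> *\<^sub>C U x"

lemma fwd_bwd_bounded: "bounded_clinear fwd" "bounded_clinear bwd"
  unfolding fwd_def[abs_def] bwd_def[abs_def]
  by (intro bounded_clinear_add bounded_clinear_diff bounded_clinear_id bounded_clinear_scaleC bounded)+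

lemmas fb_lin = bounded_clinearD[OF fwd_bwd_bounded(1)] bounded_clinearD[OF fwd_bwd_bounded(2)]

lemma fwd_bwd: "fwd (bwd x) = x + x" "bwd (fwd x) = x + x"
  unfolding fwd_def bwd_def
  by (simp_all add: lin involution scaleC_scaleC scaleC_one scaleC_add_right
      complex_vector.scale_right_diff_distrib complex_vector.scale_minus_left)

lemma cadjoint_fwd_bwd: "cadjoint fwd = bwd" "cadjoint bwd = fwd"
proof -
  have *: "cinner (bwd x) y = cinner x (fwd y)" for x y
    by (simp add: fwd_def bwd_def cinner_simps symmetric)
  show "cadjoint fwd = bwd" by (rule cadjoint_eqI[OF fwd_bwd_bounded(1)]) (rule *)
  then show "cadjoint bwd = fwd" using cadjoint_cadjoint[OF fwd_bwd_bounded(1)] by simp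
qed

text \<open>Expanding (1 + \<i> U) T (1 - \<i> U) gives T + U T U + \<i> (U T - T U), and U times
  the odd part of T is half of U T - T U. Conjugation makes it plain that the twist respects
  products and adjoints.\<close>

lemma twist_conj:
  assumes "bounded_clinear T"
  shows "twist U T x = (1/2) *\<^sub>C fwd (T (bwd x))"
proof -
  note T = bounded_clinearD[OF assms]
  have "twist U T x = (1/2) *\<^sub>C (T x + U (T (U x))) + \<i> *\<^sub>C ((1/2) *\<^sub>C (U (T x) - T (U x)))"
    unfolding twist_def even_part_def odd_part_def by (simp add: lin involution)
  also have "\<dots> = (1/2) *\<^sub>C (T x + U (T (U x)) + (\<i> *\<^sub>C U (T x) - \<i> *\<^sub>C T (U x)))"
    by (simp add: scaleC_scaleC mult.commute scaleC_add_right complex_vector.scale_right_diff_distrib)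
  also have "T x + U (T (U x)) + (\<i> *\<^sub>C U (T x) - \<i> *\<^sub>C T (U x)) = fwd (T (bwd x))"
    unfolding fwd_def bwd_def
    by (simp add: T lin scaleC_scaleC scaleC_one complex_vector.scale_right_diff_distrib
        complex_vector.scale_minus_left)
  finally show ?thesis .
qed

lemma twist_bounded:
  assumes T: "bounded_clinear T"
  shows "bounded_clinear (twist U T)"
proof -
  have "twist U T = (\<lambda>x. (1/2) *\<^sub>C fwd (T (bwd x)))" using twist_conj[OF T] by blast
  then show ?thesis
    using bounded_clinear_scaleC[OF bounded_clinear_compose[OF fwd_bwd_bounded(1)
          bounded_clinear_compose[OF T fwd_bwd_bounded(2)]]] by simp
qed

lemma twist_comp:
  assumes S: "bounded_clinear S" and T: "bounded_clinear T"
  shows "twist U S (twist U T x) = twist U (\<lambda>x. S (T x)) x"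
proof -
  have "twist U S (twist U T x) = (1/2) *\<^sub>C (1/2) *\<^sub>C (fwd (S (T (bwd x))) + fwd (S (T (bwd x))))"
    by (simp only: twist_conj[OF S] twist_conj[OF T] fb_lin fwd_bwd bounded_clinearD[OF S])
  then show ?thesis
    unfolding half_add by (simp add: twist_conj[OF bounded_clinear_compose[OF S T]])
qed

lemma twist_cadjoint:
  assumes T: "bounded_clinear T"
  shows "cadjoint (twist U T) = twist U (cadjoint T)"
proof (rule cadjoint_eqI[OF twist_bounded[OF T]])
  have fb: "cinner (fwd u) v = cinner u (bwd v)" "cinner (bwd u) v = cinner u (fwd v)" for u v
    using cinner_cadjoint_left[OF fwd_bwd_bounded(1)] cinner_cadjoint_left[OF fwd_bwd_bounded(2)]
    by (simp_all add: cadjoint_fwd_bwd)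
  show "cinner (twist U (cadjoint T) x) y = cinner x (twist U T y)" for x y
    by (simp add: twist_conj[OF T] twist_conj[OF bounded_clinear_cadjoint[OF T]] cinner_simps fb
        cinner_cadjoint_left[OF T])
qed

lemma twist_surj:
  assumes T: "bounded_clinear T"
  shows "\<exists>S. bounded_clinear S \<and> twist U S = T"
proof (intro exI conjI)
  let ?S = "\<lambda>x. (1/2) *\<^sub>C bwd (T (fwd x))"
  show S: "bounded_clinear ?S"
    by (rule bounded_clinear_scaleC[OF bounded_clinear_compose[OF fwd_bwd_bounded(2)
          bounded_clinear_compose[OF T fwd_bwd_bounded(1)]]])
  show "twist U ?S = T"
  proof
    fix x
    have "twist U ?S x = (1/2) *\<^sub>C (1/2) *\<^sub>C ((T x + T x) + (T x + T x))"
      by (simp only: twist_conj[OF S] fb_lin fwd_bwd bounded_clinearD[OF T])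
    then show "twist U ?S x = T x" unfolding half_add .
  qed
qed

lemma twist_inj:
  assumes S: "bounded_clinear S" and T: "bounded_clinear T" and eq: "twist U S = twist U T"
  shows "S = T"
proof
  fix x
  have "bwd (twist U R (fwd x)) = R x + R x" if R: "bounded_clinear R" for R
  proof -
    have "bwd (twist U R (fwd x)) = (1/2) *\<^sub>C ((R x + R x) + (R x + R x))"
      by (simp only: twist_conj[OF R] fb_lin fwd_bwd bounded_clinearD[OF R])
    then show ?thesis unfolding half_add .
  qed
  from this[OF S] this[OF T] have *: "S x + S x = T x + T x"
    unfolding eq by simp
  have "S x = (1/2) *\<^sub>C (S x + S x)" by (simp only: half_add)
  also have "\<dots> = T x" unfolding * half_add ..
  finally show "S x = T x" .
qed

text \<open>The twist is a multiplicative bijection of the bounded operators, and such a map carries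
  commutants to commutants.\<close>

lemma twist_commutant:
  assumes X: "X \<subseteq> Collect bounded_clinear"
  shows "twist U ` commutant X = commutant (twist U ` X)"
proof (intro equalityI subsetI)
  fix R assume "R \<in> twist U ` commutant X"
  then obtain T where T: "T \<in> commutant X" "R = twist U T" by blast
  note bT = commutant_bounded[OF T(1)]
  show "R \<in> commutant (twist U ` X)"
  proof (rule commutantI)
    show "bounded_clinear R" unfolding T(2) by (rule twist_bounded[OF bT])
    fix S' x assume "S' \<in> twist U ` X"
    then obtain S where S: "S \<in> X" "S' = twist U S" by blast
    have bS: "bounded_clinear S" using S(1) X by blast
    show "R (S' x) = S' (R x)"
      unfolding S(2) T(2) twist_comp[OF bS bT] twist_comp[OF bT bS] by (simp add: commutantD[OF T(1) S(1)])
  qed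
next
  fix R assume R: "R \<in> commutant (twist U ` X)"
  obtain T where T: "bounded_clinear T" "twist U T = R" using twist_surj[OF commutant_bounded[OF R]] by blast
  have "T \<in> commutant X"
  proof (rule commutantI[OF T(1)])
    fix S x assume S: "S \<in> X"
    then have bS: "bounded_clinear S" using X by blast
    have "twist U (\<lambda>x. T (S x)) = twist U (\<lambda>x. S (T x))"
    proof
      fix x
      have "R (twist U S x) = twist U S (R x)" using commutantD[OF R] S by blast
      then show "twist U (\<lambda>x. T (S x)) x = twist U (\<lambda>x. S (T x)) x"
        unfolding T(2)[symmetric] twist_comp[OF bS T(1)] twist_comp[OF T(1) bS] .
    qed
    then have "(\<lambda>x. T (S x)) = (\<lambda>x. S (T x))"
      by (rule twist_inj[OF bounded_clinear_compose[OF T(1) bS] bounded_clinear_compose[OF bS T(1)]])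
    then show "T (S x) = S (T x)" by (rule fun_cong)
  qed
  then show "R \<in> twist U ` commutant X" using T(2) by blast
qed

lemma invariant_commutant:
  assumes inv: "(\<lambda>T. U \<circ> T \<circ> U) ` M \<subseteq> M" and T: "T \<in> commutant M"
  shows "(\<lambda>x. U (T (U x))) \<in> commutant M"
proof (rule commutantI)
  note bT = commutant_bounded[OF T]
  show "bounded_clinear (\<lambda>x. U (T (U x)))"
    by (rule bounded_clinear_compose[OF bounded bounded_clinear_compose[OF bT bounded]])
  fix S x assume S: "S \<in> M"
  then have "U \<circ> S \<circ> U \<in> M" using inv by blast
  from commutantD[OF T this, of "U x"] show "U (T (U (S x))) = S (U (T (U x)))"
    by (metis comp_apply involution)
qed

lemma parts_mem:
  assumes A: "unital_star_subalgebra A" and inv: "\<And>T. T \<in> A \<Longrightarrow> (\<lambda>x. U (T (U x))) \<in> A" and T: "T \<in> A"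
  shows "even_part U T \<in> A" "odd_part U T \<in> A"
  unfolding even_part_def odd_part_def
  by (rule unital_star_subalgebraD(5)[OF A], rule unital_star_subalgebraD(4)[OF A] unital_star_subalgebraD(8)[OF A],
      rule T, rule inv, rule T)+

lemma commutant_parts_mem:
  assumes M: "unital_star_subalgebra M" and inv: "(\<lambda>T. U \<circ> T \<circ> U) ` M \<subseteq> M" and T: "T \<in> commutant M"
  shows "even_part U T \<in> commutant M" "odd_part U T \<in> commutant M"
proof -
  have "unital_star_subalgebra (commutant M)"
    using unital_star_subalgebraD(1)[OF M]
    by (intro commutant_star_subalgebra unital_star_subalgebraD(7)[OF M]) auto
  from parts_mem[OF this invariant_commutant[OF inv] T]
  show "even_part U T \<in> commutant M" "odd_part U T \<in> commutant M" by blast+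
qed

lemma parts_twist:
  "even_part U (twist U T) = even_part U T"
  "odd_part U (twist U T) = (\<lambda>x. \<i> *\<^sub>C U (odd_part U T x))"
  using decomposition(4)[OF decomposition(1)[of T] odd_op_twist[OF decomposition(2)[of T]], of "twist U T"]
  unfolding twist_def by simp_all

lemma even_mem_twisted_commutant: "T \<in> commutant M \<Longrightarrow> even_op U T \<Longrightarrow> T \<in> twisted_commutant U M"
  unfolding twisted_commutant_def using twist_even[of T] by force

lemma odd_mem_twisted_commutant:
  "T \<in> commutant M \<Longrightarrow> odd_op U T \<Longrightarrow> (\<lambda>x. \<i> *\<^sub>C U (T x)) \<in> twisted_commutant U M"
  unfolding twisted_commutant_def using twist_odd[of T] by force

text \<open>These are the closure properties from which the generators of a graded tensor algebra
  are identified.\<close>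

lemma twisted_commutant_props:
  assumes M: "unital_star_subalgebra M" and inv: "(\<lambda>T. U \<circ> T \<circ> U) ` M \<subseteq> M"
  shows "twisted_commutant U M \<subseteq> Collect bounded_clinear" "id \<in> twisted_commutant U M"
    "T \<in> twisted_commutant U M \<Longrightarrow> cadjoint T \<in> twisted_commutant U M"
    "T \<in> twisted_commutant U M \<Longrightarrow> even_part U T \<in> twisted_commutant U M"
    "T \<in> twisted_commutant U M \<Longrightarrow> odd_part U T \<in> twisted_commutant U M"
proof -
  have "unital_star_subalgebra (commutant M)"
    using unital_star_subalgebraD(1)[OF M]
    by (intro commutant_star_subalgebra unital_star_subalgebraD(7)[OF M]) auto
  note C = unital_star_subalgebraD[OF this] and parts = commutant_parts_mem[OF M inv]
  show "twisted_commutant U M \<subseteq> Collect bounded_clinear"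
    unfolding twisted_commutant_def using twist_bounded C(1) by blast
  show "id \<in> twisted_commutant U M" by (rule even_mem_twisted_commutant[OF C(2) even_op_id])
  assume "T \<in> twisted_commutant U M"
  then obtain S where S: "S \<in> commutant M" "T = twist U S" unfolding twisted_commutant_def by blast
  show "cadjoint T \<in> twisted_commutant U M"
    unfolding S(2) twist_cadjoint[OF C(1)[OF S(1)]] twisted_commutant_def by (rule imageI[OF C(7)[OF S(1)]])
  show "even_part U T \<in> twisted_commutant U M"
    unfolding S(2) parts_twist by (rule even_mem_twisted_commutant[OF parts(1)[OF S(1)] decomposition(1)])
  show "odd_part U T \<in> twisted_commutant U M"
    unfolding S(2) parts_twist by (rule odd_mem_twisted_commutant[OF parts(2)[OF S(1)] decomposition(2)])
qed

end

section \<open>Graded tensor products\<close>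

lemma von_neumann_algebraD:
  assumes "von_neumann_algebra M"
  shows "unital_star_subalgebra M" "commutant (commutant M) = M"
  using assms unfolding von_neumann_algebra_def by blast+

lemma von_neumann_double_commutant:
  assumes "X \<subseteq> Collect bounded_clinear" "\<And>S. S \<in> X \<Longrightarrow> cadjoint S \<in> X"
  shows "von_neumann_algebra (commutant (commutant X))"
proof -
  have "unital_star_subalgebra (commutant X)" by (rule commutant_star_subalgebra) fact+
  note C = unital_star_subalgebraD[OF this]
  have "commutant X \<subseteq> Collect bounded_clinear" using C(1) by blast
  then show ?thesis
    unfolding von_neumann_algebra_def
    using commutant_star_subalgebra[OF _ C(7)] triple_commutant by blast
qed

text \<open>\<open>X\<close> is a convenient self-adjoint generating set, whereas the defining
  family \<open>Y\<close> of graded products is not visibly closed under adjoints.\<close>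

lemma vN_generated_eq:
  assumes X: "X \<subseteq> Collect bounded_clinear" "\<And>S. S \<in> X \<Longrightarrow> cadjoint S \<in> X"
    and Y: "X \<subseteq> Y" "Y \<subseteq> commutant (commutant X)"
  shows "vN_generated Y = commutant (commutant X)"
  unfolding vN_generated_def
proof (intro equalityI Inter_lower Inter_greatest CollectI conjI)
  show "von_neumann_algebra (commutant (commutant X))" by (rule von_neumann_double_commutant) fact+
  show "Y \<subseteq> commutant (commutant X)" by fact
  fix A assume A: "A \<in> {A. von_neumann_algebra A \<and> Y \<subseteq> A}"
  then have "commutant (commutant X) \<subseteq> commutant (commutant A)"
    using Y(1) by (intro commutant_antimono) blast
  then show "commutant (commutant X) \<subseteq> A" using A by (auto dest: von_neumann_algebraD(2))
qed

section \<open>Generators of the graded tensor product\<close>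

locale graded_tensor_product =
  hilbert_tensor_product tens + gU: grading U + gV: grading V
  for tens :: "'h::chilbert_space \<Rightarrow> 'k::chilbert_space \<Rightarrow> 'l::chilbert_space"
    and U :: "'h \<Rightarrow> 'h" and V :: "'k \<Rightarrow> 'k"
begin

text \<open>Every vector is half the sum of the homogeneous vectors x + U x and x - U x.\<close>

lemma homogeneous_op_eqI:
  fixes R S :: "'l \<Rightarrow> 'm::complex_inner"
  assumes R: "bounded_clinear R" and S: "bounded_clinear S"
    and eq: "\<And>x y. homogeneous_vec U x \<Longrightarrow> homogeneous_vec V y \<Longrightarrow> R (tens x y) = S (tens x y)"
  shows "R = S"
proof (rule tens_op_eqI[OF R S])
  fix x y
  have hom: "homogeneous_vec U (x + U x)" "homogeneous_vec U (x - U x)"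
    "homogeneous_vec V (y + V y)" "homogeneous_vec V (y - V y)"
    unfolding homogeneous_vec_def even_vec_def odd_vec_def
    by (simp_all add: gU.lin gU.involution gV.lin gV.involution)
  have dec: "z = (1/2) *\<^sub>C ((z + w) + (z - w))" for z w :: "'n::complex_inner"
    using half_add[of z] by simp
  have half: "R (tens u y) = S (tens u y)" if u: "homogeneous_vec U u" for u
  proof -
    have y: "tens u y = (1/2) *\<^sub>C (tens u (y + V y) + tens u (y - V y))"
      unfolding tens_linear(3,4)[symmetric] dec[of y "V y", symmetric] ..
    show ?thesis unfolding y bounded_clinearD(1,2)[OF R] bounded_clinearD(1,2)[OF S] eq[OF u hom(3)] eq[OF u hom(4)] ..
  qed
  have x: "tens x y = (1/2) *\<^sub>C (tens (x + U x) y + tens (x - U x) y)"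
    unfolding tens_linear(1,2)[symmetric] dec[of x "U x", symmetric] ..
  show "R (tens x y) = S (tens x y)"
    unfolding x bounded_clinearD(1,2)[OF R] bounded_clinearD(1,2)[OF S] half[OF hom(1)] half[OF hom(2)] ..
qed

lemma homogeneous_graded_tensor_op_eqI:
  assumes R: "bounded_clinear R"
    and eq: "\<And>x y. homogeneous_vec U x \<Longrightarrow> homogeneous_vec V y \<Longrightarrow>
      R (tens x y) = grading_sign U V T x *\<^sub>C tens (S x) (T y)"
  shows "homogeneous_graded_tensor_op tens U V S T = R"
  unfolding homogeneous_graded_tensor_op_def
proof (rule the_equality)
  show "bounded_clinear R \<and> (\<forall>x y. homogeneous_vec U x \<longrightarrow> homogeneous_vec V y \<longrightarrow>
      R (tens x y) = grading_sign U V T x *\<^sub>C tens (S x) (T y))"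
    using R eq by blast
  fix P assume "bounded_clinear P \<and> (\<forall>x y. homogeneous_vec U x \<longrightarrow> homogeneous_vec V y \<longrightarrow>
      P (tens x y) = grading_sign U V T x *\<^sub>C tens (S x) (T y))"
  then show "P = R" using eq by (intro homogeneous_op_eqI R) auto
qed

lemma homogeneous_graded_tensor_op_even:
  assumes S: "bounded_clinear S" and T: "bounded_clinear T" and even: "even_op V T"
  shows "homogeneous_graded_tensor_op tens U V S T = S \<otimes> T"
proof (rule homogeneous_graded_tensor_op_eqI)
  show "bounded_clinear (S \<otimes> T)" by (rule tensor_op[OF S T])
  fix x y
  show "(S \<otimes> T) (tens x y) = grading_sign U V T x *\<^sub>C tens (S x) (T y)"
  proof (cases "odd_op V T")
    case True
    \<comment> \<open>\<open>grading_sign\<close> may be -1 for an even \<open>T\<close> that is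
      also odd, but such a \<open>T\<close> is zero.\<close>
    then have "T = (\<lambda>x. 0)" using gV.parts_of_odd(1) gV.parts_of_even(1)[OF even] by simp
    then have "T y = 0" by simp
    then show ?thesis by (simp add: tensor_op[OF S T] tens_simps)
  qed (simp add: grading_sign_def tensor_op[OF S T] scaleC_one)
qed

lemma homogeneous_graded_tensor_op_odd:
  assumes S: "bounded_clinear S" and T: "bounded_clinear T" and odd: "odd_op V T"
  shows "homogeneous_graded_tensor_op tens U V S T = (\<lambda>x. S (U x)) \<otimes> T"
proof (rule homogeneous_graded_tensor_op_eqI)
  note SU = bounded_clinear_compose[OF S gU.bounded]
  show "bounded_clinear ((\<lambda>x. S (U x)) \<otimes> T)" by (rule tensor_op[OF SU T])
  fix x y assume "homogeneous_vec U x"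
  then consider "odd_vec U x" | "even_vec U x" "\<not> odd_vec U x" unfolding homogeneous_vec_def by blast
  then show "((\<lambda>x. S (U x)) \<otimes> T) (tens x y) = grading_sign U V T x *\<^sub>C tens (S x) (T y)"
    by cases (simp_all add: grading_sign_def tensor_op[OF SU T] odd even_vec_def odd_vec_def
        bounded_clinearD[OF S] tens_simps scaleC_one complex_vector.scale_minus_left)
qed

text \<open>The sign caused by an odd second factor is the action of \<open>U\<close> on the first
  argument, so the graded product becomes a sum of two ordinary tensor products.\<close>

lemma graded_tensor_op_eq:
  assumes S: "bounded_clinear S" and T: "bounded_clinear T"
  shows "graded_tensor_op tens U V S T z =
    (S \<otimes> even_part V T) z + ((\<lambda>x. S (U x)) \<otimes> odd_part V T) z"
proof -
  note bS = gU.part_bounded[OF S] and bT = gV.part_bounded[OF T]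
  note eo = gV.decomposition(1,2)[of T]
  have "(S \<otimes> even_part V T) z = (even_part U S \<otimes> even_part V T) z + (odd_part U S \<otimes> even_part V T) z"
    by (subst gU.decomposition(3)[of S]) (rule tensor_op_add_left[OF bS bT(1)])
  moreover have "((\<lambda>x. S (U x)) \<otimes> odd_part V T) z =
      ((\<lambda>x. even_part U S (U x)) \<otimes> odd_part V T) z + ((\<lambda>x. odd_part U S (U x)) \<otimes> odd_part V T) z"
    by (subst gU.decomposition(3)[of S])
      (rule tensor_op_add_left[OF bounded_clinear_compose[OF bS(1) gU.bounded]
          bounded_clinear_compose[OF bS(2) gU.bounded] bT(2)])
  ultimately show ?thesis
    unfolding graded_tensor_op_def
    by (simp add: homogeneous_graded_tensor_op_even[OF bS(1) bT(1) eo(1)]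
        homogeneous_graded_tensor_op_even[OF bS(2) bT(1) eo(1)]
        homogeneous_graded_tensor_op_odd[OF bS(1) bT(2) eo(2)]
        homogeneous_graded_tensor_op_odd[OF bS(2) bT(2) eo(2)])
qed

text \<open>The last two families are the graded products of the identity with a homogeneous y;
  \<open>U\<close> enters for odd y.\<close>

definition graded_generators :: "('h \<Rightarrow> 'h) set \<Rightarrow> ('k \<Rightarrow> 'k) set \<Rightarrow> ('l \<Rightarrow> 'l) set" where
  "graded_generators M N = {x \<otimes> id | x. x \<in> M} \<union> {id \<otimes> y | y. y \<in> N \<and> even_op V y} \<union>
    {U \<otimes> y | y. y \<in> N \<and> odd_op V y}"

lemma graded_generators_cases:
  assumes "T \<in> graded_generators M N"
  obtains x where "x \<in> M" "T = x \<otimes> id" | y where "y \<in> N" "even_op V y" "T = id \<otimes> y"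
    | y where "y \<in> N" "odd_op V y" "T = U \<otimes> y"
  using assms unfolding graded_generators_def by blast

lemma graded_generatorsI:
  "x \<in> M \<Longrightarrow> x \<otimes> id \<in> graded_generators M N"
  "y \<in> N \<Longrightarrow> even_op V y \<Longrightarrow> id \<otimes> y \<in> graded_generators M N"
  "y \<in> N \<Longrightarrow> odd_op V y \<Longrightarrow> U \<otimes> y \<in> graded_generators M N"
  unfolding graded_generators_def by blast+

lemma graded_generators_bounded:
  assumes "M \<subseteq> Collect bounded_clinear" "N \<subseteq> Collect bounded_clinear"
  shows "graded_generators M N \<subseteq> Collect bounded_clinear"
proof
  fix T assume "T \<in> graded_generators M N"
  then show "T \<in> Collect bounded_clinear"
    using assms by (cases rule: graded_generators_cases) (auto intro!: tensor_op bounded_clinear_id gU.bounded)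
qed

lemma graded_generators_adjoint:
  assumes M: "M \<subseteq> Collect bounded_clinear" and N: "N \<subseteq> Collect bounded_clinear"
    and adj: "\<And>S. S \<in> M \<Longrightarrow> cadjoint S \<in> M" "\<And>S. S \<in> N \<Longrightarrow> cadjoint S \<in> N"
    and T: "T \<in> graded_generators M N"
  shows "cadjoint T \<in> graded_generators M N"
  using T
proof (cases rule: graded_generators_cases)
  case (1 x)
  then have "cadjoint T = cadjoint x \<otimes> id"
    using M by (auto simp: tensor_op_adjoint bounded_clinear_id cadjoint_id)
  then show ?thesis using graded_generatorsI(1)[OF adj(1)[OF 1(1)]] by simp
next
  case (2 y)
  then have b: "bounded_clinear y" using N by blast
  have "cadjoint T = id \<otimes> cadjoint y"
    using 2 b by (simp add: tensor_op_adjoint bounded_clinear_id cadjoint_id)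
  then show ?thesis using graded_generatorsI(2)[OF adj(2)[OF 2(1)] gV.even_op_cadjoint[OF b 2(2)]] by simp
next
  case (3 y)
  then have b: "bounded_clinear y" using N by blast
  have "cadjoint T = U \<otimes> cadjoint y"
    using 3 b by (simp add: tensor_op_adjoint gU.bounded gU.adjoint)
  then show ?thesis using graded_generatorsI(3)[OF adj(2)[OF 3(1)] gV.odd_op_cadjoint[OF b 3(2)]] by simp
qed

lemma tensor_op_zero_right: "bounded_clinear S \<Longrightarrow> (S \<otimes> (\<lambda>y. 0)) = (\<lambda>z. 0)"
  by (rule tensor_op_eqI[symmetric]) (simp_all add: bounded_clinear_zero tens_simps)

text \<open>Each generator is a graded product with one factor the identity. Conversely a graded
  product of S and T equals (S \<otimes> 1)(1 \<otimes> T_even) + (S \<otimes> 1)(U \<otimes>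
  T_odd). The hypotheses are mere closure properties because the lemma is applied to twisted
  commutants as well.\<close>

lemma graded_tensor_algebra_eq:
  assumes M: "M \<subseteq> Collect bounded_clinear" "id \<in> M" and N: "N \<subseteq> Collect bounded_clinear" "id \<in> N"
    and adj: "\<And>S. S \<in> M \<Longrightarrow> cadjoint S \<in> M" "\<And>S. S \<in> N \<Longrightarrow> cadjoint S \<in> N"
    and parts: "\<And>T. T \<in> N \<Longrightarrow> even_part V T \<in> N" "\<And>T. T \<in> N \<Longrightarrow> odd_part V T \<in> N"
  shows "graded_tensor_algebra tens U V M N = commutant (commutant (graded_generators M N))"
  unfolding graded_tensor_algebra_def
proof (rule vN_generated_eq)
  let ?G = "graded_generators M N" and ?Y = "{graded_tensor_op tens U V S T | S T. S \<in> M \<and> T \<in> N}"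
  show G: "?G \<subseteq> Collect bounded_clinear" by (rule graded_generators_bounded) fact+
  show adjG: "cadjoint T \<in> ?G" if "T \<in> ?G" for T
    using that by (intro graded_generators_adjoint[OF M(1) N(1) adj])
  show "?G \<subseteq> ?Y"
  proof
    fix T assume "T \<in> ?G"
    then show "T \<in> ?Y"
    proof (cases rule: graded_generators_cases)
      case (1 x)
      then have b: "bounded_clinear x" using M by blast
      have "T = graded_tensor_op tens U V x id"
        unfolding 1(2) graded_tensor_op_eq[OF b bounded_clinear_id(1)] fun_eq_iff
        by (simp add: gV.parts_of_even[OF gV.even_op_id]
            tensor_op_zero_right[OF bounded_clinear_compose[OF b gU.bounded]])
      then show ?thesis using 1(1) N(2) by blast
    next
      case (2 y)
      then have b: "bounded_clinear y" using N by blast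
      have "T = graded_tensor_op tens U V id y"
        unfolding 2(3) graded_tensor_op_eq[OF bounded_clinear_id(1) b] fun_eq_iff
        by (simp add: gV.parts_of_even[OF 2(2)] tensor_op_zero_right[OF gU.bounded])
      then show ?thesis using 2(1) M(2) by blast
    next
      case (3 y)
      then have b: "bounded_clinear y" using N by blast
      have "T = graded_tensor_op tens U V id y"
        unfolding 3(3) graded_tensor_op_eq[OF bounded_clinear_id(1) b] fun_eq_iff
        by (simp add: gV.parts_of_odd[OF 3(2)] tensor_op_zero_right[OF bounded_clinear_id(1)])
      then show ?thesis using 3(1) M(2) by blast
    qed
  qed
  show "?Y \<subseteq> commutant (commutant ?G)"
  proof
    have "von_neumann_algebra (commutant (commutant ?G))"
      by (rule von_neumann_double_commutant[OF G]) (rule adjG)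
    note A = unital_star_subalgebraD[OF von_neumann_algebraD(1)[OF this]]
    have sub: "T \<in> commutant (commutant ?G)" if "T \<in> ?G" for T
      using double_commutant_subset[OF G] that by blast
    fix R assume "R \<in> ?Y"
    then obtain S T where ST: "S \<in> M" "T \<in> N" "R = graded_tensor_op tens U V S T" by blast
    then have b: "bounded_clinear S" "bounded_clinear T" using M N by blast+
    note bT = gV.part_bounded[OF b(2)]
    have "R = (\<lambda>z. (S \<otimes> id) ((id \<otimes> even_part V T) z) + (S \<otimes> id) ((U \<otimes> odd_part V T) z))"
      unfolding ST(3) fun_eq_iff graded_tensor_op_eq[OF b]
        tensor_op_comp[OF b(1) bounded_clinear_id(1) bounded_clinear_id(1) bT(1)]
        tensor_op_comp[OF b(1) bounded_clinear_id(1) gU.bounded bT(2)] by simp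
    also have "\<dots> \<in> commutant (commutant ?G)"
      by (intro A(4)[OF A(6)[OF sub sub] A(6)[OF sub sub]] graded_generatorsI ST(1) parts ST(2)
          gV.decomposition)
    finally show "R \<in> commutant (commutant ?G)" .
  qed
qed

end

section \<open>The graded commutation theorem\<close>

text \<open>Invariance under conjugation by \<open>U\<close> allows \<open>U\<close> to be moved to
  the right past any element of \<open>M\<close>, so the sums b + c U are closed under products and
  adjoints.\<close>

lemma (in grading) adjoin_star_subalgebra:
  assumes "unital_star_subalgebra M" and inv: "\<And>T. T \<in> M \<Longrightarrow> (\<lambda>x. U (T (U x))) \<in> M"
  shows "unital_star_subalgebra {\<lambda>x. b x + c (U x) | b c. b \<in> M \<and> c \<in> M}" (is "unital_star_subalgebra ?A")
proof -
  note M = unital_star_subalgebraD[OF assms(1)]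
  have AI: "T \<in> ?A" if "b \<in> M" "c \<in> M" "\<And>x. T x = b x + c (U x)" for T b c
    using that by auto
  have AE: "\<exists>b\<in>M. \<exists>c\<in>M. \<forall>x. T x = b x + c (U x)" if "T \<in> ?A" for T
    using that by auto
  have zero: "(\<lambda>x. 0) \<in> M" using M(5)[OF M(3), of 0] by simp
  show ?thesis
    unfolding unital_star_subalgebra_def
  proof (intro conjI ballI allI)
    show "?A \<subseteq> Collect bounded_clinear"
      using M(1) by (auto intro!: bounded_clinear_add bounded_clinear_compose[OF _ bounded])
    show "id \<in> ?A" by (rule AI[OF M(2) zero]) simp
    fix S T assume "S \<in> ?A" "T \<in> ?A"
    from AE[OF this(1)] AE[OF this(2)] obtain b c b' c'
      where S: "b \<in> M" "c \<in> M" "\<And>x. S x = b x + c (U x)"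
        and T: "b' \<in> M" "c' \<in> M" "\<And>x. T x = b' x + c' (U x)" by blast
    show "(\<lambda>x. S x + T x) \<in> ?A"
      by (rule AI[OF M(4)[OF S(1) T(1)] M(4)[OF S(2) T(2)]]) (simp add: S T)
    show "(\<lambda>x. r *\<^sub>C T x) \<in> ?A" for r
      by (rule AI[OF M(5)[OF T(1)] M(5)[OF T(2)]]) (simp add: T(3) scaleC_add_right)
    show "S \<circ> T \<in> ?A"
      by (rule AI[OF M(4)[OF M(6)[OF S(1) T(1)] M(6)[OF S(2) inv[OF T(2)]]]
              M(4)[OF M(6)[OF S(1) T(2)] M(6)[OF S(2) inv[OF T(1)]]]])
        (simp add: S(3) T(3) bounded_clinearD[OF M(1)[OF S(1)]] bounded_clinearD[OF M(1)[OF S(2)]] lin involution)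
    have "cadjoint T = (\<lambda>x. cadjoint b' x + U (cadjoint c' x))"
    proof -
      have "T = (\<lambda>x. b' x + c' (U x))" using T(3) by blast
      then show ?thesis
        using cadjoint_add[OF M(1)[OF T(1)] bounded_clinear_compose[OF M(1)[OF T(2)] bounded]]
          cadjoint_comp[OF M(1)[OF T(2)] bounded] adjoint by simp
    qed
    then show "cadjoint T \<in> ?A"
      by (intro AI[OF M(7)[OF T(1)] inv[OF M(7)[OF T(2)]]]) (simp add: involution)
  qed
qed

context graded_tensor_product
begin

lemma tensor_op_commuteI:
  assumes b: "bounded_clinear S" "bounded_clinear T" "bounded_clinear S'" "bounded_clinear T'"
    and eq: "\<And>u v. tens (S (S' u)) (T (T' v)) = tens (S' (S u)) (T' (T v))"
  shows "(S \<otimes> T) ((S' \<otimes> T') z) = (S' \<otimes> T') ((S \<otimes> T) z)"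
proof -
  note t = tensor_op[OF b(1,2)] and t' = tensor_op[OF b(3,4)]
  have "(\<lambda>z. (S \<otimes> T) ((S' \<otimes> T') z)) = (\<lambda>z. (S' \<otimes> T') ((S \<otimes> T) z))"
    by (rule tens_op_eqI[OF bounded_clinear_compose[OF t(1) t'(1)] bounded_clinear_compose[OF t'(1) t(1)]])
      (simp add: t t' eq)
  then show ?thesis by (rule fun_cong)
qed

lemma selfadjoint_unitary_tensor_op:
  assumes "selfadjoint_unitary S" "selfadjoint_unitary T"
  shows "selfadjoint_unitary (S \<otimes> T)"
proof -
  interpret S: grading S by unfold_locales fact
  interpret T: grading T by unfold_locales fact
  have adj: "cadjoint (S \<otimes> T) = S \<otimes> T"
    by (simp add: tensor_op_adjoint[OF S.bounded T.bounded] S.adjoint T.adjoint)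
  have "(S \<otimes> T) ((S \<otimes> T) z) = z" for z
    using tensor_op_comp[OF S.bounded T.bounded S.bounded T.bounded] tensor_op_id
    by (simp add: S.involution T.involution id_def)
  then show ?thesis
    unfolding selfadjoint_unitary_def adj by (auto simp: fun_eq_iff tensor_op[OF S.bounded T.bounded])
qed

text \<open>For the commutants \<open>A\<close> and \<open>B\<close> of \<open>M\<close> and \<open>N\<close>, these are the generators of \<open>M\<^sup>\<wr> \<otimes> N\<^sup>\<wr>\<close>
  (graded) with the twist by \<open>U \<otimes> V\<close> undone.\<close>

definition cograded_generators :: "('h \<Rightarrow> 'h) set \<Rightarrow> ('k \<Rightarrow> 'k) set \<Rightarrow> ('l \<Rightarrow> 'l) set" where
  "cograded_generators A B = {x \<otimes> id | x. x \<in> A \<and> even_op U x} \<union> {x \<otimes> V | x. x \<in> A \<and> odd_op U x} \<union>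
    {id \<otimes> y | y. y \<in> B}"

lemma cograded_generators_cases:
  assumes "T \<in> cograded_generators A B"
  obtains x where "x \<in> A" "even_op U x" "T = x \<otimes> id" | x where "x \<in> A" "odd_op U x" "T = x \<otimes> V"
    | y where "y \<in> B" "T = id \<otimes> y"
  using assms unfolding cograded_generators_def by blast

lemma cograded_generatorsI:
  "x \<in> A \<Longrightarrow> even_op U x \<Longrightarrow> x \<otimes> id \<in> cograded_generators A B"
  "x \<in> A \<Longrightarrow> odd_op U x \<Longrightarrow> x \<otimes> V \<in> cograded_generators A B"
  "y \<in> B \<Longrightarrow> id \<otimes> y \<in> cograded_generators A B"
  unfolding cograded_generators_def by blast+

lemma cograded_generators_bounded:
  assumes "A \<subseteq> Collect bounded_clinear" "B \<subseteq> Collect bounded_clinear"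
  shows "cograded_generators A B \<subseteq> Collect bounded_clinear"
proof
  fix T assume "T \<in> cograded_generators A B"
  then show "T \<in> Collect bounded_clinear"
    using assms by (cases rule: cograded_generators_cases) (auto intro!: tensor_op bounded_clinear_id gV.bounded)
qed

text \<open>The critical pair is x \<otimes> V and U \<otimes> y with x and y odd: each factor
  contributes a minus sign and the two cancel. For even x or even y no sign arises.\<close>

lemma cograded_generators_commute:
  assumes M: "M \<subseteq> Collect bounded_clinear" and N: "N \<subseteq> Collect bounded_clinear"
  shows "cograded_generators (commutant M) (commutant N) \<subseteq> commutant (graded_generators M N)"
proof
  fix T assume T: "T \<in> cograded_generators (commutant M) (commutant N)"
  have bM: "bounded_clinear x" if "x \<in> M" for x using M that by blast
  have bN: "bounded_clinear y" if "y \<in> N" for y using N that by blast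
  note b = bounded_clinear_id(1) gU.bounded gV.bounded
  show "T \<in> commutant (graded_generators M N)"
  proof (rule commutantI)
    have "commutant M \<subseteq> Collect bounded_clinear" "commutant N \<subseteq> Collect bounded_clinear"
      using commutant_bounded by blast+
    then show "bounded_clinear T" using cograded_generators_bounded T by blast
    fix S z assume S: "S \<in> graded_generators M N"
    from T show "T (S z) = S (T z)"
    proof (cases rule: cograded_generators_cases)
      case (1 x)
      note bx = commutant_bounded[OF 1(1)]
      from S show ?thesis
      proof (cases rule: graded_generators_cases)
        case (1 s)
        show ?thesis unfolding 1(2) \<open>T = x \<otimes> id\<close>
          by (intro tensor_op_commuteI bM[OF 1(1)] b bx)
            (simp add: commutantD[OF \<open>x \<in> commutant M\<close> 1(1)])
      next
        case (2 s)
        show ?thesis unfolding 2(3) \<open>T = x \<otimes> id\<close>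
          by (intro tensor_op_commuteI bN[OF 2(1)] b bx) simp
      next
        case (3 s)
        show ?thesis unfolding 3(3) \<open>T = x \<otimes> id\<close>
          using \<open>even_op U x\<close>[unfolded gU.even_op_iff]
          by (intro tensor_op_commuteI bN[OF 3(1)] b bx) simp
      qed
    next
      case (2 x)
      note bx = commutant_bounded[OF 2(1)]
      from S show ?thesis
      proof (cases rule: graded_generators_cases)
        case (1 s)
        show ?thesis unfolding 1(2) \<open>T = x \<otimes> V\<close>
          by (intro tensor_op_commuteI bM[OF 1(1)] b bx)
            (simp add: commutantD[OF \<open>x \<in> commutant M\<close> 1(1)])
      next
        case (2 s)
        show ?thesis unfolding 2(3) \<open>T = x \<otimes> V\<close>
          using 2(2)[unfolded gV.even_op_iff]
          by (intro tensor_op_commuteI bN[OF 2(1)] b bx) simp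
      next
        case (3 s)
        show ?thesis unfolding 3(3) \<open>T = x \<otimes> V\<close>
          using \<open>odd_op U x\<close>[unfolded gU.odd_op_iff] 3(2)[unfolded gV.odd_op_iff]
          by (intro tensor_op_commuteI bN[OF 3(1)] b bx) (simp add: tens_simps)
      qed
    next
      case (3 y)
      note bx = commutant_bounded[OF 3(1)]
      from S show ?thesis
      proof (cases rule: graded_generators_cases)
        case (1 s)
        show ?thesis unfolding 1(2) \<open>T = id \<otimes> y\<close>
          by (intro tensor_op_commuteI bM[OF 1(1)] b bx) simp
      next
        case (2 s)
        show ?thesis unfolding 2(3) \<open>T = id \<otimes> y\<close>
          by (intro tensor_op_commuteI bN[OF 2(1)] b bx)
            (simp add: commutantD[OF \<open>y \<in> commutant N\<close> 2(1)])
      next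
        case (3 s)
        show ?thesis unfolding 3(3) \<open>T = id \<otimes> y\<close>
          by (intro tensor_op_commuteI bN[OF 3(1)] b bx)
            (simp add: commutantD[OF \<open>y \<in> commutant N\<close> 3(1)])
      qed
    qed
  qed
qed

text \<open>An element of the commutant that is even with respect to \<open>U \<otimes> 1\<close> commutes with the ungraded
  tensor product of \<open>M \<or> {U}\<close> and \<open>N\<close>.\<close>

lemma graded_commutation_even:
  assumes M: "unital_star_subalgebra M" and N: "unital_star_subalgebra N"
    and invM: "\<And>T. T \<in> M \<Longrightarrow> (\<lambda>x. U (T (U x))) \<in> M" and invN: "\<And>T. T \<in> N \<Longrightarrow> (\<lambda>x. V (T (V x))) \<in> N"
    and C: "C \<in> commutant (graded_generators M N)" "\<And>z. C ((U \<otimes> id) z) = (U \<otimes> id) (C z)"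
    and D: "D \<in> commutant (cograded_generators (commutant M) (commutant N))"
  shows "C (D z) = D (C z)"
proof -
  let ?M1 = "{\<lambda>x. b x + c (U x) | b c. b \<in> M \<and> c \<in> M}"
  note Ms = unital_star_subalgebraD[OF M] and Ns = unital_star_subalgebraD[OF N]
  have M1: "unital_star_subalgebra ?M1" by (rule gU.adjoin_star_subalgebra[OF M invM])
  note bC = bounded_clinearD[OF commutant_bounded[OF C(1)]]
  have C1: "C \<in> commutant (tensor_generators tens ?M1 N)"
  proof (rule commutantI[OF commutant_bounded[OF C(1)]])
    fix S z assume "S \<in> tensor_generators tens ?M1 N"
    then consider b c where "b \<in> M" "c \<in> M" "S = (\<lambda>x. b x + c (U x)) \<otimes> id" | y where "y \<in> N" "S = id \<otimes> y"
      unfolding tensor_generators_def by blast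
    then show "C (S z) = S (C z)"
    proof cases
      case 1
      note b = Ms(1)[OF 1(1)] Ms(1)[OF 1(2)]
      have S: "S z = (b \<otimes> id) z + (c \<otimes> id) ((U \<otimes> id) z)" for z
        unfolding 1(3) tensor_op_add_left[OF b(1) bounded_clinear_compose[OF b(2) gU.bounded] bounded_clinear_id(1)]
          tensor_op_comp[OF b(2) bounded_clinear_id(1) gU.bounded bounded_clinear_id(1)] by (simp add: id_def)
      show ?thesis
        unfolding S bC commutantD[OF C(1) graded_generatorsI(1)[OF 1(1)]]
          commutantD[OF C(1) graded_generatorsI(1)[OF 1(2)]] C(2) ..
    next
      case 2
      note b = Ns(1)[OF 2(1)] and p = gV.part_bounded[OF Ns(1)[OF 2(1)]]
      \<comment> \<open>For odd y the operator 1 \<otimes> y is (U \<otimes> 1)(U \<otimes> y), and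
        C commutes with both factors.\<close>
      have S: "S z = (id \<otimes> even_part V y) z + (U \<otimes> id) ((U \<otimes> odd_part V y) z)" for z
        unfolding 2(2) tensor_op_comp[OF gU.bounded bounded_clinear_id(1) gU.bounded p(2)]
        by (subst gV.decomposition(3)[of y], subst tensor_op_add_right[OF bounded_clinear_id(1) p])
          (simp add: gU.involution id_def)
      have "even_part V y \<in> N" "odd_part V y \<in> N"
        by (rule gV.parts_mem[OF N _ 2(1)], rule invN, assumption)+
      note g = graded_generatorsI(2)[OF this(1) gV.decomposition(1)]
        graded_generatorsI(3)[OF this(2) gV.decomposition(2)]
      show ?thesis
        unfolding S bC C(2) commutantD[OF C(1) g(1)] commutantD[OF C(1) g(2)] ..
    qed
  qed
  \<comment> \<open>An operator commuting with \<open>M\<close> and \<open>U\<close> is an even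
    element of the commutant of \<open>M\<close>, so no factor V is attached to it.\<close>
  have "tensor_generators tens (commutant ?M1) (commutant N) \<subseteq> cograded_generators (commutant M) (commutant N)"
  proof
    fix S assume "S \<in> tensor_generators tens (commutant ?M1) (commutant N)"
    then consider x where "x \<in> commutant ?M1" "S = x \<otimes> id" | y where "y \<in> commutant N" "S = id \<otimes> y"
      unfolding tensor_generators_def by blast
    then show "S \<in> cograded_generators (commutant M) (commutant N)"
    proof cases
      case 1
      have zero: "(\<lambda>x. 0) \<in> M" using Ms(5)[OF Ms(3), of 0] by simp
      have "b \<in> ?M1" if "b \<in> M" for b
        using that zero by (intro CollectI exI[of _ b] exI[of _ "\<lambda>x. 0"]) simp
      then have "x \<in> commutant M" using 1(1) commutant_antimono by blast
      moreover have "U \<in> ?M1"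
        using zero Ms(3) by (intro CollectI exI[of _ "\<lambda>x. 0"] exI[of _ "\<lambda>x. x"]) simp
      then have "even_op U x" unfolding gU.even_op_iff by (simp add: commutantD[OF 1(1)])
      ultimately show ?thesis unfolding 1(2) by (rule cograded_generatorsI)
    next
      case 2
      then show ?thesis using cograded_generatorsI(3) by simp
    qed
  qed
  then have "D \<in> commutant (tensor_generators tens (commutant ?M1) (commutant N))"
    using D commutant_antimono by blast
  from tensor_commutation[OF M1 N C1 this] show ?thesis .
qed

end

context graded_tensor_product
begin

text \<open>The remaining part \<open>C\<close>, odd with respect to \<open>U \<otimes> 1\<close>, is made even by multiplication with
  \<open>x \<otimes> V\<close> for odd \<open>x\<close> in the commutant of \<open>M\<close>. This determines \<open>C\<close> on the span \<open>Z\<close> of the ranges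
  of such \<open>x\<close>; on the complement of \<open>Z\<close> the grading \<open>U\<close> is implemented by an
  element of \<open>M\<close>, so that \<open>C\<close> vanishes there.\<close>

lemma graded_commutation_odd:
  assumes M: "von_neumann_algebra M" and N: "von_neumann_algebra N"
    and invM: "\<And>T. T \<in> M \<Longrightarrow> (\<lambda>x. U (T (U x))) \<in> M" and invN: "\<And>T. T \<in> N \<Longrightarrow> (\<lambda>x. V (T (V x))) \<in> N"
    and C: "C \<in> commutant (graded_generators M N)" "\<And>z. C ((U \<otimes> id) z) = - (U \<otimes> id) (C z)"
    and D: "D \<in> commutant (cograded_generators (commutant M) (commutant N))"
  shows "C (D z) = D (C z)"
proof -
  let ?M' = "commutant M" and ?a = "U \<otimes> id"
  have Mstar: "unital_star_subalgebra M" and Nstar: "unital_star_subalgebra N"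
    using M N by (simp_all add: von_neumann_algebraD)
  note Ms = unital_star_subalgebraD[OF Mstar] and Ns = unital_star_subalgebraD[OF Nstar]
  have Mb: "M \<subseteq> Collect bounded_clinear" and Nb: "N \<subseteq> Collect bounded_clinear"
    using Ms(1) Ns(1) by blast+
  have M'star: "unital_star_subalgebra ?M'" by (rule commutant_star_subalgebra[OF Mb Ms(7)])
  note M's = unital_star_subalgebraD[OF M'star]
  have "(\<lambda>T. U \<circ> T \<circ> U) ` M \<subseteq> M" using invM by (auto simp: comp_def)
  note parts = gU.commutant_parts_mem[OF Mstar this]
  note bC = commutant_bounded[OF C(1)] and bD = commutant_bounded[OF D]
  note ba = tensor_op[OF gU.bounded bounded_clinear_id(1)]
  note linC = bounded_clinearD[OF bC] and linD = bounded_clinearD[OF bD] and lina = bounded_clinearD[OF ba(1)]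
  define F where "F z = C (D z) - D (C z)" for z
  have bF: "bounded_clinear F"
    unfolding F_def[abs_def] by (rule bounded_clinear_diff[OF bounded_clinear_compose[OF bC bD] bounded_clinear_compose[OF bD bC]])
  note linF = bounded_clinearD[OF bF]
  have G_star: "unital_star_subalgebra (commutant (graded_generators M N))"
    by (rule commutant_star_subalgebra[OF graded_generators_bounded[OF Mb Nb]])
      (rule graded_generators_adjoint[OF Mb Nb Ms(7) Ns(7)])
  \<comment> \<open>x \<otimes> V is odd for U \<otimes> 1, so C (x \<otimes> V) is even and
    commutes with D by the even case. D also commutes with x \<otimes> V, and cancelling gives F (x
    \<otimes> V) = 0.\<close>
  have F_odd: "F (tens (x \<xi>) y) = 0" if x: "x \<in> ?M'" "odd_op U x" for x \<xi> y
  proof -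
    note bx = commutant_bounded[OF x(1)]
    note t = tensor_op[OF bx gV.bounded]
    have xV: "x \<otimes> V \<in> cograded_generators ?M' (commutant N)" using x by (rule cograded_generatorsI)
    have "x \<otimes> V \<in> commutant (graded_generators M N)"
      using cograded_generators_commute[OF Mb Nb] xV by blast
    then have CX: "(\<lambda>z. C ((x \<otimes> V) z)) \<in> commutant (graded_generators M N)"
      by (rule unital_star_subalgebraD(6)[OF G_star C(1)])
    have anti: "(x \<otimes> V) (?a z) = - ?a ((x \<otimes> V) z)" for z
    proof -
      have "(\<lambda>z. (x \<otimes> V) (?a z)) = (\<lambda>z. (-1) *\<^sub>C ?a ((x \<otimes> V) z))"
        by (rule tens_op_eqI[OF bounded_clinear_compose[OF t(1) ba(1)]
              bounded_clinear_scaleC[OF bounded_clinear_compose[OF ba(1) t(1)]]])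
          (use x(2)[unfolded gU.odd_op_iff] in
            \<open>simp add: ba t tens_simps complex_vector.scale_minus_left scaleC_one\<close>)
      from fun_cong[OF this, of z] show ?thesis by (simp add: complex_vector.scale_minus_left scaleC_one)
    qed
    have even: "C ((x \<otimes> V) (?a z)) = ?a (C ((x \<otimes> V) z))" for z
      unfolding anti linC C(2) by simp
    have "F ((x \<otimes> V) z) = 0" for z
      using graded_commutation_even[OF Mstar Nstar invM invN CX even D, of z] commutantD[OF D xV]
      by (simp add: F_def)
    from this[of "tens \<xi> (V y)"] show ?thesis by (simp add: t gV.involution)
  qed
  define Z where "Z = closure (complex_vector.span {x \<xi> | x \<xi>. x \<in> ?M' \<and> odd_op U x})"
  have Z: "closed Z" "complex_vector.subspace Z"
    unfolding Z_def by (simp_all add: closure_csubspace complex_vector.subspace_span)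
  have ZI: "x \<xi> \<in> Z" if "x \<in> ?M'" "odd_op U x" for x \<xi>
    unfolding Z_def
    by (rule subsetD[OF closure_subset], rule complex_vector.span_base) (use that in blast)
  have Z_induct: "u \<in> R" if "u \<in> Z" "closed R" "complex_vector.subspace R"
    "\<And>x \<xi>. x \<in> ?M' \<Longrightarrow> odd_op U x \<Longrightarrow> x \<xi> \<in> R" for u R
  proof -
    have "complex_vector.span {x \<xi> | x \<xi>. x \<in> ?M' \<and> odd_op U x} \<subseteq> R"
      using that(3,4) by (intro complex_vector.span_minimal) auto
    from closure_minimal[OF this that(2)] show ?thesis using that(1) unfolding Z_def by blast
  qed
  have Z_inv: "T u \<in> Z"
    if T: "bounded_clinear T" "\<And>x \<xi>. x \<in> ?M' \<Longrightarrow> odd_op U x \<Longrightarrow> T (x \<xi>) \<in> Z" and u: "u \<in> Z" for T u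
  proof -
    have "u \<in> {u. T u \<in> Z}"
    proof (rule Z_induct[OF u])
      show "closed {u. T u \<in> Z}"
        using closed_vimage[OF Z(1) bounded_clinear_continuous_on[OF T(1)]] by (simp add: vimage_def)
      show "complex_vector.subspace {u. T u \<in> Z}"
        using Z(2) by (simp add: complex_vector.subspace_def bounded_clinearD[OF T(1)])
    qed (use T(2) in simp)
    then show ?thesis by simp
  qed
  let ?z = "cproj Z"
  note bz = cproj(1)[OF Z] and linz = bounded_clinearD[OF cproj(1)[OF Z]]
  have F_Z: "F (tens u y) = 0" if "u \<in> Z" for u y
  proof -
    have "u \<in> {u. F (tens u y) = 0}"
    proof (rule Z_induct[OF that])
      show "closed {u. F (tens u y) = 0}"
        by (intro closed_Collect_eq bounded_clinear_continuous_on bounded_clinear_compose[OF bF bounded_clinear_tens(2)]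
            continuous_intros)
      show "complex_vector.subspace {u. F (tens u y) = 0}"
        by (simp add: complex_vector.subspace_def tens_simps linF)
    qed (use F_odd in simp)
    then show ?thesis by simp
  qed
  have zM: "?z (T v) = T (?z v)" if T: "T \<in> M" for T v
  proof -
    have inv: "T u \<in> Z" if T: "T \<in> M" and u: "u \<in> Z" for T u
    proof (rule Z_inv[OF Ms(1)[OF T] _ u])
      show "T (x \<xi>) \<in> Z" if x: "x \<in> ?M'" "odd_op U x" for x \<xi>
        using ZI[OF x, of "T \<xi>"] commutantD[OF x(1) T] by simp
    qed
    show ?thesis by (rule cproj_commute[OF Z Ms(1)[OF T]]) (rule inv[OF T] inv[OF Ms(7)[OF T]]; assumption)+
  qed
  have zU: "?z (U v) = U (?z v)" for v
  proof -
    have inv: "U u \<in> Z" if u: "u \<in> Z" for u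
    proof (rule Z_inv[OF gU.bounded _ u])
      show "U (x \<xi>) \<in> Z" if x: "x \<in> ?M'" "odd_op U x" for x \<xi>
        using complex_vector.subspace_neg[OF Z(2) ZI[OF x, of "U \<xi>"]] x(2)[unfolded gU.odd_op_iff] by simp
    qed
    show ?thesis by (rule cproj_commute[OF Z gU.bounded]) (simp_all add: inv gU.adjoint)
  qed
  have zM': "?z (T v) = T (?z v)" if T: "T \<in> ?M'" for T v
  proof -
    have inv: "T u \<in> Z" if T: "T \<in> ?M'" and u: "u \<in> Z" for T u
    proof (rule Z_inv[OF M's(1)[OF T] _ u])
      fix x \<xi> assume x: "x \<in> ?M'" "odd_op U x"
      note e = gU.decomposition(1)[of T, unfolded gU.even_op_iff, rule_format]
      have "odd_op U (\<lambda>v. even_part U T (x v))"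
        using x(2) unfolding gU.odd_op_iff
        by (simp add: e bounded_clinearD[OF gU.part_bounded(1)[OF M's(1)[OF T]]])
      then have "even_part U T (x \<xi>) \<in> Z" by (rule ZI[OF M's(6)[OF parts(1)[OF T] x(1)]])
      moreover have "odd_part U T (x \<xi>) \<in> Z" by (rule ZI[OF parts(2)[OF T] gU.decomposition(2)])
      ultimately show "T (x \<xi>) \<in> Z"
        by (subst gU.decomposition(3)[of T]) (rule complex_vector.subspace_add[OF Z(2)])
    qed
    show ?thesis by (rule cproj_commute[OF Z M's(1)[OF T]]) (rule inv[OF T] inv[OF M's(7)[OF T]]; assumption)+
  qed
  \<comment> \<open>Z is invariant under \<open>M\<close> and under its commutant, so its projection
    is central in \<open>M\<close>. Both memberships are used: one for commuting with C, the other,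
    with evenness, for commuting with D.\<close>
  have z_in_M': "?z \<in> ?M'" by (rule commutantI[OF bz]) (rule zM)
  have "?z \<in> commutant ?M'" by (rule commutantI[OF bz]) (rule zM')
  then have z_in_M: "?z \<in> M" by (simp only: von_neumann_algebraD(2)[OF M])
  \<comment> \<open>Odd elements of the commutant vanish off Z and even ones commute with U. So U (1
    - z) commutes with the whole commutant, and the double commutant property puts it in
    \<open>M\<close>.\<close>
  let ?w = "\<lambda>v. U (v - ?z v)"
  have bw: "bounded_clinear ?w"
    by (rule bounded_clinear_compose[OF gU.bounded bounded_clinear_diff[OF bounded_clinear_id(2) bz]])
  have "?w \<in> commutant ?M'"
  proof (rule commutantI[OF bw])
    fix T v assume T: "T \<in> ?M'"
    note e = gU.decomposition(1)[of T, unfolded gU.even_op_iff, rule_format]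
      and o = gU.decomposition(2)[of T, unfolded gU.odd_op_iff, rule_format]
    note le = bounded_clinearD[OF M's(1)[OF parts(1)[OF T]]] and lo = bounded_clinearD[OF M's(1)[OF parts(2)[OF T]]]
    have z0: "?z (odd_part U T v) = odd_part U T v" for v
      by (rule cproj(3)[OF Z ZI[OF parts(2)[OF T] gU.decomposition(2)]])
    have "U (odd_part U T v - ?z (odd_part U T v)) = 0" by (simp add: z0 gU.lin)
    moreover have "odd_part U T (U (v - ?z v)) = - U (odd_part U T v - ?z (odd_part U T v))"
      unfolding zM'[OF parts(2)[OF T]] lo(6)[symmetric] o by simp
    then have "odd_part U T (U (v - ?z v)) = 0" by (simp add: z0 gU.lin)
    moreover have "U (even_part U T v - ?z (even_part U T v)) = even_part U T (U (v - ?z v))"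
      unfolding zM'[OF parts(1)[OF T]] lo(6)[symmetric] le(6)[symmetric] e ..
    ultimately show "U (T v - ?z (T v)) = T (U (v - ?z v))"
      by (subst (1 2 3) gU.decomposition(3)[of T]) (simp only: linz gU.lin add_diff_add)
  qed
  then have w_in_M: "?w \<in> M" by (simp only: von_neumann_algebraD(2)[OF M])
  let ?e = "?z \<otimes> id"
  note te = tensor_op[OF bz bounded_clinear_id(1)]
  have Ce: "C (?e v) = ?e (C v)" for v
    by (rule commutantD[OF C(1) graded_generatorsI(1)[OF z_in_M]])
  have De: "D (?e v) = ?e (D v)" for v
  proof (rule commutantD[OF D cograded_generatorsI(1)[OF z_in_M']])
    show "even_op U ?z" unfolding gU.even_op_iff using zU by simp
  qed
  have w: "(?w \<otimes> id) v = ?a (v - ?e v)" for v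
  proof -
    have "(\<lambda>v. ?a (v - ?e v)) = ?w \<otimes> id"
      by (rule tensor_op_eqI[OF bw bounded_clinear_id(1) bounded_clinear_compose[OF ba(1)
              bounded_clinear_diff[OF bounded_clinear_id(2) te(1)]]])
        (simp add: te ba lina tens_simps gU.lin)
    then show ?thesis by (rule fun_cong[symmetric])
  qed
  \<comment> \<open>C commutes with (U \<otimes> 1)(1 - e), as this comes from \<open>M\<close>, and
    with e, but anticommutes with U \<otimes> 1. Hence C (1 - e) equals its own negative.\<close>
  have C0: "C (v - ?e v) = 0" for v
  proof -
    let ?r = "C (v - ?e v)"
    have r: "?r = C v - ?e (C v)" by (simp add: linC Ce)
    have "C ((?w \<otimes> id) v) = (?w \<otimes> id) (C v)"
      by (rule commutantD[OF C(1) graded_generatorsI(1)[OF w_in_M]])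
    then have "- ?a ?r = ?a ?r" unfolding w C(2) r .
    then have "?a ?r + ?a ?r = 0" by (metis add.right_inverse)
    then have "?a ?r = 0" using half_add[of "?a ?r"] by simp
    then have "?a (?a ?r) = 0" by (simp add: lina)
    moreover have "?a (?a ?r) = ?r"
      using tensor_op_comp[OF gU.bounded bounded_clinear_id(1) gU.bounded bounded_clinear_id(1)] tensor_op_id
      by (simp add: gU.involution id_def)
    ultimately show ?thesis by simp
  qed
  have Fe: "F (?e v) = 0" for v
  proof -
    have "(\<lambda>v. F (?e v)) = (\<lambda>v. 0)"
      by (rule tens_op_eqI[OF bounded_clinear_compose[OF bF te(1)] bounded_clinear_zero])
        (simp add: te F_Z cproj(2)[OF Z])
    then show ?thesis by (rule fun_cong)
  qed
  have "F z = F (?e z) + F (z - ?e z)" by (simp add: linF)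
  also have "F (z - ?e z) = C (D z - ?e (D z)) - D (C (z - ?e z))"
    by (simp add: F_def linD De)
  also have "\<dots> = 0" unfolding C0 by (simp add: linD)
  finally have "F z = 0" unfolding Fe by simp
  then show ?thesis by (simp add: F_def)
qed

theorem graded_commutation:
  assumes M: "von_neumann_algebra M" and N: "von_neumann_algebra N"
    and invM: "\<And>T. T \<in> M \<Longrightarrow> (\<lambda>x. U (T (U x))) \<in> M" and invN: "\<And>T. T \<in> N \<Longrightarrow> (\<lambda>x. V (T (V x))) \<in> N"
    and C: "C \<in> commutant (graded_generators M N)"
    and D: "D \<in> commutant (cograded_generators (commutant M) (commutant N))"
  shows "C (D z) = D (C z)"
proof -
  let ?G = "graded_generators M N" and ?a = "U \<otimes> id"
  have Mstar: "unital_star_subalgebra M" and Nstar: "unital_star_subalgebra N"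
    using M N by (simp_all add: von_neumann_algebraD)
  note Ms = unital_star_subalgebraD[OF Mstar] and Ns = unital_star_subalgebraD[OF Nstar]
  have Mb: "M \<subseteq> Collect bounded_clinear" and Nb: "N \<subseteq> Collect bounded_clinear"
    using Ms(1) Ns(1) by blast+
  have id: "selfadjoint_unitary (id :: 'k \<Rightarrow> 'k)"
    by (simp add: selfadjoint_unitary_def cadjoint_id bounded_clinear_id)
  interpret a: grading ?a
    by unfold_locales (rule selfadjoint_unitary_tensor_op[OF gU.selfadjoint_unitary id])
  have star: "unital_star_subalgebra (commutant ?G)"
    by (rule commutant_star_subalgebra[OF graded_generators_bounded[OF Mb Nb]])
      (rule graded_generators_adjoint[OF Mb Nb Ms(7) Ns(7)])
  have conj: "?a ((x \<otimes> y) (?a z)) = ((\<lambda>v. U (x (U v))) \<otimes> y) z"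
    if b: "bounded_clinear x" "bounded_clinear y" for x y z
    by (simp add: tensor_op_comp[OF b gU.bounded bounded_clinear_id(1)]
        tensor_op_comp[OF gU.bounded bounded_clinear_id(1) bounded_clinear_compose[OF b(1) gU.bounded] b(2)])
  \<comment> \<open>Conjugation by U \<otimes> 1 preserves the generators, so the even and odd parts
    of C for this grading remain in the commutant.\<close>
  have "(\<lambda>T. ?a \<circ> T \<circ> ?a) ` ?G \<subseteq> ?G"
  proof (rule image_subsetI)
    fix T assume "T \<in> ?G"
    then show "?a \<circ> T \<circ> ?a \<in> ?G"
    proof (cases rule: graded_generators_cases)
      case (1 x)
      have "?a \<circ> T \<circ> ?a = (\<lambda>v. U (x (U v))) \<otimes> id"
        using conj[OF Ms(1)[OF 1(1)] bounded_clinear_id(1)] unfolding 1(2) by auto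
      then show ?thesis using graded_generatorsI(1)[OF invM[OF 1(1)]] by simp
    next
      case (2 y)
      have "?a \<circ> T \<circ> ?a = T"
        using conj[OF bounded_clinear_id(1) Ns(1)[OF 2(1)]] unfolding 2(3) by (auto simp: gU.involution id_def)
      then show ?thesis using \<open>T \<in> ?G\<close> by simp
    next
      case (3 y)
      have "?a \<circ> T \<circ> ?a = T"
        using conj[OF gU.bounded Ns(1)[OF 3(1)]] unfolding 3(3) by (auto simp: gU.involution)
      then show ?thesis using \<open>T \<in> ?G\<close> by simp
    qed
  qed
  note inv = a.invariant_commutant[OF this]
  have parts: "even_part ?a C \<in> commutant ?G" "odd_part ?a C \<in> commutant ?G"
    by (rule a.parts_mem[OF star _ C], rule inv, assumption)+
  have 1: "even_part ?a C (D z) = D (even_part ?a C z)" for z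
    by (rule graded_commutation_even[OF Mstar Nstar invM invN parts(1) _ D])
      (use a.decomposition(1)[of C] in \<open>simp_all add: a.even_op_iff\<close>)
  have 2: "odd_part ?a C (D z) = D (odd_part ?a C z)" for z
    by (rule graded_commutation_odd[OF M N invM invN parts(2) _ D])
      (use a.decomposition(2)[of C] in \<open>simp_all add: a.odd_op_iff\<close>)
  show ?thesis
    by (subst (1 2) a.decomposition(3)[of C]) (simp add: 1 2 bounded_clinearD[OF commutant_bounded[OF D]])
qed

end

section \<open>Transport of the generators through the twist\<close>

theorem theorem4p4:
  fixes tens :: "'h::chilbert_space \<Rightarrow> 'k::chilbert_space \<Rightarrow> 'l::chilbert_space"
    and U :: "'h \<Rightarrow> 'h" and V :: "'k \<Rightarrow> 'k"
    and M :: "('h \<Rightarrow> 'h) set" and N :: "('k \<Rightarrow> 'k) set"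
  assumes "hilbert_tensor tens"
    and "selfadjoint_unitary U" and "selfadjoint_unitary V"
    and "von_neumann_algebra M" and "von_neumann_algebra N"
    and "(\<lambda>T. U \<circ> T \<circ> U) ` M = M" and "(\<lambda>T. V \<circ> T \<circ> V) ` N = N"
  shows "twisted_commutant (tensor_op tens U V) (graded_tensor_algebra tens U V M N) =
         graded_tensor_algebra tens U V (twisted_commutant U M) (twisted_commutant V N)"
proof -
  interpret graded_tensor_product tens U V by unfold_locales fact+
  let ?M' = "commutant M" and ?N' = "commutant N" and ?\<Gamma> = "U \<otimes> V"
  let ?Mt = "twisted_commutant U M" and ?Nt = "twisted_commutant V N"
  interpret \<Gamma>: grading ?\<Gamma> by unfold_locales (rule selfadjoint_unitary_tensor_op[OF assms(2,3)])
  note star = von_neumann_algebraD(1)[OF assms(4)] von_neumann_algebraD(1)[OF assms(5)]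
  note Ms = unital_star_subalgebraD[OF star(1)] and Ns = unital_star_subalgebraD[OF star(2)]
  have b: "M \<subseteq> Collect bounded_clinear" "N \<subseteq> Collect bounded_clinear" using Ms(1) Ns(1)
    by blast+
  have "unital_star_subalgebra ?M'" by (rule commutant_star_subalgebra[OF b(1) Ms(7)])
  moreover have "unital_star_subalgebra ?N'" by (rule commutant_star_subalgebra[OF b(2) Ns(7)])
  ultimately have star': "unital_star_subalgebra ?M'" "unital_star_subalgebra ?N'" .
  note M's = unital_star_subalgebraD[OF star'(1)] and N's = unital_star_subalgebraD[OF star'(2)]
  have b': "?M' \<subseteq> Collect bounded_clinear" "?N' \<subseteq> Collect bounded_clinear"
    using M's(1) N's(1) by blast+
  have invM: "(\<lambda>x. U (T (U x))) \<in> M" if "T \<in> M" for T using assms(6) that by (force simp: comp_def)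
  have invN: "(\<lambda>x. V (T (V x))) \<in> N" if "T \<in> N" for T using assms(7) that by (force simp: comp_def)
  have partsN: "even_part V T \<in> N" "odd_part V T \<in> N" if "T \<in> N" for T
    by (rule gV.parts_mem[OF star(2) _ that], rule invN, assumption)+
  note invs = equalityD1[OF assms(6)] equalityD1[OF assms(7)]
  note partsM' = gU.commutant_parts_mem[OF star(1) invs(1)] and partsN' = gV.commutant_parts_mem[OF star(2) invs(2)]
  note Mt = gU.twisted_commutant_props[OF star(1) invs(1)] and Nt = gV.twisted_commutant_props[OF star(2) invs(2)]
  let ?G = "graded_generators M N" and ?Gt = "graded_generators ?Mt ?Nt" and ?Q = "cograded_generators ?M' ?N'"
  have G: "?G \<subseteq> Collect bounded_clinear" by (rule graded_generators_bounded[OF b])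
  have Gt: "?Gt \<subseteq> Collect bounded_clinear" by (rule graded_generators_bounded[OF Mt(1) Nt(1)])
  have Q: "?Q \<subseteq> Collect bounded_clinear" by (rule cograded_generators_bounded[OF b'])
  have alg: "graded_tensor_algebra tens U V M N = commutant (commutant ?G)"
    by (rule graded_tensor_algebra_eq[OF b(1) Ms(2) b(2) Ns(2) Ms(7) Ns(7) partsN])
  have algt: "graded_tensor_algebra tens U V ?Mt ?Nt = commutant (commutant ?Gt)"
    by (rule graded_tensor_algebra_eq[OF Mt(1,2) Nt(1,2) Mt(3) Nt(3-5)])
  have tw_even_M: "twist ?\<Gamma> (x \<otimes> id) = x \<otimes> id" if x: "bounded_clinear x" "even_op U x" for x
  proof (rule \<Gamma>.twist_even, unfold \<Gamma>.even_op_iff, rule allI)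
    show "?\<Gamma> ((x \<otimes> id) z) = (x \<otimes> id) (?\<Gamma> z)" for z
      using x(2)[unfolded gU.even_op_iff]
      by (intro tensor_op_commuteI gU.bounded gV.bounded x bounded_clinear_id) simp
  qed
  have tw_even_N: "twist ?\<Gamma> (id \<otimes> y) = id \<otimes> y" if y: "bounded_clinear y" "even_op V y" for y
  proof (rule \<Gamma>.twist_even, unfold \<Gamma>.even_op_iff, rule allI)
    show "?\<Gamma> ((id \<otimes> y) z) = (id \<otimes> y) (?\<Gamma> z)" for z
      using y(2)[unfolded gV.even_op_iff]
      by (intro tensor_op_commuteI gU.bounded gV.bounded y bounded_clinear_id) simp
  qed
  have odd_tensor: "odd_op ?\<Gamma> (x \<otimes> y)" if xy: "bounded_clinear x" "bounded_clinear y"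
    and "\<And>u v. tens (U (x u)) (V (y v)) = - tens (x (U u)) (y (V v))" for x y
    unfolding \<Gamma>.odd_op_iff
  proof
    fix z
    note t = tensor_op[OF xy] and tg = tensor_op[OF gU.bounded gV.bounded]
    have "(\<lambda>z. ?\<Gamma> ((x \<otimes> y) z)) = (\<lambda>z. (-1) *\<^sub>C (x \<otimes> y) (?\<Gamma> z))"
      by (rule tens_op_eqI[OF bounded_clinear_compose[OF tg(1) t(1)]
            bounded_clinear_scaleC[OF bounded_clinear_compose[OF t(1) tg(1)]]])
        (simp add: t tg that(3) complex_vector.scale_minus_left scaleC_one)
    from fun_cong[OF this, of z] show "?\<Gamma> ((x \<otimes> y) z) = - (x \<otimes> y) (?\<Gamma> z)"
      by (simp add: complex_vector.scale_minus_left scaleC_one)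
  qed
  \<comment> \<open>Multiplying by U \<otimes> V cancels the factor V and leaves the twist of x in
    the first tensor factor; this is why V was attached to odd x.\<close>
  have tw_odd_M: "twist ?\<Gamma> (x \<otimes> V) = (\<lambda>u. \<i> *\<^sub>C U (x u)) \<otimes> id" if x: "bounded_clinear x" "odd_op U x" for x
  proof -
    have "odd_op ?\<Gamma> (x \<otimes> V)"
      using x(2)[unfolded gU.odd_op_iff] by (intro odd_tensor x gV.bounded) (simp add: tens_simps)
    note o = \<Gamma>.twist_odd[OF this]
    note t = tensor_op[OF x(1) gV.bounded] and tg = tensor_op[OF gU.bounded gV.bounded]
    note iUx = bounded_clinear_scaleC[OF bounded_clinear_compose[OF gU.bounded x(1)], of \<i>]
    show ?thesis
      unfolding o
      by (rule tensor_op_eqI[OF iUx bounded_clinear_id(1) bounded_clinear_scaleC[OF bounded_clinear_compose[OF tg(1) t(1)]]])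
        (simp add: t tg tens_linear gV.involution)
  qed
  \<comment> \<open>Here U \<otimes> V supplies the factor U that graded generators carry in front
    of an odd second factor.\<close>
  have tw_odd_N: "twist ?\<Gamma> (id \<otimes> y) = U \<otimes> (\<lambda>v. \<i> *\<^sub>C V (y v))" if y: "bounded_clinear y" "odd_op V y" for y
  proof -
    have "odd_op ?\<Gamma> (id \<otimes> y)"
      using y(2)[unfolded gV.odd_op_iff] by (intro odd_tensor y bounded_clinear_id) (simp add: tens_simps)
    note o = \<Gamma>.twist_odd[OF this]
    note t = tensor_op[OF bounded_clinear_id(1) y(1)] and tg = tensor_op[OF gU.bounded gV.bounded]
    note iVy = bounded_clinear_scaleC[OF bounded_clinear_compose[OF gV.bounded y(1)], of \<i>]
    show ?thesis
      unfolding o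
      by (rule tensor_op_eqI[OF gU.bounded iVy bounded_clinear_scaleC[OF bounded_clinear_compose[OF tg(1) t(1)]]])
        (simp add: t tg tens_linear)
  qed
  \<comment> \<open>Each twisted generator on the commutant side is a generator built from twisted
    commutants or a sum of two of them, so commuting with the latter is enough.\<close>
  have Q_to_Gt: "commutant ?Gt \<subseteq> twist ?\<Gamma> ` commutant ?Q"
    unfolding \<Gamma>.twist_commutant[OF Q]
  proof
    fix D assume D: "D \<in> commutant ?Gt"
    note linD = bounded_clinearD[OF commutant_bounded[OF D]]
    note comm = commutantD[OF D]
    show "D \<in> commutant (twist ?\<Gamma> ` ?Q)"
    proof (rule commutantI[OF commutant_bounded[OF D]])
      fix S z assume "S \<in> twist ?\<Gamma> ` ?Q"
      then obtain q where q: "q \<in> ?Q" "S = twist ?\<Gamma> q" by blast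
      from q(1) show "D (S z) = S (D z)"
      proof (cases rule: cograded_generators_cases)
        case (1 x)
        show ?thesis
          unfolding q(2) 1(3) tw_even_M[OF M's(1)[OF 1(1)] 1(2)]
          by (rule comm[OF graded_generatorsI(1)[OF gU.even_mem_twisted_commutant[OF 1(1,2)]]])
      next
        case (2 x)
        show ?thesis
          unfolding q(2) 2(3) tw_odd_M[OF M's(1)[OF 2(1)] 2(2)]
          by (rule comm[OF graded_generatorsI(1)[OF gU.odd_mem_twisted_commutant[OF 2(1,2)]]])
      next
        case (3 y)
        note p = partsN'[OF 3(1)] and d = gV.decomposition(1,2)[of y] and b = gV.part_bounded[OF N's(1)[OF 3(1)]]
        have y: "id \<otimes> y = (\<lambda>z. (id \<otimes> even_part V y) z + (id \<otimes> odd_part V y) z)"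
          by (subst gV.decomposition(3)[of y]) (rule ext, rule tensor_op_add_right[OF bounded_clinear_id(1) b])
        note te = tensor_op[OF bounded_clinear_id(1) b(1)] and to = tensor_op[OF bounded_clinear_id(1) b(2)]
        have "twist ?\<Gamma> (id \<otimes> y) z = twist ?\<Gamma> (id \<otimes> even_part V y) z + twist ?\<Gamma> (id \<otimes> odd_part V y) z" for z
          unfolding y \<Gamma>.twist_conj[OF te(1)] \<Gamma>.twist_conj[OF to(1)] \<Gamma>.twist_conj[OF bounded_clinear_add[OF te(1) to(1)]]
          by (simp add: \<Gamma>.fb_lin scaleC_add_right)
        then have S: "S z = (id \<otimes> even_part V y) z + (U \<otimes> (\<lambda>v. \<i> *\<^sub>C V (odd_part V y v))) z" for z
          unfolding q(2) 3(2) tw_even_N[OF b(1) d(1)] tw_odd_N[OF b(2) d(2)] .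
        show ?thesis
          unfolding S linD comm[OF graded_generatorsI(2)[OF gV.even_mem_twisted_commutant[OF p(1) d(1)] d(1)]]
            comm[OF graded_generatorsI(3)[OF gV.odd_mem_twisted_commutant[OF p(2) d(2)] gV.odd_op_twist[OF d(2)]]] ..
      qed
    qed
  qed
  \<comment> \<open>This is the easy inclusion: generators built from twisted commutants are sums of
    twisted operators that commute with \<open>?G\<close> before twisting.\<close>
  have Gt_sub: "?Gt \<subseteq> commutant (twist ?\<Gamma> ` ?G)"
  proof -
    have sG: "unital_star_subalgebra (commutant (twist ?\<Gamma> ` ?G))"
    proof (rule commutant_star_subalgebra)
      show "twist ?\<Gamma> ` ?G \<subseteq> Collect bounded_clinear" using \<Gamma>.twist_bounded G by blast
      fix S assume "S \<in> twist ?\<Gamma> ` ?G"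
      then obtain T where T: "T \<in> ?G" "S = twist ?\<Gamma> T" by blast
      have "cadjoint T \<in> ?G" by (rule graded_generators_adjoint[OF b Ms(7) Ns(7) T(1)])
      moreover have "cadjoint S = twist ?\<Gamma> (cadjoint T)"
        unfolding T(2) by (rule \<Gamma>.twist_cadjoint) (use T(1) G in blast)
      ultimately show "cadjoint S \<in> twist ?\<Gamma> ` ?G" by blast
    qed
    have q: "twist ?\<Gamma> T \<in> commutant (twist ?\<Gamma> ` ?G)" if "T \<in> ?Q" for T
      unfolding \<Gamma>.twist_commutant[OF G, symmetric] using cograded_generators_commute[OF b] that by blast
    show ?thesis
    proof
      fix T assume "T \<in> ?Gt"
      then show "T \<in> commutant (twist ?\<Gamma> ` ?G)"
      proof (cases rule: graded_generators_cases)
        case (1 x)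
        then obtain s where s: "s \<in> ?M'" "x = twist U s" unfolding twisted_commutant_def by blast
        note p = partsM'[OF s(1)] and d = gU.decomposition(1,2)[of s] and bs = gU.part_bounded[OF M's(1)[OF s(1)]]
        note iUs = bounded_clinear_scaleC[OF bounded_clinear_compose[OF gU.bounded bs(2)], of \<i>]
        have "T = (\<lambda>z. twist ?\<Gamma> (even_part U s \<otimes> id) z + twist ?\<Gamma> (odd_part U s \<otimes> V) z)"
          unfolding tw_even_M[OF bs(1) d(1)] tw_odd_M[OF bs(2) d(2)] 1(2) s(2) twist_def[of U] fun_eq_iff
          by (rule allI, rule tensor_op_add_left[OF bs(1) iUs bounded_clinear_id(1)])
        also have "\<dots> \<in> commutant (twist ?\<Gamma> ` ?G)"
          by (rule unital_star_subalgebraD(4)[OF sG q[OF cograded_generatorsI(1)[OF p(1) d(1)]]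
                q[OF cograded_generatorsI(2)[OF p(2) d(2)]]])
        finally show ?thesis .
      next
        case (2 y)
        then obtain s where s: "s \<in> ?N'" "y = twist V s" unfolding twisted_commutant_def by blast
        have y: "y = even_part V s" using gV.parts_twist(1)[of s] gV.parts_of_even(1)[OF 2(2)] s(2) by simp
        have "even_part V s \<in> ?N'" by (rule partsN'(1)[OF s(1)])
        from q[OF cograded_generatorsI(3)[OF this]] show ?thesis
          unfolding 2(3) y tw_even_N[OF gV.part_bounded(1)[OF N's(1)[OF s(1)]] gV.decomposition(1)] .
      next
        case (3 y)
        then obtain s where s: "s \<in> ?N'" "y = twist V s" unfolding twisted_commutant_def by blast
        have y: "y = (\<lambda>v. \<i> *\<^sub>C V (odd_part V s v))"
          using gV.parts_twist(2)[of s] gV.parts_of_odd(2)[OF 3(2)] s(2) by simp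
        have "odd_part V s \<in> ?N'" by (rule partsN'(2)[OF s(1)])
        from q[OF cograded_generatorsI(3)[OF this]] show ?thesis
          unfolding 3(3) y tw_odd_N[OF gV.part_bounded(2)[OF N's(1)[OF s(1)]] gV.decomposition(2)] .
      qed
    qed
  qed
  have tG: "twist ?\<Gamma> ` ?G \<subseteq> Collect bounded_clinear" using \<Gamma>.twist_bounded G by blast
  have "commutant (twist ?\<Gamma> ` ?G) = commutant (commutant ?Gt)"
  proof
    show "commutant (commutant ?Gt) \<subseteq> commutant (twist ?\<Gamma> ` ?G)"
      using commutant_antimono[OF commutant_antimono[OF Gt_sub]] unfolding triple_commutant[OF tG] .
    show "commutant (twist ?\<Gamma> ` ?G) \<subseteq> commutant (commutant ?Gt)"
    proof
      \<comment> \<open>Both R and S are untwisted, the graded commutation theorem is applied to the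
        resulting C and D, and multiplicativity of the twist carries the relation back.\<close>
      fix R assume R: "R \<in> commutant (twist ?\<Gamma> ` ?G)"
      then obtain C where C: "C \<in> commutant ?G" "R = twist ?\<Gamma> C"
        unfolding \<Gamma>.twist_commutant[OF G, symmetric] by blast
      show "R \<in> commutant (commutant ?Gt)"
      proof (rule commutantI[OF commutant_bounded[OF R]])
        fix S z assume "S \<in> commutant ?Gt"
        then obtain D where D: "D \<in> commutant ?Q" "S = twist ?\<Gamma> D" using Q_to_Gt by blast
        note bC = commutant_bounded[OF C(1)] and bD = commutant_bounded[OF D(1)]
        have "(\<lambda>z. C (D z)) = (\<lambda>z. D (C z))"
          using graded_commutation[OF assms(4,5) invM invN C(1) D(1)] by blast
        then show "R (S z) = S (R z)"
          unfolding C(2) D(2) \<Gamma>.twist_comp[OF bC bD] \<Gamma>.twist_comp[OF bD bC] by simp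
      qed
    qed
  qed
  then show ?thesis
    unfolding twisted_commutant_def[of ?\<Gamma>] alg algt triple_commutant[OF G] \<Gamma>.twist_commutant[OF G] .
qed

end
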